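(* Let $G$ be a subcubic outerplanar graph (an outerplanar graph with maximum degree at most $3$). Then $\chi'_{st}(G) \le 5$.
   Context: A star edge coloring of a graph $G$ is a proper edge coloring of $G$ such that there is no bichromatic path and no bichromatic cycle of length four (i.e., every path and every cycle with four edges uses at least three distinct colors). The star chromatic index $\chi'_{st}(G)$ is the minimum number of colors for which $G$ admits a star edge coloring. *)

theory Defs
  imports "HOL-Analysis.Analysis"
begin

locale finite_simple_graph =
  fixes V :: "'a set" and E :: "'a set set"
  assumes finite_vertices: "finite V"
    and edges_in_vertices: "e \<in> E \<Longrightarrow> e \<subseteq> V"
    and edges_two_ends: "e \<in> E \<Longrightarrow> card e = 2"
begin

lemma finite_edges: "finite E"
  using finite_vertices edges_in_vertices by (meson PowI finite_Pow_iff finite_subset subsetI)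

end

definition vertex_degree :: "'a set set \<Rightarrow> 'a \<Rightarrow> nat" where
  "vertex_degree E v = card {e \<in> E. v \<in> e}"

definition subcubic :: "'a set \<Rightarrow> 'a set set \<Rightarrow> bool" where
  "subcubic V E \<longleftrightarrow> (\<forall>v\<in>V. vertex_degree E v \<le> 3)"

text \<open>Edges are drawn as arbitrary (not necessarily polygonal) simple arcs in the plane. Distinct
  edges may meet only in the image of a common end vertex.\<close>

definition plane_drawing ::
    "'a set \<Rightarrow> 'a set set \<Rightarrow> ('a \<Rightarrow> complex) \<Rightarrow> ('a set \<Rightarrow> real \<Rightarrow> complex) \<Rightarrow> bool" where
  "plane_drawing V E pos \<gamma> \<longleftrightarrow>
     inj_on pos V \<and>
     (\<forall>e\<in>E. arc (\<gamma> e) \<and> {pathstart (\<gamma> e), pathfinish (\<gamma> e)} = pos ` e) \<and>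
     (\<forall>e\<in>E. \<forall>v\<in>V. v \<notin> e \<longrightarrow> pos v \<notin> path_image (\<gamma> e)) \<and>
     (\<forall>e\<in>E. \<forall>f\<in>E. e \<noteq> f \<longrightarrow> path_image (\<gamma> e) \<inter> path_image (\<gamma> f) \<subseteq> pos ` (e \<inter> f))"

definition drawing_image ::
    "'a set \<Rightarrow> 'a set set \<Rightarrow> ('a \<Rightarrow> complex) \<Rightarrow> ('a set \<Rightarrow> real \<Rightarrow> complex) \<Rightarrow> complex set" where
  "drawing_image V E pos \<gamma> = pos ` V \<union> (\<Union>e\<in>E. path_image (\<gamma> e))"

text \<open>The image of a drawing of a finite graph is compact, so its complement has exactly one
  unbounded component; hence \<^const>\<open>outside\<close> is the outer face.\<close>

definition outerplanar :: "'a set \<Rightarrow> 'a set set \<Rightarrow> bool" where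
  "outerplanar V E \<longleftrightarrow>
     (\<exists>pos \<gamma>. plane_drawing V E pos \<gamma> \<and>
        pos ` V \<subseteq> frontier (outside (drawing_image V E pos \<gamma>)))"

definition walk_edges :: "'a list \<Rightarrow> 'a set list" where
  "walk_edges p = map (\<lambda>(u, v). {u, v}) (zip p (tl p))"

definition is_path :: "'a set \<Rightarrow> 'a set set \<Rightarrow> 'a list \<Rightarrow> bool" where
  "is_path V E p \<longleftrightarrow> p \<noteq> [] \<and> distinct p \<and> set p \<subseteq> V \<and> set (walk_edges p) \<subseteq> E"

text \<open>A cycle is given by its vertices, each listed once; the closing edge joins the last
  to the first.\<close>

definition cycle_edges :: "'a list \<Rightarrow> 'a set list" where
  "cycle_edges p = walk_edges (p @ [hd p])"

definition is_cycle :: "'a set \<Rightarrow> 'a set set \<Rightarrow> 'a list \<Rightarrow> bool" where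
  "is_cycle V E p \<longleftrightarrow> length p \<ge> 3 \<and> distinct p \<and> set p \<subseteq> V \<and> set (cycle_edges p) \<subseteq> E"

definition proper_edge_coloring :: "'a set set \<Rightarrow> ('a set \<Rightarrow> 'c) \<Rightarrow> bool" where
  "proper_edge_coloring E c \<longleftrightarrow>
     (\<forall>e\<in>E. \<forall>f\<in>E. e \<noteq> f \<and> e \<inter> f \<noteq> {} \<longrightarrow> c e \<noteq> c f)"

definition star_edge_coloring :: "'a set \<Rightarrow> 'a set set \<Rightarrow> ('a set \<Rightarrow> 'c) \<Rightarrow> bool" where
  "star_edge_coloring V E c \<longleftrightarrow>
     proper_edge_coloring E c \<and>
     (\<forall>p. is_path V E p \<and> length (walk_edges p) = 4 \<longrightarrow> card (c ` set (walk_edges p)) \<ge> 3) \<and>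
     (\<forall>p. is_cycle V E p \<and> length (cycle_edges p) = 4 \<longrightarrow> card (c ` set (cycle_edges p)) \<ge> 3)"

definition star_edge_colorable :: "'a set \<Rightarrow> 'a set set \<Rightarrow> nat \<Rightarrow> bool" where
  "star_edge_colorable V E k \<longleftrightarrow>
     (\<exists>c :: 'a set \<Rightarrow> nat. c ` E \<subseteq> {..<k} \<and> star_edge_coloring V E c)"

definition star_chromatic_index :: "'a set \<Rightarrow> 'a set set \<Rightarrow> nat" where
  "star_chromatic_index V E = (LEAST k. star_edge_colorable V E k)"

text \<open>The minimum in \<^const>\<open>star_chromatic_index\<close> is attained: giving all edges different colors
  is a star edge coloring.\<close>

lemma length_walk_edges [simp]: "length (walk_edges p) = length p - 1"
  by (simp add: walk_edges_def)

lemma card_walk_edges_path: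
  assumes "distinct p" "length p = 5"
  shows "card (set (walk_edges p)) = 4"
proof -
  obtain a b c d e where "p = [a, b, c, d, e]"
    using assms(2) by (auto simp: length_Suc_conv numeral_eq_Suc)
  then show ?thesis
    using assms(1) by (auto simp: walk_edges_def doubleton_eq_iff card_insert_if)
qed

lemma card_cycle_edges_cycle:
  assumes "distinct p" "length p = 4"
  shows "card (set (cycle_edges p)) = 4"
proof -
  obtain a b c d where "p = [a, b, c, d]"
    using assms(2) by (auto simp: length_Suc_conv numeral_eq_Suc)
  then show ?thesis
    using assms(1) by (auto simp: cycle_edges_def walk_edges_def doubleton_eq_iff card_insert_if)
qed

lemma inj_on_star_edge_coloring:
  fixes E :: "'a set set"
  assumes "inj_on c E"
  shows "star_edge_coloring V E c"
proof -
  have "card (c ` F) = card F" if "F \<subseteq> E" for F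
    using assms that by (meson card_image inj_on_subset)
  moreover have "proper_edge_coloring E c"
    using assms by (auto simp: proper_edge_coloring_def inj_on_def)
  moreover have "length (cycle_edges p) = length p" for p :: "'a list"
    by (simp add: cycle_edges_def)
  ultimately show ?thesis
    by (auto simp: star_edge_coloring_def is_path_def is_cycle_def card_walk_edges_path
        card_cycle_edges_cycle)
qed

lemma (in finite_simple_graph) star_edge_colorable_card: "star_edge_colorable V E (card E)"
proof -
  obtain c where "bij_betw c E {..<card E}"
    using ex_bij_betw_finite_nat[OF finite_edges] by (auto simp: atLeast0LessThan)
  then show ?thesis
    unfolding star_edge_colorable_def
    by (intro exI[of _ c]) (auto simp: bij_betw_def intro: inj_on_star_edge_coloring)
qed

lemma (in finite_simple_graph) star_edge_colorable_star_chromatic_index: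
  "star_edge_colorable V E (star_chromatic_index V E)"
  unfolding star_chromatic_index_def using star_edge_colorable_card by (rule LeastI)

end

(* Outerplanarity is used only through two consequences of the Jordan curve theorem and Janiszewski's
   theorem: there are no three internally disjoint paths with common ends that all have inner vertices,
   and no cycle has two crossing chords. Both properties pass to subsets of the edges, so consider a
   minimal edge set without a star coloring with five colors.

   A coloring is a star coloring iff it is proper and no path x y z has both the color of yz present at x
   and the color of xy present at z. Around a bridge one can make all five colors different, so by
   permuting colors a bridge with two non-leaf ends is impossible. Hence the vertices of a longest cycle
   have, besides their cycle edges, only leaves and noncrossing chords. Take a chord uv and a side of it
   with at least two inner vertices, of minimal length: all chords on that side cut off triangles, and the
   side is a sequence of pendant vertices (p) and triangles (t). If it contains one of the blocks pppp,
   ppt, ptp, tpp, tt, tpt, then the block can be deleted and recolored for any coloring of the rest.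
   Otherwise the whole side is one of t, pp, pt, tp, ppp, and a coloring of the graph in which that side
   is deleted up to its two end edges extends as well. Chordless cycles and 4-cycles with a chord are
   similar. Each of these extension claims is a finite statement about colors. *)
theory Submission
  imports Defs
begin

section \<open>Theta curves and the outer face\<close>

text \<open>The star condition reaches two edges away, so extending a coloring into a deleted arc
  could depend on much more than the colors at its ends. Keeping the two end edges of the arc as
  pendant edges localizes this: every condition centered beyond an end is already settled by the old
  coloring, and those centered at an end hold once the new edges at the first and last inner
  vertices avoid the colors of the old edges there. The listed blocks have room to avoid all colors
  at both ends, whatever these are, so they are reducible without knowing how the ends are
  connected. For a short whole side of a chord a weaker claim is used that exploits the chord: its
  color has to be avoided only in special cases, and if the colors leaving the chord coincide or
  match crosswise, the pendant end edges are recolored beforehand. The bridge step uses up all five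
  colors, as two ends of degree three see three colors each and share one. A longest cycle is taken
  because a path that leaves it and returns would lengthen it or form a theta, so that only leaves
  hang on it.\<close>

definition arc_between :: "complex set \<Rightarrow> complex \<Rightarrow> complex \<Rightarrow> bool" where
  "arc_between A a b \<longleftrightarrow> (\<exists>g. arc g \<and> pathstart g = a \<and> pathfinish g = b \<and> path_image g = A)"

lemma arc_between_sym: "arc_between A a b \<Longrightarrow> arc_between A b a"
  unfolding arc_between_def
  by (metis arc_reversepath path_image_reversepath pathfinish_reversepath pathstart_reversepath)

lemma arc_between_ends: "arc_between A a b \<Longrightarrow> a \<in> A \<and> b \<in> A \<and> a \<noteq> b"
  unfolding arc_between_def
  by (metis arc_distinct_ends pathfinish_in_path_image pathstart_in_path_image)

lemma arc_between_compact: "arc_between A a b \<Longrightarrow> compact A"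
  unfolding arc_between_def using compact_arc_image by blast

lemma arc_between_connected: "arc_between A a b \<Longrightarrow> connected A"
  unfolding arc_between_def using connected_arc_image by blast

lemma arc_between_interior:
  assumes "arc_between A a b"
  shows "connected (A - {a, b})" "A - {a, b} \<noteq> {}"
  using assms unfolding arc_between_def
  by (metis arc_imp_simple_path connected_simple_path_endless,
      metis arc_imp_simple_path nonempty_simple_path_endless)

text \<open>A connected set with two points has no isolated point, and removing finitely many points
  preserves limit points.\<close>

lemma arc_between_closure:
  assumes "arc_between A a b"
  shows "A \<subseteq> closure (A - {a, b})"
proof -
  have cA: "connected A" and inf: "A - {a, b} \<noteq> {}"
    using arc_between_connected[OF assms] arc_between_interior(2)[OF assms] by auto
  then have "x islimpt A" if "x \<in> A" for x
    using connected_imp_perfect[OF cA] that arc_between_ends[OF assms] by fastforce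
  then have "x islimpt (A - {a, b})" if "x \<in> A" for x
    using that islimpt_finite islimpt_Un[of x "A - {a, b}" "A \<inter> {a, b}"]
    by (metis Un_Diff_Int finite.emptyI finite.insertI finite_Int)
  then show ?thesis
    by (simp add: closure_def subset_iff)
qed

lemma Jordan_arcs:
  assumes "arc_between A a b" "arc_between B a b" "A \<inter> B \<subseteq> {a, b}"
  shows "open (inside (A \<union> B))" "connected (inside (A \<union> B))" "inside (A \<union> B) \<noteq> {}"
    "connected (outside (A \<union> B))" "frontier (inside (A \<union> B)) = A \<union> B"
proof -
  obtain g h where g: "arc g" "pathstart g = a" "pathfinish g = b" "path_image g = A"
    and h: "arc h" "pathstart h = a" "pathfinish h = b" "path_image h = B"
    using assms(1,2) unfolding arc_between_def by blast
  let ?c = "g +++ reversepath h"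
  have "simple_path ?c"
    using g h assms(3) by (intro simple_path_join_loop) (auto simp: arc_reversepath)
  moreover have "pathfinish ?c = pathstart ?c" "path_image ?c = A \<union> B"
    using g h by (auto simp: path_image_join)
  ultimately show "open (inside (A \<union> B))" "connected (inside (A \<union> B))" "inside (A \<union> B) \<noteq> {}"
    "connected (outside (A \<union> B))" "frontier (inside (A \<union> B)) = A \<union> B"
    using Jordan_inside_outside[of ?c] by auto
qed

text \<open>A single point of \<open>C\<close> inside the closed curve forces all of
  \<open>C\<close> except its ends to lie there. This transfers information about the arc to every
  vertex drawn on it.\<close>

lemma inside_split_arc:
  assumes "arc_between A a b" "arc_between B a b" "arc_between C a b"
    and "A \<inter> B \<subseteq> {a, b}" "A \<inter> C \<subseteq> {a, b}" "B \<inter> C \<subseteq> {a, b}"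
    and "C \<inter> inside (A \<union> B) \<noteq> {}"
  shows "inside (A \<union> C) \<inter> inside (B \<union> C) = {}"
    "inside (A \<union> C) \<union> inside (B \<union> C) \<union> (C - {a, b}) = inside (A \<union> B)"
proof -
  obtain f g h where f: "arc f" "pathstart f = a" "pathfinish f = b" "path_image f = A"
    and g: "arc g" "pathstart g = a" "pathfinish g = b" "path_image g = B"
    and h: "arc h" "pathstart h = a" "pathfinish h = b" "path_image h = C"
    using assms(1,2,3) unfolding arc_between_def by blast
  have ab: "a \<noteq> b" "a \<in> A" "b \<in> A" "a \<in> B" "b \<in> B" "a \<in> C" "b \<in> C"
    using arc_between_ends assms(1,2,3) by auto
  then have eq: "A \<inter> B = {a, b}" "A \<inter> C = {a, b}" "B \<inter> C = {a, b}"
    using assms(4-6) by auto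
  have "inside (path_image f \<union> path_image h) \<inter> inside (path_image g \<union> path_image h) = {} \<and>
    inside (path_image f \<union> path_image h) \<union> inside (path_image g \<union> path_image h) \<union>
      (path_image h - {a, b}) = inside (path_image f \<union> path_image g)"
    by (rule split_inside_simple_closed_curve[of f a b g h])
      (use f g h ab eq assms(7) in \<open>auto simp: arc_imp_simple_path\<close>)
  then show "inside (A \<union> C) \<inter> inside (B \<union> C) = {}"
    "inside (A \<union> C) \<union> inside (B \<union> C) \<union> (C - {a, b}) = inside (A \<union> B)"
    using f g h by auto
qed

text \<open>Each inside is connected and, by the last two assumptions, misses the frontier of the
  other. Overlapping insides would therefore contain each other and have equal frontiers, which
  leaves \<open>B\<close> nothing but its ends.\<close>

lemma theta_insides_disjoint:
  assumes "arc_between A a b" "arc_between B a b" "arc_between C a b"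
    and "A \<inter> B \<subseteq> {a, b}" "A \<inter> C \<subseteq> {a, b}" "B \<inter> C \<subseteq> {a, b}"
    and "C \<inter> inside (A \<union> B) = {}" "B \<inter> inside (A \<union> C) = {}"
  shows "inside (A \<union> B) \<inter> inside (A \<union> C) = {}"
proof (rule ccontr)
  assume meet: "inside (A \<union> B) \<inter> inside (A \<union> C) \<noteq> {}"
  have sub: "inside (A \<union> X) \<subseteq> inside (A \<union> Y)"
    if X: "arc_between X a b" "A \<inter> X \<subseteq> {a, b}" and Y: "arc_between Y a b" "A \<inter> Y \<subseteq> {a, b}"
      and "Y \<inter> inside (A \<union> X) = {}" "inside (A \<union> X) \<inter> inside (A \<union> Y) \<noteq> {}" for X Y
  proof (rule ccontr)
    assume "\<not> ?thesis"
    then have "inside (A \<union> X) \<inter> frontier (inside (A \<union> Y)) \<noteq> {}"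
      using connected_Int_frontier[OF Jordan_arcs(2)[OF assms(1) X]] that(6) by blast
    then show False
      using Jordan_arcs(5)[OF assms(1) Y] that(5) inside_no_overlap[of "A \<union> X"] by blast
  qed
  have "inside (A \<union> B) = inside (A \<union> C)"
    using sub[of B C] sub[of C B] meet assms by blast
  then have "A \<union> B = A \<union> C"
    using Jordan_arcs(5) assms(1-5) by metis
  then have "B \<subseteq> {a, b}"
    using assms(4,6) by blast
  then show False
    using arc_between_interior(2)[OF assms(2)] by blast
qed

text \<open>If no arc of a theta curve were inside the closed curve formed by the two others, then a point
  inside \<open>B \<union> C\<close> could be joined to infinity avoiding \<open>A \<union> B\<close>, and also avoiding \<open>A \<union> C\<close>. Both
  avoided sets share the connected set \<open>A\<close>, so Janiszewski's theorem gives a contradiction.\<close>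

lemma theta_arc_inside:
  assumes "arc_between A a b" "arc_between B a b" "arc_between C a b"
    and "A \<inter> B \<subseteq> {a, b}" "A \<inter> C \<subseteq> {a, b}" "B \<inter> C \<subseteq> {a, b}"
  shows "A \<inter> inside (B \<union> C) \<noteq> {} \<or> B \<inter> inside (A \<union> C) \<noteq> {} \<or> C \<inter> inside (A \<union> B) \<noteq> {}"
proof (rule ccontr)
  assume "\<not> ?thesis"
  then have out: "A \<inter> inside (B \<union> C) = {}" "B \<inter> inside (A \<union> C) = {}" "C \<inter> inside (A \<union> B) = {}"
    by auto
  obtain p where p: "p \<in> inside (B \<union> C)"
    using Jordan_arcs(3)[OF assms(2,3,6)] by blast
  have cpt: "compact A" "compact B" "compact C"
    using assms arc_between_compact by auto
  then have "bounded (A \<union> B \<union> C)"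
    by (simp add: compact_imp_bounded)
  then obtain q where "q \<in> outside (A \<union> B \<union> C)"
    using outside_bounded_nonempty by blast
  then have q: "q \<in> outside (A \<union> B)" "q \<in> outside (A \<union> C)" "q \<in> outside (B \<union> C)"
    using outside_mono[of "A \<union> B" "A \<union> B \<union> C"] outside_mono[of "A \<union> C" "A \<union> B \<union> C"]
      outside_mono[of "B \<union> C" "A \<union> B \<union> C"] by auto
  have "p \<notin> inside (A \<union> B)"
    using theta_insides_disjoint[of B a b A C] assms out p arc_between_sym
    by (auto simp: Un_commute Int_commute)
  moreover have "p \<notin> inside (A \<union> C)"
    using theta_insides_disjoint[of C a b A B] assms out p
    by (auto simp: Un_commute Int_commute)
  moreover have "p \<notin> A \<union> B \<union> C"
    using p out(1) inside_no_overlap[of "B \<union> C"] by blast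
  ultimately have pout: "p \<in> outside (A \<union> B)" "p \<in> outside (A \<union> C)"
    using inside_Un_outside[of "A \<union> B"] inside_Un_outside[of "A \<union> C"] by blast+
  have "connected_component (- (A \<union> B)) p q" "connected_component (- (A \<union> C)) p q"
    using Jordan_arcs(4)[OF assms(1,2,4)] Jordan_arcs(4)[OF assms(1,3,5)] pout q
      outside_no_overlap[of "A \<union> B"] outside_no_overlap[of "A \<union> C"]
    unfolding connected_component_def by blast+
  moreover have "(A \<union> B) \<inter> (A \<union> C) = A"
    using assms(6) arc_between_ends[OF assms(1)] by auto
  ultimately have "connected_component (- ((A \<union> B) \<union> (A \<union> C))) p q"
    using Janiszewski[of "A \<union> B" "A \<union> C" p q] cpt arc_between_connected[OF assms(1)]
    by (simp add: compact_Un compact_imp_closed)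
  then have "connected_component (- (B \<union> C)) p q"
    by (rule connected_component_of_subset) auto
  then have "q \<in> inside (B \<union> C)"
    using p inside_same_component by blast
  then show False
    using q(3) inside_Int_outside by blast
qed

text \<open>A larger set has a smaller \<open>outside\<close>, so the open set
  \<open>inside Z\<close> is disjoint from \<open>outside X\<close> and hence from its
  closure.\<close>

lemma inside_not_outer_frontier:
  fixes Z :: "complex set"
  assumes "closed Z" "Z \<subseteq> X" "v \<in> inside Z"
  shows "v \<notin> frontier (outside X)"
proof -
  have "open (inside Z)"
    using assms(1) by (rule open_inside)
  moreover have "inside Z \<inter> outside X = {}"
    using outside_mono[OF assms(2)] inside_Int_outside[of Z] by blast
  ultimately have "inside Z \<inter> closure (outside X) = {}"
    using open_Int_closure_eq_empty by blast
  then show ?thesis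
    using assms(3) by (auto simp: frontier_def)
qed

text \<open>An arc entering the inside would lie there up to its ends and take \<open>v\<close> with
  it, but no point of the inside is on the frontier of the outer face.\<close>

lemma theta_outer_vertex:
  assumes "arc_between A a b" "arc_between B a b" "arc_between C a b"
    and "A \<inter> B \<subseteq> {a, b}" "A \<inter> C \<subseteq> {a, b}" "B \<inter> C \<subseteq> {a, b}"
    and "A \<union> B \<subseteq> X" "v \<in> C - {a, b}" "v \<in> frontier (outside X)"
  shows "C \<inter> inside (A \<union> B) = {}"
proof (rule ccontr)
  assume "\<not> ?thesis"
  then have "v \<in> inside (A \<union> B)"
    using inside_split_arc(2)[OF assms(1-6)] assms(8) by blast
  moreover have "closed (A \<union> B)"
    using assms(1,2) arc_between_compact compact_imp_closed by blast
  ultimately show False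
    using inside_not_outer_frontier assms(7,9) by blast
qed

text \<open>Some arc of a theta curve enters the inside formed by the two others, yet here each arc
  carries an outer vertex. This is the topological form of \<open>K_{2,3}\<close> not being
  outerplanar.\<close>

lemma theta_not_outer:
  assumes "arc_between A a b" "arc_between B a b" "arc_between C a b"
    and "A \<inter> B \<subseteq> {a, b}" "A \<inter> C \<subseteq> {a, b}" "B \<inter> C \<subseteq> {a, b}"
    and "A \<union> B \<union> C \<subseteq> X"
    and "u \<in> A - {a, b}" "v \<in> B - {a, b}" "w \<in> C - {a, b}"
    and "{u, v, w} \<subseteq> frontier (outside X)"
  shows False
proof -
  have "C \<inter> inside (A \<union> B) = {}"
    by (rule theta_outer_vertex[OF assms(1-6), of X w]) (use assms(7-11) in auto)
  moreover have "B \<inter> inside (A \<union> C) = {}"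
    by (rule theta_outer_vertex[of A a b C B X v]) (use assms in auto)
  moreover have "A \<inter> inside (B \<union> C) = {}"
    by (rule theta_outer_vertex[of B a b C A X u]) (use assms in auto)
  ultimately show False
    using theta_arc_inside[OF assms(1-6)] by blast
qed

text \<open>\<open>A\<close> and \<open>B\<close> carry outer vertices and cannot enter the inside
  formed by the other two arcs, so by \<open>theta_arc_inside\<close> it is \<open>C\<close> that
  does. Hence chords of an outer cycle are drawn inside it.\<close>

lemma chord_inside:
  assumes "arc_between A a b" "arc_between B a b" "arc_between C a b"
    and "A \<inter> B \<subseteq> {a, b}" "A \<inter> C \<subseteq> {a, b}" "B \<inter> C \<subseteq> {a, b}"
    and "A \<union> B \<union> C \<subseteq> X"
    and "u \<in> A - {a, b}" "v \<in> B - {a, b}"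
    and "{u, v} \<subseteq> frontier (outside X)"
  shows "C \<inter> inside (A \<union> B) \<noteq> {}"
proof -
  have "B \<inter> inside (A \<union> C) = {}"
    by (rule theta_outer_vertex[of A a b C B X v]) (use assms in auto)
  moreover have "A \<inter> inside (B \<union> C) = {}"
    by (rule theta_outer_vertex[of B a b C A X u]) (use assms in auto)
  ultimately show ?thesis
    using theta_arc_inside[OF assms(1-6)] by blast
qed

text \<open>\<open>A'\<close> and \<open>B'\<close> are the arcs of the same closed curve between
  \<open>c\<close> and \<open>d\<close>. Both chords run inside it, and \<open>C\<close> splits the
  inside into two regions. The interior of \<open>D\<close> is connected and avoids
  \<open>C\<close>, so it stays in one region, although its ends lie on different sides.\<close>

lemma crossing_chords_not_outer:
  assumes "arc_between A a b" "arc_between B a b" "arc_between C a b"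
    and "A \<inter> B \<subseteq> {a, b}" "A \<inter> C \<subseteq> {a, b}" "B \<inter> C \<subseteq> {a, b}"
    and "arc_between A' c d" "arc_between B' c d" "arc_between D c d"
    and "A' \<inter> B' \<subseteq> {c, d}" "A' \<inter> D \<subseteq> {c, d}" "B' \<inter> D \<subseteq> {c, d}"
    and "A \<union> B = A' \<union> B'" "C \<inter> D = {}"
    and "A \<union> B \<union> C \<union> D \<subseteq> X"
    and "c \<in> A - {a, b}" "d \<in> B - {a, b}" "a \<in> A' - {c, d}" "b \<in> B' - {c, d}"
    and "{a, b, c, d} \<subseteq> frontier (outside X)"
  shows False
proof -
  let ?Z = "A \<union> B"
  have C: "C \<inter> inside ?Z \<noteq> {}"
    by (rule chord_inside[OF assms(1-6), of X c d]) (use assms in auto)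
  have "D \<inter> inside (A' \<union> B') \<noteq> {}"
    by (rule chord_inside[OF assms(7-12), of X a b]) (use assms in auto)
  then have D: "D - {c, d} \<subseteq> inside ?Z"
    using inside_split_arc(2)[OF assms(7-12)] assms(13) by auto
  note split = inside_split_arc[OF assms(1-6) C]
  have D2: "D - {c, d} \<subseteq> inside (A \<union> C) \<union> inside (B \<union> C)"
    using D split(2) assms(14) by blast
  have cases: "D - {c, d} \<subseteq> inside (A \<union> C) \<or> D - {c, d} \<subseteq> inside (B \<union> C)"
    using connectedD[OF arc_between_interior(1)[OF assms(9)] Jordan_arcs(1)[OF assms(1,3,5)]
        Jordan_arcs(1)[OF assms(2,3,6)]] D2 split(1) by blast
  \<comment> \<open>The end \<open>z\<close> of \<open>D\<close> is a limit of the interior of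
    \<open>D\<close>, so it is in the closure of the region. Being on the outer cycle it is not
    inside, hence it lies on \<open>E \<union> C\<close>; but \<open>D\<close> avoids
    \<open>C\<close>, and \<open>z\<close> is not on \<open>E\<close>.\<close>
  have no: False if sub: "D - {c, d} \<subseteq> inside (E \<union> C)" and E:
    "arc_between E a b" "E \<inter> C \<subseteq> {a, b}" "inside (E \<union> C) \<subseteq> inside ?Z" "z \<in> {c, d}" "z \<notin> E" for E z
  proof -
    have "z \<in> closure (inside (E \<union> C))"
      using arc_between_closure[OF assms(9)] closure_mono[OF sub] E(4) arc_between_ends[OF assms(9)]
      by auto
    then have "z \<in> inside (E \<union> C) \<or> z \<in> frontier (inside (E \<union> C))"
      using closure_Un_frontier[of "inside (E \<union> C)"] by auto
    moreover have "z \<in> ?Z"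
      using E(4) assms(16,17) by auto
    ultimately have "z \<in> E \<union> C"
      using Jordan_arcs(5)[OF E(1) assms(3) E(2)] E(3) inside_no_overlap[of ?Z] by blast
    moreover have "z \<in> D" "z \<in> A \<union> B"
      using E(4) arc_between_ends[OF assms(9)] assms(16,17) by auto
    ultimately show False
      using E(5) assms(14) by blast
  qed
  have "d \<notin> A" "c \<notin> B"
    using assms(4,16,17) by auto
  then have "\<not> D - {c, d} \<subseteq> inside (A \<union> C)" "\<not> D - {c, d} \<subseteq> inside (B \<union> C)"
    using no[of A d] no[of B c] split(2) assms(1,2,5,6) by auto
  then show False
    using cases by blast
qed

section \<open>Paths in an outerplanar drawing\<close>

lemma arc_between_join:
  assumes "arc_between A a b" "arc_between B b c" "A \<inter> B \<subseteq> {b}"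
  shows "arc_between (A \<union> B) a c"
proof -
  obtain g h where g: "arc g" "pathstart g = a" "pathfinish g = b" "path_image g = A"
    and h: "arc h" "pathstart h = b" "pathfinish h = c" "path_image h = B"
    using assms(1,2) unfolding arc_between_def by blast
  then have "arc (g +++ h)"
    using assms(3) by (intro arc_join) auto
  moreover have "path_image (g +++ h) = A \<union> B"
    using g h by (simp add: path_image_join)
  ultimately show ?thesis
    unfolding arc_between_def using g h by (metis pathfinish_join pathstart_join)
qed

lemma walk_edges_simps [simp]:
  "walk_edges [] = []" "walk_edges [a] = []"
  "walk_edges (a # b # p) = {a, b} # walk_edges (b # p)"
  by (simp_all add: walk_edges_def)

lemma walk_edges_append: "walk_edges (p @ x # q) = walk_edges (p @ [x]) @ walk_edges (x # q)"
  by (induction p rule: induct_list012) simp_all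

lemma set_walk_edges_rev: "set (walk_edges (rev p)) = set (walk_edges p)"
proof (induction p rule: induct_list012)
  case (3 a b p)
  have "walk_edges (rev (a # b # p)) = walk_edges (rev (b # p)) @ [{b, a}]"
    using walk_edges_append[of "rev p" b "[a]"] by simp
  then show ?case
    using 3 by (auto simp: insert_commute)
qed auto

lemma walk_edges_subset: "e \<in> set (walk_edges p) \<Longrightarrow> e \<subseteq> set p"
  by (induction p rule: induct_list012) auto

lemma in_walk_edge: "v \<in> set p \<Longrightarrow> length p \<ge> 2 \<Longrightarrow> \<exists>e\<in>set (walk_edges p). v \<in> e"
proof (induction p rule: induct_list012)
  case (3 a b p)
  then show ?case by (cases p) auto
qed auto

lemma ends_not_walk_edge:
  assumes "distinct (a # p @ [b])" "p \<noteq> []"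
  shows "{a, b} \<notin> set (walk_edges (a # p @ [b]))"
proof -
  obtain c q where p: "p = c # q"
    using assms(2) by (cases p) auto
  have "a \<notin> \<Union> (set (walk_edges (c # q @ [b])))"
    using assms(1) p walk_edges_subset by fastforce
  then show ?thesis
    using assms(1) p by (auto simp: doubleton_eq_iff)
qed

text \<open>No vertex set is carried along, because the later induction passes to subsets of the
  edges. A list with one vertex always qualifies.\<close>

definition path_in :: "'a set set \<Rightarrow> 'a list \<Rightarrow> bool" where
  "path_in E p \<longleftrightarrow> distinct p \<and> set (walk_edges p) \<subseteq> E"

text \<open>Excludes subdivisions of \<open>K_{2,3}\<close>.\<close>

definition theta_free :: "'a set set \<Rightarrow> bool" where
  "theta_free E \<longleftrightarrow> (\<forall>a b p q r. path_in E (a # p @ [b]) \<longrightarrow> path_in E (a # q @ [b]) \<longrightarrow>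
     path_in E (a # r @ [b]) \<longrightarrow> p \<noteq> [] \<longrightarrow> q \<noteq> [] \<longrightarrow> r \<noteq> [] \<longrightarrow>
     set p \<inter> set q = {} \<longrightarrow> set p \<inter> set r = {} \<longrightarrow> set q \<inter> set r = {} \<longrightarrow> False)"

text \<open>The configuration is a subdivision of \<open>K_4\<close> in which the two disjoint edges
  \<open>ab\<close> and \<open>cd\<close> are not subdivided.\<close>

definition crossing_free :: "'a set set \<Rightarrow> bool" where
  "crossing_free E \<longleftrightarrow> (\<forall>a b p q c d. path_in E (a # p @ [b]) \<longrightarrow> path_in E (a # q @ [b]) \<longrightarrow>
     set p \<inter> set q = {} \<longrightarrow> {a, b} \<in> E \<longrightarrow> c \<in> set p \<longrightarrow> d \<in> set q \<longrightarrow> {c, d} \<in> E \<longrightarrow> False)"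

locale outer_drawing =
  fixes V :: "'a set" and E :: "'a set set"
    and pos :: "'a \<Rightarrow> complex" and \<gamma> :: "'a set \<Rightarrow> real \<Rightarrow> complex"
  assumes edges: "e \<in> E \<Longrightarrow> e \<subseteq> V" "e \<in> E \<Longrightarrow> card e = 2"
    and drawing: "plane_drawing V E pos \<gamma>"
    and outer: "pos ` V \<subseteq> frontier (outside (drawing_image V E pos \<gamma>))"
begin

definition trace :: "'a list \<Rightarrow> complex set" where
  "trace p = (\<Union>e\<in>set (walk_edges p). path_image (\<gamma> e))"

lemma edge_disjoint:
  "e \<in> E \<Longrightarrow> f \<in> E \<Longrightarrow> e \<noteq> f \<Longrightarrow> path_image (\<gamma> e) \<inter> path_image (\<gamma> f) \<subseteq> pos ` (e \<inter> f)"
  using drawing unfolding plane_drawing_def by blast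

lemma path_vertices:
  assumes "path_in E p" "length p \<ge> 2"
  shows "set p \<subseteq> V"
  using in_walk_edge[OF _ assms(2)] assms(1) edges(1) unfolding path_in_def by blast

lemma pos_eq: "u \<in> V \<Longrightarrow> v \<in> V \<Longrightarrow> pos u = pos v \<longleftrightarrow> u = v"
  using drawing unfolding plane_drawing_def by (auto simp: inj_on_def)

lemma edge_arc:
  assumes "{a, b} \<in> E"
  shows "arc_between (path_image (\<gamma> {a, b})) (pos a) (pos b)"
proof -
  let ?g = "\<gamma> {a, b}"
  have "arc ?g" and ends: "{pathstart ?g, pathfinish ?g} = {pos a, pos b}"
    using drawing assms unfolding plane_drawing_def by auto
  then have "arc_between (path_image ?g) (pathstart ?g) (pathfinish ?g)"
    unfolding arc_between_def by blast
  then show ?thesis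
    using ends arc_between_sym by (auto simp: doubleton_eq_iff)
qed

lemma trace_arc:
  assumes "path_in E p" "length p \<ge> 2"
  shows "arc_between (trace p) (pos (hd p)) (pos (last p))"
  using assms
proof (induction p rule: induct_list012)
  case (3 a b r)
  have ab: "{a, b} \<in> E"
    using 3 by (auto simp: path_in_def)
  show ?case
  proof (cases r)
    case Nil
    then show ?thesis
      using edge_arc[OF ab] by (simp add: trace_def)
  next
    case (Cons c s)
    have br: "path_in E (b # r)" "length (b # r) \<ge> 2"
      using 3 Cons by (auto simp: path_in_def)
    have "path_image (\<gamma> {a, b}) \<inter> path_image (\<gamma> e) \<subseteq> {pos b}" if "e \<in> set (walk_edges (b # r))" for e
    proof -
      have "a \<notin> e" "e \<in> E"
        using walk_edges_subset[OF that] 3(3) br that by (auto simp: path_in_def)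
      then show ?thesis
        using edge_disjoint[OF ab, of e] by blast
    qed
    then have "path_image (\<gamma> {a, b}) \<inter> trace (b # r) \<subseteq> {pos b}"
      by (auto simp: trace_def)
    from arc_between_join[OF edge_arc[OF ab] _ this] show ?thesis
      using 3(2)[OF br] Cons by (simp add: trace_def)
  qed
qed auto

lemma trace_vertex:
  assumes "path_in E p" "length p \<ge> 2" "v \<in> set p"
  shows "pos v \<in> trace p"
proof -
  obtain e where e: "e \<in> set (walk_edges p)" "v \<in> e"
    using in_walk_edge[OF assms(3,2)] by blast
  then have "e \<in> E"
    using assms(1) by (auto simp: path_in_def)
  then have "{pathstart (\<gamma> e), pathfinish (\<gamma> e)} = pos ` e"
    using drawing by (simp add: plane_drawing_def)
  then have "pos v \<in> path_image (\<gamma> e)"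
    using imageI[OF e(2), of pos] pathstart_in_path_image[of "\<gamma> e"] pathfinish_in_path_image[of "\<gamma> e"]
    by (metis insertE singletonD)
  then show ?thesis
    using e(1) by (auto simp: trace_def)
qed

lemma trace_inter:
  assumes "path_in E p" "path_in E q" "set (walk_edges p) \<inter> set (walk_edges q) = {}"
  shows "trace p \<inter> trace q \<subseteq> pos ` (set p \<inter> set q)"
proof -
  have "path_image (\<gamma> e) \<inter> path_image (\<gamma> f) \<subseteq> pos ` (set p \<inter> set q)"
    if "e \<in> set (walk_edges p)" "f \<in> set (walk_edges q)" for e f
  proof -
    have "e \<in> E" "f \<in> E" "e \<noteq> f"
      using that assms unfolding path_in_def by auto
    then show ?thesis
      using edge_disjoint[of e f] walk_edges_subset[OF that(1)] walk_edges_subset[OF that(2)] by blast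
  qed
  then show ?thesis
    unfolding trace_def by blast
qed

text \<open>A common edge of the two paths would be contained in \<open>{a, b}\<close> and thus
  equal it, but a path with inner vertices does not use the edge between its ends. With
  \<open>q\<close> empty this covers a chord.\<close>

lemma parallel_traces:
  assumes "path_in E (a # p @ [b])" "path_in E (a # q @ [b])" "set p \<inter> set q = {}" "p \<noteq> []"
  shows "trace (a # p @ [b]) \<inter> trace (a # q @ [b]) \<subseteq> {pos a, pos b}"
proof -
  have "e \<notin> set (walk_edges (a # q @ [b]))" if "e \<in> set (walk_edges (a # p @ [b]))" for e
  proof
    assume "e \<in> set (walk_edges (a # q @ [b]))"
    then have "e \<subseteq> {a, b}"
      using walk_edges_subset that assms(3) by fastforce
    moreover have "card e = 2"
      using that assms(1) edges(2) unfolding path_in_def by blast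
    ultimately have "e = {a, b}"
      using card_seteq[of "{a, b}" e] by (auto simp: card_insert_if split: if_splits)
    then show False
      using that ends_not_walk_edge[of a p b] assms(1,4) by (auto simp: path_in_def)
  qed
  then have "trace (a # p @ [b]) \<inter> trace (a # q @ [b]) \<subseteq> pos ` (set (a # p @ [b]) \<inter> set (a # q @ [b]))"
    by (intro trace_inter assms) blast
  moreover have "set (a # p @ [b]) \<inter> set (a # q @ [b]) = {a, b}"
    using assms(3) by auto
  ultimately show ?thesis
    by auto
qed

lemma trace_inner_vertex:
  assumes "path_in E (a # p @ [b])" "v \<in> set p"
  shows "pos v \<in> trace (a # p @ [b]) - {pos a, pos b}"
proof -
  have "v \<in> V" "a \<in> V" "b \<in> V" "v \<noteq> a" "v \<noteq> b"
    using path_vertices[OF assms(1)] assms by (auto simp: path_in_def)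
  then show ?thesis
    using trace_vertex[OF assms(1), of v] assms(2) pos_eq by auto
qed

lemma trace_drawing: "path_in E p \<Longrightarrow> trace p \<subseteq> drawing_image V E pos \<gamma>"
  unfolding trace_def drawing_image_def path_in_def by blast

lemma arc_ends: "path_in E (a # p @ [b]) \<Longrightarrow> arc_between (trace (a # p @ [b])) (pos a) (pos b)"
  using trace_arc[of "a # p @ [b]"] by simp

lemma theta_free: "theta_free E"
  unfolding theta_free_def
proof (intro allI impI)
  fix a b p q r
  assume P: "path_in E (a # p @ [b])" "path_in E (a # q @ [b])" "path_in E (a # r @ [b])"
    and ne: "p \<noteq> []" "q \<noteq> []" "r \<noteq> []"
    and dj: "set p \<inter> set q = {}" "set p \<inter> set r = {}" "set q \<inter> set r = {}"
  have "{hd p, hd q, hd r} \<subseteq> V"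
    using path_vertices P ne by (simp add: subset_iff)
  then show False
    using theta_not_outer[of "trace (a # p @ [b])" "pos a" "pos b" "trace (a # q @ [b])"
        "trace (a # r @ [b])" "drawing_image V E pos \<gamma>" "pos (hd p)" "pos (hd q)" "pos (hd r)"]
      arc_ends[OF P(1)] arc_ends[OF P(2)] arc_ends[OF P(3)]
      parallel_traces[OF P(1,2) dj(1) ne(1)] parallel_traces[OF P(1,3) dj(2) ne(1)]
      parallel_traces[OF P(2,3) dj(3) ne(2)]
      trace_drawing[OF P(1)] trace_drawing[OF P(2)] trace_drawing[OF P(3)]
      trace_inner_vertex[OF P(1)] trace_inner_vertex[OF P(2)] trace_inner_vertex[OF P(3)]
      outer ne by simp blast
qed

lemma crossing_free: "crossing_free E"
  unfolding crossing_free_def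
proof (intro allI impI)
  fix a b p q c d
  assume P: "path_in E (a # p @ [b])" "path_in E (a # q @ [b])"
    and dj: "set p \<inter> set q = {}" and ab: "{a, b} \<in> E" and cd: "c \<in> set p" "d \<in> set q" "{c, d} \<in> E"
  obtain p1 p2 where p: "p = p1 @ c # p2"
    using cd(1) split_list by metis
  obtain q1 q2 where q: "q = q1 @ d # q2"
    using cd(2) split_list by metis
  \<comment> \<open>The same cycle is cut once at \<open>a\<close>, \<open>b\<close> and once at
    \<open>c\<close>, \<open>d\<close>: \<open>?A'\<close> runs from \<open>c\<close> back to
    \<open>a\<close> and on to \<open>d\<close>, and \<open>?B'\<close> runs from \<open>c\<close>
    through \<open>b\<close> to \<open>d\<close>.\<close>
  let ?A = "a # p @ [b]" and ?B = "a # q @ [b]" and ?C = "a # [] @ [b]"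
    and ?A' = "c # (rev p1 @ a # q1) @ [d]" and ?B' = "c # (p2 @ b # rev q2) @ [d]" and ?D = "c # [] @ [d]"
  have eA: "set (walk_edges ?A) = set (walk_edges (a # p1 @ [c])) \<union> set (walk_edges (c # p2 @ [b]))"
    using walk_edges_append[of "a # p1" c "p2 @ [b]"] p by simp
  have eB: "set (walk_edges ?B) = set (walk_edges (a # q1 @ [d])) \<union> set (walk_edges (d # q2 @ [b]))"
    using walk_edges_append[of "a # q1" d "q2 @ [b]"] q by simp
  have eA': "set (walk_edges ?A') = set (walk_edges (a # p1 @ [c])) \<union> set (walk_edges (a # q1 @ [d]))"
    using walk_edges_append[of "c # rev p1" a "q1 @ [d]"] set_walk_edges_rev[of "a # p1 @ [c]"] by simp
  have eB': "set (walk_edges ?B') = set (walk_edges (c # p2 @ [b])) \<union> set (walk_edges (d # q2 @ [b]))"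
    using walk_edges_append[of "c # p2" b "rev q2 @ [d]"] set_walk_edges_rev[of "d # q2 @ [b]"] by simp
  have dist: "distinct ?A" "distinct ?B"
    using P by (auto simp: path_in_def)
  have P': "path_in E ?A'" "path_in E ?B'" "path_in E ?C" "path_in E ?D"
    using P eA eB eA' eB' dj ab cd(3) p q unfolding path_in_def by auto
  have ne: "p \<noteq> []" "q \<noteq> []" "rev p1 @ a # q1 \<noteq> []" "p2 @ b # rev q2 \<noteq> []"
    using p q by auto
  have dj': "set (rev p1 @ a # q1) \<inter> set (p2 @ b # rev q2) = {}"
    using dist dj p q by auto
  have "trace ?A \<union> trace ?B = trace ?A' \<union> trace ?B'"
    unfolding trace_def eA eB eA' eB' by blast
  moreover have "trace ?C \<inter> trace ?D = {}"
    using trace_inter[OF P'(3,4)] dist cd by (auto simp: doubleton_eq_iff)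
  moreover have "{a, b, c, d} \<subseteq> V"
    using ab cd(3) edges by auto
  ultimately show False
    using crossing_chords_not_outer[of "trace ?A" "pos a" "pos b" "trace ?B" "trace ?C"
        "trace ?A'" "pos c" "pos d" "trace ?B'" "trace ?D" "drawing_image V E pos \<gamma>"]
      arc_ends[OF P(1)] arc_ends[OF P(2)] arc_ends[OF P'(1)] arc_ends[OF P'(2)]
      arc_ends[OF P'(3)] arc_ends[OF P'(4)]
      parallel_traces[OF P(1,2) dj ne(1)] parallel_traces[OF P(1) P'(3) _ ne(1)]
      parallel_traces[OF P(2) P'(3) _ ne(2)]
      parallel_traces[OF P'(1,2) dj' ne(3)] parallel_traces[OF P'(1) P'(4) _ ne(3)]
      parallel_traces[OF P'(2) P'(4) _ ne(4)]
      trace_drawing[OF P(1)] trace_drawing[OF P(2)] trace_drawing[OF P'(1)] trace_drawing[OF P'(2)]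
      trace_drawing[OF P'(3)] trace_drawing[OF P'(4)]
      trace_inner_vertex[OF P(1) cd(1)] trace_inner_vertex[OF P(2) cd(2)]
      trace_inner_vertex[OF P'(1), of a] trace_inner_vertex[OF P'(2), of b]
      outer by (simp add: image_subset_iff)
qed

end

lemma outerplanar_theta_crossing_free:
  assumes "finite_simple_graph V E" "outerplanar V E"
  shows "theta_free E" "crossing_free E"
proof -
  obtain pos \<gamma> where d: "plane_drawing V E pos \<gamma>"
    "pos ` V \<subseteq> frontier (outside (drawing_image V E pos \<gamma>))"
    using assms(2) unfolding outerplanar_def by auto
  interpret finite_simple_graph V E
    by (rule assms(1))
  interpret outer_drawing V E pos \<gamma>
    using edges_in_vertices edges_two_ends d by unfold_locales
  show "theta_free E" "crossing_free E"
    by (rule theta_free crossing_free)+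
qed

section \<open>Star colorings in terms of the colors at a vertex\<close>

definition colors_at :: "'a set set \<Rightarrow> ('a set \<Rightarrow> nat) \<Rightarrow> 'a \<Rightarrow> nat set" where
  "colors_at E c v = c ` {e \<in> E. v \<in> e}"

text \<open>Here \<open>y\<close> is the middle vertex of a path with four edges, and the outer
  edges are seen only through the colors at \<open>z\<close> and \<open>w\<close>. Their far ends
  may coincide, so 4-cycles are covered as well. That \<open>colors_at\<close> includes the inner
  edges is harmless because of properness.\<close>

definition star_coloring :: "'a set set \<Rightarrow> ('a set \<Rightarrow> nat) \<Rightarrow> bool" where
  "star_coloring E c \<longleftrightarrow> (\<forall>y z w. {y, z} \<in> E \<longrightarrow> {y, w} \<in> E \<longrightarrow> z \<noteq> w \<longrightarrow>
     c {y, z} \<noteq> c {y, w} \<and> \<not> (c {y, w} \<in> colors_at E c z \<and> c {y, z} \<in> colors_at E c w))"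

lemma star_coloringD:
  assumes "star_coloring E c" "{y, z} \<in> E" "{y, w} \<in> E" "z \<noteq> w"
  shows "c {y, z} \<noteq> c {y, w}" "\<not> (c {y, w} \<in> colors_at E c z \<and> c {y, z} \<in> colors_at E c w)"
  using assms unfolding star_coloring_def by blast+

lemma colors_atI: "{v, w} \<in> E \<Longrightarrow> c {v, w} \<in> colors_at E c v"
  unfolding colors_at_def by blast

lemma colors_atE:
  assumes "k \<in> colors_at E c v" "\<forall>e\<in>E. card e = 2"
  obtains w where "{v, w} \<in> E" "k = c {v, w}" "w \<noteq> v"
proof -
  obtain e where e: "e \<in> E" "v \<in> e" "k = c e"
    using assms(1) unfolding colors_at_def by blast
  then obtain w where "e = {v, w}" "w \<noteq> v"
    using assms(2) card_2_iff[of e] by (metis doubleton_eq_iff insertE singletonD)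
  then show ?thesis
    using that e by blast
qed

lemma proper_star_coloring:
  assumes "star_coloring E c" "\<forall>e\<in>E. card e = 2"
  shows "proper_edge_coloring E c"
  unfolding proper_edge_coloring_def
proof (intro ballI impI)
  fix e f
  assume ef: "e \<in> E" "f \<in> E" "e \<noteq> f \<and> e \<inter> f \<noteq> {}"
  then obtain y where y: "y \<in> e" "y \<in> f"
    by blast
  then obtain z w where "e = {y, z}" "f = {y, w}"
    using assms(2) ef card_2_iff[of e] card_2_iff[of f] by (metis doubleton_eq_iff insertE singletonD)
  then show "c e \<noteq> c f"
    using star_coloringD(1)[OF assms(1), of y z w] ef by auto
qed

lemma card_four_colors:
  "p \<noteq> q \<Longrightarrow> q \<noteq> r \<Longrightarrow> r \<noteq> s \<Longrightarrow> \<not> (p = r \<and> q = s) \<Longrightarrow> card {p, q, r, s} \<ge> 3"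
  by (auto simp: card_insert_if)

text \<open>Two alternating colors would violate the condition at the middle vertex
  \<open>x\<close>. In a 4-cycle the outer edges meet in the vertex opposite to
  \<open>x\<close>.\<close>

lemma star_edge_coloring_if_star_coloring:
  assumes star: "star_coloring E c" and two: "\<forall>e\<in>E. card e = 2"
  shows "star_edge_coloring V E c"
  unfolding star_edge_coloring_def
proof (intro conjI allI impI)
  show "proper_edge_coloring E c"
    using assms by (rule proper_star_coloring)
next
  fix p
  assume p: "is_path V E p \<and> length (walk_edges p) = 4"
  then have "length p = 5"
    by auto
  then obtain a b x d e where pe: "p = [a, b, x, d, e]"
    by (auto simp: length_Suc_conv numeral_eq_Suc)
  have E: "{a, b} \<in> E" "{b, x} \<in> E" "{x, d} \<in> E" "{d, e} \<in> E" and "distinct p"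
    using p pe by (auto simp: is_path_def)
  then show "card (c ` set (walk_edges p)) \<ge> 3"
    using star_coloringD[OF star, of b a x] star_coloringD[OF star, of x b d]
      star_coloringD[OF star, of d x e] colors_atI[of b a E c] colors_atI[of d e E c]
      card_four_colors[of "c {a, b}" "c {b, x}" "c {x, d}" "c {d, e}"] pe
    by (simp add: insert_commute) metis
next
  fix p
  assume p: "is_cycle V E p \<and> length (cycle_edges p) = 4"
  then have "length p = 4"
    by (simp add: cycle_edges_def)
  then obtain a b x d where pe: "p = [a, b, x, d]"
    by (auto simp: length_Suc_conv numeral_eq_Suc)
  have E: "{a, b} \<in> E" "{b, x} \<in> E" "{x, d} \<in> E" "{d, a} \<in> E" and "distinct p"
    using p pe by (auto simp: is_cycle_def cycle_edges_def)
  then show "card (c ` set (cycle_edges p)) \<ge> 3"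
    using star_coloringD[OF star, of b a x] star_coloringD[OF star, of x b d]
      star_coloringD[OF star, of d x a] colors_atI[of b a E c] colors_atI[of d a E c]
      card_four_colors[of "c {a, b}" "c {b, x}" "c {x, d}" "c {d, a}"] pe
    by (simp add: insert_commute cycle_edges_def) metis
qed

text \<open>A two-colored path through the new edge has to start at the leaf, so it begins
  \<open>y x z w\<close> with \<open>z\<close> in the middle of its four edges. Assumption
  \<open>far\<close> forbids exactly this.\<close>

lemma star_coloring_leaf:
  assumes star: "star_coloring E c" and leaf: "\<And>e. e \<in> E \<Longrightarrow> y \<notin> e" and xy: "x \<noteq> y"
    and new: "k \<notin> colors_at E c x"
    and far: "\<And>z w. {x, z} \<in> E \<Longrightarrow> {z, w} \<in> E \<Longrightarrow> w \<noteq> x \<Longrightarrow> c {z, w} = k \<Longrightarrow>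
      c {x, z} \<notin> colors_at E c w"
  shows "star_coloring (insert {x, y} E) (c({x, y} := k))"
proof -
  let ?E = "insert {x, y} E" and ?c = "c({x, y} := k)"
  have other: "?c e = c e" if "e \<in> E" for e
    using that leaf[OF that] by auto
  have at: "colors_at ?E ?c v = (if v \<in> {x, y} then insert k (colors_at E c v) else colors_at E c v)" for v
  proof -
    have "?c ` {e \<in> E. v \<in> e} = c ` {e \<in> E. v \<in> e}"
      by (rule image_cong[OF refl]) (use other in blast)
    moreover have "{e \<in> ?E. v \<in> e} = (if v \<in> {x, y} then insert {x, y} {e \<in> E. v \<in> e} else {e \<in> E. v \<in> e})"
      by auto
    ultimately show ?thesis
      by (simp add: colors_at_def fun_upd_same del: fun_upd_apply)
  qed
  have aty: "colors_at E c y = {}"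
    using leaf by (auto simp: colors_at_def)
  have no: False if "{y, u} \<in> E" for u
    using leaf[OF that] by simp
  have key: "?c {u, z} \<noteq> ?c {u, w} \<and> \<not> (?c {u, w} \<in> colors_at ?E ?c z \<and> ?c {u, z} \<in> colors_at ?E ?c w)"
    if e: "{u, z} \<in> E" "{u, w} \<in> ?E" "z \<noteq> w" for u z w
  proof (cases "{u, w} \<in> E")
    case True
    have "z \<noteq> y" "w \<noteq> y" "u \<noteq> y"
      using e(1) True leaf by auto
    moreover have "\<not> (c {u, w} = k \<and> c {u, z} \<in> colors_at E c w)" if "z = x"
      using far[of u w] e(1) True that e(3) by (auto simp: insert_commute)
    moreover have "\<not> (c {u, z} = k \<and> c {u, w} \<in> colors_at E c z)" if "w = x"
      using far[of u z] e(1) True that e(3) by (auto simp: insert_commute)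
    ultimately show ?thesis
      using star_coloringD[OF star e(1) True e(3)] other[OF e(1)] other[OF True] e(3)
      by (auto simp: at)
  next
    case False
    then have "u = x" "w = y"
      using e(1,2) no by (auto simp: doubleton_eq_iff)
    then show ?thesis
      using new e(1) other[OF e(1)] colors_atI[of x z E c] by (auto simp: at aty)
  qed
  show ?thesis
    unfolding star_coloring_def
  proof (intro allI impI)
    fix u z w
    assume e: "{u, z} \<in> ?E" "{u, w} \<in> ?E" "z \<noteq> w"
    show "?c {u, z} \<noteq> ?c {u, w} \<and> \<not> (?c {u, w} \<in> colors_at ?E ?c z \<and> ?c {u, z} \<in> colors_at ?E ?c w)"
    proof (cases "{u, z} \<in> E")
      case True
      then show ?thesis using key e by blast
    next
      case False
      then have "{u, w} \<in> E"
        using e by (auto simp: doubleton_eq_iff)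
      then show ?thesis using key[of u w z] e by metis
    qed
  qed
qed

lemma colors_at_comp: "colors_at E (\<pi> \<circ> c) v = \<pi> ` colors_at E c v"
  by (auto simp: colors_at_def)

lemma star_coloring_permute:
  assumes "star_coloring E c" "inj_on \<pi> (c ` E)"
  shows "star_coloring E (\<pi> \<circ> c)"
proof -
  have "\<pi> (c e) \<in> \<pi> ` colors_at E c v \<longleftrightarrow> c e \<in> colors_at E c v" if "e \<in> E" for e v
    using assms(2) that by (auto simp: colors_at_def dest: inj_onD)
  moreover have "\<pi> (c e) = \<pi> (c f) \<longleftrightarrow> c e = c f" if "e \<in> E" "f \<in> E" for e f
    using assms(2) that by (auto dest: inj_onD)
  ultimately show ?thesis
    using assms(1) unfolding star_coloring_def colors_at_comp by simp
qed

section \<open>Extending a star coloring along an arc\<close>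

text \<open>An arc \<open>x 0, x 1, \<dots>, x (k + 1)\<close> is colored by lists: \<open>fs ! i\<close> is the color of the edge
  \<open>x i, x (i + 1)\<close>, and \<open>gs ! (i - 1)\<close> the color of the third edge at \<open>x i\<close>, its spoke, for
  \<open>1 \<le> i \<le> k\<close>. The spoke either ends in a leaf, then \<open>ps ! (i - 1) = i\<close>, or in \<open>x j\<close>, then
  \<open>ps ! (i - 1) = j\<close>. The lists \<open>A\<close> and \<open>B\<close> contain the colors at the two ends of the arc.\<close>

definition cols_at :: "nat list \<Rightarrow> nat list \<Rightarrow> nat list \<Rightarrow> nat list \<Rightarrow> nat \<Rightarrow> nat list" where
  "cols_at A B fs gs i =
     (if i = 0 then A else if i \<le> length gs then [fs ! (i - 1), fs ! i, gs ! (i - 1)] else B)"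

text \<open>These are the star conditions centered at \<open>x i\<close>. For a leaf spoke
  (\<open>j = i\<close>) only the pair of arc neighbours matters beyond properness, since the leaf
  sees no other color than \<open>g\<close>. For a chord the two pairs with the spoke are added, and
  both its ends must record the same color.\<close>

definition ok_at :: "nat list \<Rightarrow> nat list \<Rightarrow> nat list \<Rightarrow> nat list \<Rightarrow> nat list \<Rightarrow> nat \<Rightarrow> bool" where
  "ok_at ps A B fs gs i \<longleftrightarrow>
     (let e = fs ! (i - 1); f = fs ! i; g = gs ! (i - 1); j = ps ! (i - 1);
          L = cols_at A B fs gs (i - 1); R = cols_at A B fs gs (i + 1)
      in distinct [e, f, g] \<and> \<not> (f \<in> set L \<and> e \<in> set R) \<and>
         (j \<noteq> i \<longrightarrow> (let M = cols_at A B fs gs j in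
            gs ! (j - 1) = g \<and> \<not> (g \<in> set L \<and> e \<in> set M) \<and> \<not> (g \<in> set R \<and> f \<in> set M))))"

text \<open>The end edges survive as pendant edges, so that the old coloring fixes their colors and
  already respects everything on the far side of the ends.\<close>

definition delete_arc :: "'a set set \<Rightarrow> (nat \<Rightarrow> 'a) \<Rightarrow> nat \<Rightarrow> 'a set set" where
  "delete_arc E x k = {e \<in> E. e \<inter> x ` {1..k} = {}} \<union> {{x 0, x 1}, {x k, x (k + 1)}}"

text \<open>The ends \<open>x 0\<close> and \<open>x (k + 1)\<close> may be unrelated, adjacent or
  equal, so that one argument serves blocks, sides of chords and closed cycles. In
  \<open>left\<close> and \<open>right\<close> the star condition centered at an end holds either
  because the color of the old edge is missing at the neighbouring arc vertex, or because the color
  of the end edge is missing at \<open>w\<close>. In the second case \<open>w\<close> is off the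
  arc, where colors do not change.\<close>

locale arc_extension =
  fixes E :: "'a set set" and x :: "nat \<Rightarrow> 'a" and k :: nat and c :: "'a set \<Rightarrow> nat"
    and ps A B fs gs :: "nat list"
  assumes two: "\<forall>e\<in>E. card e = 2"
    and k: "2 \<le> k" and len: "length gs = k"
    and inj: "inj_on x {1..k}" and x0: "x 0 \<notin> x ` {1..k}" and xk: "x (k + 1) \<notin> x ` {1..k}"
    and path: "i \<le> k \<Longrightarrow> {x i, x (i + 1)} \<in> E"
    and spoke: "i \<in> {1..k} \<Longrightarrow> {x i, w} \<in> E \<Longrightarrow> w \<noteq> x (i - 1) \<Longrightarrow> w \<noteq> x (i + 1) \<Longrightarrow>
      (\<forall>e\<in>E. w \<in> e \<longrightarrow> e = {x i, w}) \<or>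
      ps ! (i - 1) \<noteq> i \<and> ps ! (i - 1) \<in> {1..k} \<and> w = x (ps ! (i - 1))"
    and spoke_unique: "i \<in> {1..k} \<Longrightarrow> {x i, w} \<in> E \<Longrightarrow> {x i, w'} \<in> E \<Longrightarrow>
      w \<notin> {x (i - 1), x (i + 1)} \<Longrightarrow> w' \<notin> {x (i - 1), x (i + 1)} \<Longrightarrow> w = w'"
    and star: "star_coloring (delete_arc E x k) c"
    and c0: "c {x 0, x 1} = fs ! 0" and ck: "c {x k, x (k + 1)} = fs ! k"
    and A: "colors_at (delete_arc E x k) c (x 0) \<subseteq> set A"
    and B: "colors_at (delete_arc E x k) c (x (k + 1)) \<subseteq> set B"
    and ok: "i \<in> {1..k} \<Longrightarrow> ok_at ps A B fs gs i"
    and left: "{x 0, w} \<in> delete_arc E x k \<Longrightarrow> w \<noteq> x 1 \<Longrightarrow> c {x 0, w} \<notin> {fs ! 1, gs ! 0} \<or>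
      w \<notin> x ` {1..k} \<and> fs ! 0 \<notin> colors_at (delete_arc E x k) c w"
    and right: "{x (k + 1), w} \<in> delete_arc E x k \<Longrightarrow> w \<noteq> x k \<Longrightarrow> c {x (k + 1), w} \<notin> {fs ! (k - 1), gs ! (k - 1)} \<or>
      w \<notin> x ` {1..k} \<and> fs ! k \<notin> colors_at (delete_arc E x k) c w"
begin

abbreviation "X \<equiv> x ` {1..k}"
abbreviation "E' \<equiv> delete_arc E x k"

definition spoke_end :: "nat \<Rightarrow> 'a \<Rightarrow> bool" where
  "spoke_end i w \<longleftrightarrow> i \<in> {1..k} \<and> {x i, w} \<in> E \<and> w \<noteq> x (i - 1) \<and> w \<noteq> x (i + 1)"

definition leaf_of :: "nat \<Rightarrow> 'a \<Rightarrow> bool" where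
  "leaf_of i w \<longleftrightarrow> (\<forall>e\<in>E. w \<in> e \<longrightarrow> e = {x i, w})"

lemma loopless: "{v, v} \<notin> E"
  using two by fastforce

lemma x_eq: "i \<in> {1..k} \<Longrightarrow> j \<in> {0..k+1} \<Longrightarrow> x i = x j \<Longrightarrow> i = j"
proof -
  assume a: "i \<in> {1..k}" "j \<in> {0..k+1}" "x i = x j"
  then have "x j \<in> X"
    using imageI[OF a(1), of x] by simp
  have "j \<noteq> 0"
  proof
    assume "j = 0"
    then show False using \<open>x j \<in> X\<close> x0 by (simp only:)
  qed
  moreover have "j \<noteq> k + 1"
  proof
    assume "j = k + 1"
    then show False using \<open>x j \<in> X\<close> xk by (simp only:)
  qed
  ultimately have "j \<in> {1..k}"
    using a(2) by auto
  then show ?thesis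
    using inj_onD[OF inj a(3) a(1)] by simp
qed

lemma x_ne:
  assumes "i \<in> {1..k}"
  shows "x i \<noteq> x 0" "x i \<noteq> x (k + 1)" "x 0 \<noteq> x i" "x (k + 1) \<noteq> x i"
  using x_eq[OF assms, of 0] x_eq[OF assms, of "k + 1"] assms by auto

lemma E'_sub: "E' \<subseteq> E"
  using path[of 0] path[of k] by (auto simp: delete_arc_def)

lemma spoke_cases:
  assumes "spoke_end i w"
  obtains (leaf) "leaf_of i w" "w \<notin> X" "w \<noteq> x 0" "w \<noteq> x (k + 1)"
    | (chord) j where "j = ps ! (i - 1)" "j \<in> {1..k}" "j \<noteq> i" "w = x j" "gs ! (j - 1) = gs ! (i - 1)"
proof -
  have i: "i \<in> {1..k}" and e: "{x i, w} \<in> E" and w: "w \<noteq> x (i - 1)" "w \<noteq> x (i + 1)"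
    using assms by (auto simp: spoke_end_def)
  consider "leaf_of i w" | "ps ! (i - 1) \<noteq> i \<and> ps ! (i - 1) \<in> {1..k} \<and> w = x (ps ! (i - 1))"
    using spoke[OF i e w] by (auto simp: leaf_of_def)
  then show ?thesis
  proof cases
    case 1
    \<comment> \<open>If the leaf \<open>w\<close> were \<open>x j\<close>, the arc edge at
      \<open>x j\<close> would be the spoke itself. Then \<open>w\<close> would be a neighbour of
      \<open>x i\<close> along the arc, which a spoke end is not.\<close>
    have ne: "w \<noteq> x j" if j: "j \<le> k + 1" for j
    proof
      assume wj: "w = x j"
      have "x j \<noteq> x i"
        using e wj loopless by auto
      show False
      proof (cases "j \<le> k")
        case True
        then have "{x j, x (j + 1)} = {x i, x j}"
          using 1 path[of j] wj by (simp add: leaf_of_def)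
        then have "x (j + 1) = x i"
          using \<open>x j \<noteq> x i\<close> by (auto simp: doubleton_eq_iff)
        then have "i = j + 1"
          using x_eq[OF i, of "j + 1"] True by auto
        then show False
          using w(1) wj by simp
      next
        case False
        then have j: "j = k + 1"
          using j by simp
        then have "{x k, x j} = {x i, x j}"
          using 1 path[of k] wj by (simp add: leaf_of_def)
        then have "x k = x i"
          using \<open>x j \<noteq> x i\<close> by (auto simp: doubleton_eq_iff)
        then have "i = k"
          using x_eq[OF i, of k] by auto
        then show False
          using w(2) wj j by simp
      qed
    qed
    have "w \<notin> X"
    proof
      assume "w \<in> X"
      then obtain j where "j \<in> {1..k}" "w = x j" by blast
      then show False using ne[of j] by simp
    qed
    moreover have "w \<noteq> x 0" "w \<noteq> x (k + 1)"
      using ne[of 0] ne[of "k + 1"] by simp_all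
    ultimately have "w \<notin> X" "w \<noteq> x 0" "w \<noteq> x (k + 1)"
      by blast+
    then show ?thesis
      using leaf 1 by blast
  next
    case 2
    then show ?thesis
      using chord[of "ps ! (i - 1)"] ok[OF i] by (simp add: ok_at_def Let_def)
  qed
qed

lemma mid_unique:
  assumes "i \<in> {1..<k}" "j \<in> {1..<k}" "{x i, x (i + 1)} = {x j, x (j + 1)}"
  shows "i = j"
  using assms x_eq[of i j] x_eq[of i "j + 1"] x_eq[of "i + 1" j]
  by (auto simp: doubleton_eq_iff)

lemma mid_not_E':
  assumes "i \<in> {1..<k}"
  shows "{x i, x (i + 1)} \<notin> E'"
proof
  assume "{x i, x (i + 1)} \<in> E'"
  moreover have i: "i \<in> {1..k}" "i + 1 \<in> {1..k}"
    using assms by auto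
  ultimately have "{x i, x (i + 1)} = {x 0, x 1} \<or> {x i, x (i + 1)} = {x k, x (k + 1)}"
    by (auto simp: delete_arc_def)
  then show False
    using x_ne[OF i(1)] x_ne[OF i(2)] by (auto simp: doubleton_eq_iff)
qed

lemma spoke_not_E':
  assumes "spoke_end i w"
  shows "{x i, w} \<notin> E'"
proof
  assume "{x i, w} \<in> E'"
  moreover have i: "i \<in> {1..k}"
    using assms by (simp add: spoke_end_def)
  ultimately have "{x i, w} = {x 0, x 1} \<or> {x i, w} = {x k, x (k + 1)}"
    by (auto simp: delete_arc_def)
  then have "x i = x 1 \<and> w = x 0 \<or> x i = x k \<and> w = x (k + 1)"
    using x_ne[OF i] by (auto simp: doubleton_eq_iff)
  then have "i = 1 \<and> w = x 0 \<or> i = k \<and> w = x (k + 1)"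
    using x_eq[OF i, of 1] x_eq[OF i, of k] by auto
  then show False
    using assms by (auto simp: spoke_end_def)
qed

lemma spoke_not_mid:
  assumes "spoke_end i w" "j \<in> {1..<k}"
  shows "{x i, w} \<noteq> {x j, x (j + 1)}"
  using assms x_eq[of i j] x_eq[of i "j + 1"]
  by (auto simp: doubleton_eq_iff spoke_end_def)

text \<open>Only a chord between two arc vertices is a spoke from both ends, and
  \<open>ok_at\<close> makes its two entries in \<open>gs\<close> agree.\<close>

lemma spoke_color_unique:
  assumes "spoke_end i w" "spoke_end j v" "{x i, w} = {x j, v}"
  shows "gs ! (i - 1) = gs ! (j - 1)"
proof (cases "x i = x j")
  case True
  then show ?thesis
    using x_eq[of i j] assms by (auto simp: spoke_end_def)
next
  case False
  then have w: "w = x j"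
    using assms(3) by (auto simp: doubleton_eq_iff)
  have j: "j \<in> {1..k}"
    using assms(2) by (simp add: spoke_end_def)
  from assms(1) show ?thesis
  proof (cases rule: spoke_cases)
    case leaf
    then show ?thesis using w j by auto
  next
    case (chord m)
    then have "m = j"
      using w x_eq[of m j] j by auto
    then show ?thesis using chord by simp
  qed
qed

lemma edge_at_arc:
  assumes "i \<in> {1..k}" "{x i, w} \<in> E"
  shows "w = x (i - 1) \<or> w = x (i + 1) \<or> spoke_end i w"
  using assms by (auto simp: spoke_end_def)

lemma edge_cases:
  assumes "e \<in> E"
  obtains "e \<in> E'" | i where "i \<in> {1..<k}" "e = {x i, x (i + 1)}"
    | i w where "spoke_end i w" "e = {x i, w}"
proof (cases "e \<inter> X = {}")
  case True
  then show ?thesis using that(1) assms by (simp add: delete_arc_def)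
next
  case False
  then obtain i where i: "i \<in> {1..k}" "x i \<in> e"
    by blast
  then obtain w where e: "e = {x i, w}"
    using two assms card_2_iff[of e] by (metis insertE insert_commute singletonD)
  consider "w = x (i - 1)" | "w = x (i + 1)" | "spoke_end i w"
    using edge_at_arc i e assms by blast
  then show ?thesis
  proof cases
    case 1
    show ?thesis
    proof (cases "i = 1")
      case True
      then show ?thesis using 1 e that(1) by (auto simp: delete_arc_def)
    next
      case False
      then have "i - 1 \<in> {1..<k}" "i - 1 + 1 = i"
        using i(1) by auto
      then show ?thesis using 1 e that(2)[of "i - 1"] by (simp add: insert_commute)
    qed
  next
    case 2
    show ?thesis
    proof (cases "i = k")
      case True
      then show ?thesis using 2 e that(1) by (auto simp: delete_arc_def)
    next
      case False
      then show ?thesis using 2 e that(2)[of i] i(1) by auto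
    qed
  next
    case 3
    then show ?thesis using that(3) e by blast
  qed
qed

text \<open>Kept edges, inner arc edges and spokes are disjoint classes, and a chord receives the
  same color from both ends. The three prescriptions are thus compatible at every edge.\<close>

lemma extension_exists:
  obtains c' where "\<And>e. e \<in> E' \<Longrightarrow> c' e = c e"
    "\<And>i. i \<in> {1..<k} \<Longrightarrow> c' {x i, x (i + 1)} = fs ! i"
    "\<And>i w. spoke_end i w \<Longrightarrow> c' {x i, w} = gs ! (i - 1)"
proof -
  let ?P = "\<lambda>e m. (e \<in> E' \<longrightarrow> m = c e) \<and> (\<forall>i\<in>{1..<k}. e = {x i, x (i + 1)} \<longrightarrow> m = fs ! i) \<and>
    (\<forall>i w. spoke_end i w \<longrightarrow> e = {x i, w} \<longrightarrow> m = gs ! (i - 1))"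
  have "\<exists>m. ?P e m" for e
  proof (cases "e \<in> E")
    case True
    then show ?thesis
    proof (cases rule: edge_cases)
      case 1
      then have "?P e (c e)"
        using mid_not_E' spoke_not_E' by blast
      then show ?thesis ..
    next
      case (2 i)
      then have "?P e (fs ! i)"
        using mid_not_E' spoke_not_mid mid_unique by blast
      then show ?thesis ..
    next
      case (3 i w)
      have "e \<notin> E'" "\<forall>j\<in>{1..<k}. e \<noteq> {x j, x (j + 1)}"
        using spoke_not_E'[OF 3(1)] spoke_not_mid[OF 3(1)] 3(2) by simp_all
      moreover have "gs ! (i - 1) = gs ! (j - 1)" if "spoke_end j v" "e = {x j, v}" for j v
        using spoke_color_unique[OF 3(1) that(1)] 3(2) that(2) by simp
      ultimately have "?P e (gs ! (i - 1))"
        by blast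
      then show ?thesis ..
    qed
  next
    case False
    then have "e \<noteq> {x i, x (i + 1)}" if "i \<in> {1..<k}" for i
      using path[of i] that by auto
    moreover have "e \<noteq> {x i, w}" if "spoke_end i w" for i w
      using False that by (auto simp: spoke_end_def)
    ultimately have "?P e (c e)"
      by blast
    then show ?thesis ..
  qed
  then obtain c' where "\<forall>e. ?P e (c' e)"
    by metis
  then show ?thesis
    using that[of c'] by blast
qed

lemma off_arc_edge:
  assumes "v \<notin> X" "{v, w} \<in> E" "\<And>i. \<not> spoke_end i v"
  shows "{v, w} \<in> E'" "w \<in> X \<Longrightarrow> v = x 0 \<and> w = x 1 \<or> v = x (k + 1) \<and> w = x k"
proof -
  have *: "v = x 0 \<and> w = x 1 \<or> v = x (k + 1) \<and> w = x k" if "w \<in> X"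
  proof -
    obtain i where i: "i \<in> {1..k}" "w = x i"
      using \<open>w \<in> X\<close> by blast
    consider "v = x (i - 1)" | "v = x (i + 1)" | "spoke_end i v"
      using edge_at_arc[OF i(1), of v] assms(2) i(2) by (auto simp: insert_commute)
    then show ?thesis
    proof cases
      case 1
      have "i - 1 \<notin> {1..k}"
        using 1 assms(1) by blast
      then have "i = 1"
        using i(1) by auto
      then show ?thesis using 1 i by simp
    next
      case 2
      have "i + 1 \<notin> {1..k}"
        using 2 assms(1) by blast
      then have "i = k"
        using i(1) by auto
      then show ?thesis using 2 i by simp
    next
      case 3
      then show ?thesis using assms(3) by blast
    qed
  qed
  then show "w \<in> X \<Longrightarrow> v = x 0 \<and> w = x 1 \<or> v = x (k + 1) \<and> w = x k" .
  show "{v, w} \<in> E'"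
    using * assms(1,2) by (cases "w \<in> X") (auto simp: delete_arc_def insert_commute)
qed

lemma arc_ends_not_spoke_end: "\<not> spoke_end i (x 0)" "\<not> spoke_end i (x (k + 1))"
  using spoke_cases[of i "x 0"] spoke_cases[of i "x (k + 1)"] x0 xk by blast+

section \<open>The star condition for the extended coloring\<close>

context
  fixes c' :: "'a set \<Rightarrow> nat"
  assumes c'E': "\<And>e. e \<in> E' \<Longrightarrow> c' e = c e"
    and c'mid: "\<And>i. i \<in> {1..<k} \<Longrightarrow> c' {x i, x (i + 1)} = fs ! i"
    and c'spoke: "\<And>i w. spoke_end i w \<Longrightarrow> c' {x i, w} = gs ! (i - 1)"
begin

lemma path_color:
  assumes "i \<le> k"
  shows "c' {x i, x (i + 1)} = fs ! i"
proof -
  consider "i = 0" | "i = k" | "i \<in> {1..<k}"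
    using assms by force
  then show ?thesis
    by cases (use c'E' c'mid c0 ck in \<open>auto simp: delete_arc_def\<close>)
qed

lemma prev_color:
  assumes "i \<in> {1..k}"
  shows "c' {x i, x (i - 1)} = fs ! (i - 1)"
proof -
  have "i - 1 \<le> k" "i - 1 + 1 = i"
    using assms by auto
  then show ?thesis
    using path_color[of "i - 1"] by (simp add: insert_commute)
qed

lemma colors_off_arc:
  assumes "v \<notin> X" "\<And>i. \<not> spoke_end i v"
  shows "colors_at E c' v = colors_at E' c v"
proof -
  have "{e \<in> E. v \<in> e} = {e \<in> E'. v \<in> e}"
  proof (intro set_eqI iffI)
    fix e
    assume e: "e \<in> {e \<in> E. v \<in> e}"
    then obtain w where "e = {v, w}"
      using two card_2_iff[of e] by (metis (lifting) insertE insert_commute mem_Collect_eq singletonD)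
    then show "e \<in> {e \<in> E'. v \<in> e}"
      using off_arc_edge(1)[OF assms(1) _ assms(2), of w] e by auto
  qed (use E'_sub in auto)
  then show ?thesis
    unfolding colors_at_def using c'E' by auto
qed

lemma colors_on_arc:
  assumes "i \<in> {1..k}"
  shows "colors_at E c' (x i) \<subseteq> {fs ! (i - 1), fs ! i, gs ! (i - 1)}"
proof
  fix m
  assume "m \<in> colors_at E c' (x i)"
  then obtain w where w: "{x i, w} \<in> E" "m = c' {x i, w}"
    using two by (metis colors_atE)
  then show "m \<in> {fs ! (i - 1), fs ! i, gs ! (i - 1)}"
    using edge_at_arc[OF assms w(1)] prev_color[OF assms] path_color[of i] c'spoke assms by auto
qed

lemma colors_arc:
  assumes "i \<le> k + 1"
  shows "colors_at E c' (x i) \<subseteq> set (cols_at A B fs gs i)"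
proof -
  consider "i = 0" | "i = k + 1" | "i \<in> {1..k}"
    using assms by force
  then show ?thesis
  proof cases
    case 1
    then show ?thesis
      using colors_off_arc[OF x0] arc_ends_not_spoke_end A by (simp add: cols_at_def)
  next
    case 2
    then show ?thesis
      using colors_off_arc[OF xk] arc_ends_not_spoke_end B len by (simp add: cols_at_def)
  next
    case 3
    then show ?thesis
      using colors_on_arc[OF 3] len by (auto simp: cols_at_def)
  qed
qed

definition good_pair :: "'a \<Rightarrow> 'a \<Rightarrow> 'a \<Rightarrow> bool" where
  "good_pair y z w \<longleftrightarrow> c' {y, z} \<noteq> c' {y, w} \<and>
     \<not> (c' {y, w} \<in> colors_at E c' z \<and> c' {y, z} \<in> colors_at E c' w)"

lemma good_pair_sym: "good_pair y z w \<Longrightarrow> good_pair y w z"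
  by (auto simp: good_pair_def)

text \<open>A conflict needs the color of the old edge at \<open>x 1\<close> and
  \<open>fs ! 0\<close> at \<open>w\<close>, and \<open>left\<close> excludes one of them. In its
  second alternative \<open>w\<close> is not the leaf of a spoke, since its only neighbour would
  then be on the arc; so the colors at \<open>w\<close> are the old ones.\<close>

lemma good_pair_left:
  assumes "{x 0, w} \<in> E" "w \<noteq> x 1"
  shows "good_pair (x 0) (x 1) w"
proof -
  have nl: "\<And>i. \<not> spoke_end i (x 0)"
    by (rule arc_ends_not_spoke_end)
  have E': "{x 0, w} \<in> E'" "{x 0, x 1} \<in> E'"
    using off_arc_edge(1)[OF x0 _ nl] assms(1) path[of 0] by auto
  have "c {x 0, x 1} \<noteq> c {x 0, w}"
    using star_coloringD(1)[OF star E'(2,1)] assms(2) by auto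
  moreover have "c {x 0, w} \<notin> colors_at E c' (x 1) \<or> fs ! 0 \<notin> colors_at E c' w"
  proof (cases "c {x 0, w} \<in> {fs ! 1, gs ! 0}")
    case True
    then have w: "w \<notin> X" "fs ! 0 \<notin> colors_at E' c w"
      using left[OF E'(1) assms(2)] by auto
    moreover have "\<not> spoke_end i w" for i
    proof
      assume s: "spoke_end i w"
      then have "leaf_of i w"
        by (cases rule: spoke_cases) (use w in auto)
      then have "{x 0, w} = {x i, w}" "i \<in> {1..k}"
        using assms(1) s by (auto simp: leaf_of_def spoke_end_def)
      then show False
        using x0 w(1) by (auto simp: doubleton_eq_iff)
    qed
    ultimately show ?thesis
      using colors_off_arc by simp
  next
    case False
    then show ?thesis
      using colors_on_arc[of 1] k c0 \<open>c {x 0, x 1} \<noteq> c {x 0, w}\<close> by auto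
  qed
  ultimately show ?thesis
    using c'E'[OF E'(1)] c'E'[OF E'(2)] c0 by (auto simp: good_pair_def)
qed

lemma good_pair_right:
  assumes "{x (k + 1), w} \<in> E" "w \<noteq> x k"
  shows "good_pair (x (k + 1)) (x k) w"
proof -
  have nl: "\<And>i. \<not> spoke_end i (x (k + 1))"
    by (rule arc_ends_not_spoke_end)
  have E': "{x (k + 1), w} \<in> E'" "{x (k + 1), x k} \<in> E'"
    using off_arc_edge(1)[OF xk _ nl] assms(1) path[of k] by (auto simp: insert_commute)
  have ck': "c {x (k + 1), x k} = fs ! k"
    using ck by (simp add: insert_commute)
  have ne: "c {x (k + 1), x k} \<noteq> c {x (k + 1), w}"
    using star_coloringD(1)[OF star E'(2,1)] assms(2) by auto
  moreover have "c {x (k + 1), w} \<notin> colors_at E c' (x k) \<or> fs ! k \<notin> colors_at E c' w"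
  proof (cases "c {x (k + 1), w} \<in> {fs ! (k - 1), gs ! (k - 1)}")
    case True
    then have w: "w \<notin> X" "fs ! k \<notin> colors_at E' c w"
      using right[OF E'(1) assms(2)] by auto
    moreover have "\<not> spoke_end i w" for i
    proof
      assume s: "spoke_end i w"
      then have "leaf_of i w"
        by (cases rule: spoke_cases) (use w in auto)
      then have "{x (k + 1), w} = {x i, w}" "i \<in> {1..k}"
        using assms(1) s by (auto simp: leaf_of_def spoke_end_def)
      then show False
        using xk w(1) by (auto simp: doubleton_eq_iff)
    qed
    ultimately show ?thesis
      using colors_off_arc by simp
  next
    case False
    then show ?thesis
      using colors_on_arc[of k] k ck' ne by auto
  qed
  ultimately show ?thesis
    using c'E'[OF E'(1)] c'E'[OF E'(2)] ck' by (auto simp: good_pair_def)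
qed

lemma good_pair_off_arc:
  assumes "v \<notin> X" "{v, z} \<in> E" "{v, w} \<in> E" "z \<noteq> w"
  shows "good_pair v z w"
proof (cases "\<exists>i. spoke_end i v")
  case True
  then obtain i where "spoke_end i v" by blast
  then have "leaf_of i v"
    by (cases rule: spoke_cases) (use assms(1) in auto)
  then have "{v, z} = {x i, v}" "{v, w} = {x i, v}"
    unfolding leaf_of_def using assms(2,3) by (metis insertI1)+
  then have "{v, z} = {v, w}"
    by simp
  then show ?thesis
    using assms(4) by (auto simp: doubleton_eq_iff)
next
  case False
  then have nl: "\<And>i. \<not> spoke_end i v" by blast
  consider "z \<in> X" | "w \<in> X" | "z \<notin> X" "w \<notin> X" by blast
  then show ?thesis
  proof cases
    case 1
    then show ?thesis
      using off_arc_edge(2)[OF assms(1,2) nl] assms(3,4) good_pair_left good_pair_right by metis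
  next
    case 2
    then show ?thesis
      using off_arc_edge(2)[OF assms(1,3) nl] assms(2,4) good_pair_left good_pair_right good_pair_sym
      by metis
  next
    case 3
    have "\<not> spoke_end i u" if "u \<notin> X" "{v, u} \<in> E" for i u
    proof
      assume s: "spoke_end i u"
      then have "leaf_of i u"
        by (cases rule: spoke_cases) (use that in auto)
      then have "{v, u} = {x i, u}" "i \<in> {1..k}"
        using that(2) s by (auto simp: leaf_of_def spoke_end_def)
      then show False
        using assms(1) that(1) by (auto simp: doubleton_eq_iff)
    qed
    then have "colors_at E c' z = colors_at E' c z" "colors_at E c' w = colors_at E' c w"
      using colors_off_arc 3 assms(2,3) by simp_all
    moreover have "{v, z} \<in> E'" "{v, w} \<in> E'"
      using off_arc_edge(1)[OF assms(1) _ nl] assms(2,3) by auto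
    ultimately show ?thesis
      using star_coloringD[OF star, of v z w] assms(4) c'E' by (simp add: good_pair_def)
  qed
qed

text \<open>The variables \<open>f\<close> and \<open>j\<close> name color and index of the arc
  neighbour \<open>z\<close>, so both directions are treated at once. At a leaf only the color of
  the spoke itself occurs, which reduces the claim to properness.\<close>

lemma good_pair_spoke:
  assumes "spoke_end i w" "z = x (i - 1) \<and> f = fs ! (i - 1) \<and> j = i - 1 \<or> z = x (i + 1) \<and> f = fs ! i \<and> j = i + 1"
  shows "good_pair (x i) z w"
proof -
  have i: "i \<in> {1..k}"
    using assms(1) by (simp add: spoke_end_def)
  have cz: "c' {x i, z} = f"
    using assms(2) path_color[of i] prev_color[OF i] i by auto
  have cw: "c' {x i, w} = gs ! (i - 1)"
    using c'spoke[OF assms(1)] .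
  have zj: "colors_at E c' z \<subseteq> set (cols_at A B fs gs j)"
  proof -
    have "j \<le> k + 1" "z = x j"
      using assms(2) i by auto
    then show ?thesis
      using colors_arc by blast
  qed
  have ne: "f \<noteq> gs ! (i - 1)"
    using ok[OF i] assms(2) by (auto simp: ok_at_def Let_def)
  from assms(1) show ?thesis
  proof (cases rule: spoke_cases)
    case leaf
    have "m = gs ! (i - 1)" if "m \<in> colors_at E c' w" for m
      using that leaf(1) cw by (auto simp: colors_at_def leaf_of_def)
    then show ?thesis
      using cz cw ne by (auto simp: good_pair_def)
  next
    case (chord l)
    have "colors_at E c' w \<subseteq> set (cols_at A B fs gs l)"
      using colors_arc[of l] chord by auto
    then show ?thesis
      using ok[OF i] chord assms(2) zj cz cw ne by (auto simp: ok_at_def Let_def good_pair_def)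
  qed
qed

lemma star_coloring_extension: "star_coloring E c'"
proof -
  have "good_pair v z w" if e: "{v, z} \<in> E" "{v, w} \<in> E" "z \<noteq> w" for v z w
  proof (cases "v \<in> X")
    case False
    then show ?thesis using e by (rule good_pair_off_arc)
  next
    case True
    then obtain i where i: "i \<in> {1..k}" "v = x i" by blast
    have "i - 1 \<le> k + 1" "i + 1 \<le> k + 1"
      using i(1) by auto
    note around = this[THEN colors_arc]
    have adj: "good_pair (x i) (x (i - 1)) (x (i + 1))"
      using ok[OF i(1)] path_color[of i] prev_color[OF i(1)] around i(1)
      by (auto simp: good_pair_def ok_at_def Let_def)
    have uniq: False if "spoke_end i z" "spoke_end i w"
      using spoke_unique[OF i(1)] that e(3) by (auto simp: spoke_end_def)
    show ?thesis
      using edge_at_arc[OF i(1), of z] edge_at_arc[OF i(1), of w] e i(2) adj uniq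
        good_pair_spoke[of i w z] good_pair_spoke[of i z w] good_pair_sym
      by metis
  qed
  then show ?thesis
    by (auto simp: star_coloring_def good_pair_def)
qed

end

theorem extension:
  obtains c' where "star_coloring E c'" "c' ` E \<subseteq> c ` E' \<union> (!) fs ` {1..<k} \<union> (!) gs ` {0..<k}"
proof -
  obtain c' where c': "\<And>e. e \<in> E' \<Longrightarrow> c' e = c e"
    "\<And>i. i \<in> {1..<k} \<Longrightarrow> c' {x i, x (i + 1)} = fs ! i"
    "\<And>i w. spoke_end i w \<Longrightarrow> c' {x i, w} = gs ! (i - 1)"
    using extension_exists by blast
  have "c' e \<in> c ` E' \<union> (!) fs ` {1..<k} \<union> (!) gs ` {0..<k}" if "e \<in> E" for e
    using that
  proof (cases rule: edge_cases)
    case (3 i w)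
    then have "i - 1 \<in> {0..<k}"
      by (auto simp: spoke_end_def)
    then show ?thesis using c'(3)[OF 3(1)] 3(2) by blast
  qed (use c' in auto)
  then show ?thesis
    using that star_coloring_extension[OF c'] by blast
qed

end

section \<open>Finding the colors of an arc by search\<close>

text \<open>\<open>p\<close> and \<open>q\<close> are the given colors of the two end edges.
  \<open>Fu\<close> and \<open>Fv\<close> are forbidden for the new edges at \<open>x 1\<close> and
  \<open>x k\<close>; this provides the first alternatives of \<open>left\<close> and
  \<open>right\<close> in \<open>arc_extension\<close>.\<close>

definition fits :: "nat list \<Rightarrow> nat list \<Rightarrow> nat list \<Rightarrow> nat list \<Rightarrow> nat list \<Rightarrow> nat \<Rightarrow> nat \<Rightarrow>
    nat list \<Rightarrow> nat list \<Rightarrow> bool" where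
  "fits ps A B Fu Fv p q fs gs \<longleftrightarrow>
     (let k = length ps in
      length fs = k + 1 \<and> length gs = k \<and> list_all (\<lambda>m. m < 5) (fs @ gs) \<and> fs ! 0 = p \<and> fs ! k = q \<and>
      list_all (ok_at ps A B fs gs) [1..<k + 1] \<and>
      fs ! 1 \<notin> set Fu \<and> gs ! 0 \<notin> set Fu \<and> fs ! (k - 1) \<notin> set Fv \<and> gs ! (k - 1) \<notin> set Fv)"

text \<open>Written with a conditional so that evaluation can stop at the first success.\<close>

fun any :: "('b \<Rightarrow> bool) \<Rightarrow> 'b list \<Rightarrow> bool" where
  "any P [] = False"
| "any P (m # ms) = (if P m then True else any P ms)"

lemma any_imp_ex: "any P ms \<Longrightarrow> \<exists>m. P m"
  by (induction ms) (auto split: if_splits)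

text \<open>Prunes the search below. It plays no role for its soundness.\<close>

definition plausible :: "nat list \<Rightarrow> nat list \<Rightarrow> nat list \<Rightarrow> nat list \<Rightarrow> nat \<Rightarrow> nat \<Rightarrow> nat \<Rightarrow> nat \<Rightarrow> bool" where
  "plausible ps A fs gs i e f g =
    (if e = f \<or> e = g \<or> f = g then False else
     if i > 1 \<and> e \<in> set (cols_at A [] fs gs (i - 2)) \<and> fs ! (i - 2) \<in> set [e, f, g] then False else
     let j = ps ! (i - 1) in if j \<ge> i then True else
       (let M = cols_at A [] fs gs j in
         \<not> (g \<in> set (cols_at A [] fs gs (i - 1)) \<and> e \<in> set M) \<and>
         \<not> (g \<in> set (cols_at A [] fs gs (j - 1)) \<and> fs ! (j - 1) \<in> set [e, f, g]) \<and>
         \<not> (g \<in> set (cols_at A [] fs gs (j + 1)) \<and> fs ! j \<in> set [e, f, g])))"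

text \<open>Backtracking along the arc, where \<open>n\<close> counts the vertices still to be
  treated. A chord whose other end was already passed reuses its color, and at the last vertex the
  next arc edge is the end edge, whose color \<open>q\<close> is prescribed.\<close>

fun search :: "nat list \<Rightarrow> nat list \<Rightarrow> nat list \<Rightarrow> nat list \<Rightarrow> nat list \<Rightarrow> nat \<Rightarrow> nat \<Rightarrow>
    nat list \<Rightarrow> nat list \<Rightarrow> nat \<Rightarrow> bool" where
  "search ps A B Fu Fv p q fs gs 0 = fits ps A B Fu Fv p q fs gs"
| "search ps A B Fu Fv p q fs gs (Suc n) =
    (let i = length gs + 1; e = last fs in
     if n = 0 \<and> e \<in> set Fv then False else
     any (\<lambda>g. if i = 1 \<and> g \<in> set Fu then False else if n = 0 \<and> g \<in> set Fv then False else
      any (\<lambda>f. if i = 1 \<and> f \<in> set Fu then False else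
        if plausible ps A fs gs i e f g then search ps A B Fu Fv p q (fs @ [f]) (gs @ [g]) n else False)
      (if n = 0 then [q] else [0, 1, 2, 3, 4]))
     (if ps ! (i - 1) < i then [gs ! (ps ! (i - 1) - 1)] else [0, 1, 2, 3, 4]))"

text \<open>The last step checks \<open>fits\<close> in full, so pruning can only lose
  solutions.\<close>

lemma search_sound: "search ps A B Fu Fv p q fs gs n \<Longrightarrow> \<exists>fs gs. fits ps A B Fu Fv p q fs gs"
proof (induction n arbitrary: fs gs)
  case (Suc n)
  have "\<exists>f g. search ps A B Fu Fv p q (fs @ [f]) (gs @ [g]) n"
    using Suc.prems unfolding search.simps Let_def
    by (auto dest!: any_imp_ex simp del: any.simps split: if_split_asm)
  then show ?case
    using Suc.IH by blast
qed auto

definition extendable :: "nat list \<Rightarrow> nat list \<Rightarrow> nat list \<Rightarrow> nat list \<Rightarrow> nat list \<Rightarrow> nat \<Rightarrow> nat \<Rightarrow> bool" where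
  "extendable ps A B Fu Fv p q \<longleftrightarrow> (\<exists>fs gs. fits ps A B Fu Fv p q fs gs)"

definition find_extension :: "nat list \<Rightarrow> nat list \<Rightarrow> nat list \<Rightarrow> nat list \<Rightarrow> nat list \<Rightarrow> nat \<Rightarrow> nat \<Rightarrow> bool" where
  "find_extension ps A B Fu Fv p q = search ps A B Fu Fv p q [p] [] (length ps)"

lemma find_extension_sound: "find_extension ps A B Fu Fv p q \<Longrightarrow> extendable ps A B Fu Fv p q"
  unfolding find_extension_def extendable_def by (rule search_sound)

text \<open>Permuting colors, the colors at \<open>x 0\<close> may be assumed to be 0, 1, 2, where 2 is the color of the
  first edge of the arc. In \<open>chord_ends\<close> the ends are joined by a chord of color 0, the edges leaving
  the arc and the chord have colors 1 and \<open>b\<close>, and \<open>q\<close> is the color of the last edge of the arc. The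
  end vertices of the arc must avoid 1 and \<open>b\<close> unless 2 and \<open>q\<close> do not occur at the far ends of those
  edges, and they must avoid 0 only if color 2 occurs at \<open>x (k + 1)\<close> or \<open>q\<close> at \<open>x 0\<close>. In
  \<open>closed_ends\<close> the two ends coincide.\<close>

definition free_ends :: "nat list \<Rightarrow> bool" where
  "free_ends ps \<longleftrightarrow> list_all (\<lambda>B. length B = 3 \<longrightarrow>
     list_all (\<lambda>q. extendable ps [0, 1, 2] B [0, 1, 2] B 2 q) B) (subseqs [0, 1, 2, 3, 4])"

definition chord_ends :: "nat list \<Rightarrow> bool" where
  "chord_ends ps \<longleftrightarrow> list_all (\<lambda>b. list_all (\<lambda>q. b \<noteq> q \<longrightarrow>
     (let h = (if b = 2 \<or> q = 2 then [0] else []); k = (if q = 1 \<or> q = 2 then [0] else []) in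
      extendable ps [0, 1, 2] [0, b, q] (2 # h) (q # k) 2 q \<and>
      (b \<noteq> 1 \<and> \<not> (b = 2 \<and> q = 1) \<longrightarrow>
        extendable ps [0, 1, 2] [0, b, q] (1 # 2 # h) (b # q # k) 2 q))) [1, 2, 3, 4]) [1, 2, 3, 4]"

definition closed_ends :: "nat list \<Rightarrow> bool" where
  "closed_ends ps \<longleftrightarrow> extendable ps [0, 1, 2] [0, 1, 2] [2, 1] [2, 1] 2 1"

definition find_free :: "nat list \<Rightarrow> bool" where
  "find_free ps = list_all (\<lambda>B. if length B = 3 then
     list_all (\<lambda>q. find_extension ps [0, 1, 2] B [0, 1, 2] B 2 q) B else True) (subseqs [0, 1, 2, 3, 4])"

definition find_chord :: "nat list \<Rightarrow> bool" where
  "find_chord ps = list_all (\<lambda>b. list_all (\<lambda>q. if b = q then True else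
     (let h = (if b = 2 \<or> q = 2 then [0] else []); k = (if q = 1 \<or> q = 2 then [0] else []) in
      find_extension ps [0, 1, 2] [0, b, q] (2 # h) (q # k) 2 q \<and>
      (if b = 1 \<or> b = 2 \<and> q = 1 then True else
        find_extension ps [0, 1, 2] [0, b, q] (1 # 2 # h) (b # q # k) 2 q))) [1, 2, 3, 4]) [1, 2, 3, 4]"

lemma find_free_sound: "find_free ps \<Longrightarrow> free_ends ps"
  unfolding find_free_def free_ends_def
  by (auto simp: list_all_iff split: if_splits intro: find_extension_sound)

lemma find_chord_sound: "find_chord ps \<Longrightarrow> chord_ends ps"
  unfolding find_chord_def chord_ends_def list_all_iff Let_def
  by (metis find_extension_sound)

lemma find_closed_sound: "find_extension ps [0, 1, 2] [0, 1, 2] [2, 1] [2, 1] 2 1 \<Longrightarrow> closed_ends ps"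
  unfolding closed_ends_def by (rule find_extension_sound)

text \<open>Encoding of the patterns: a pendant vertex (p) contributes its own index, and a triangle
  (t) starting at \<open>i\<close> contributes \<open>i + 2\<close>, \<open>i + 1\<close>,
  \<open>i\<close>, that is, a chord between its outer vertices and a pendant vertex between
  them.\<close>

lemma free_pppp: "free_ends [1, 2, 3, 4]"
  by (rule find_free_sound) code_simp

lemma free_ppt: "free_ends [1, 2, 5, 4, 3]"
  by (rule find_free_sound) code_simp

lemma free_ptp: "free_ends [1, 4, 3, 2, 5]"
  by (rule find_free_sound) code_simp

lemma free_tpp: "free_ends [3, 2, 1, 4, 5]"
  by (rule find_free_sound) code_simp

lemma free_tt: "free_ends [3, 2, 1, 6, 5, 4]"
  by (rule find_free_sound) code_simp

lemma free_tpt: "free_ends [3, 2, 1, 4, 7, 6, 5]"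
  by (rule find_free_sound) code_simp

lemma chord_pp: "chord_ends [1, 2]"
  by (rule find_chord_sound) code_simp

lemma chord_ppp: "chord_ends [1, 2, 3]"
  by (rule find_chord_sound) code_simp

lemma chord_t: "chord_ends [3, 2, 1]"
  by (rule find_chord_sound) code_simp

lemma chord_pt: "chord_ends [1, 4, 3, 2]"
  by (rule find_chord_sound) code_simp

lemma chord_tp: "chord_ends [3, 2, 1, 4]"
  by (rule find_chord_sound) code_simp

text \<open>Together with the common end \<open>x 0\<close> these patterns are the chordless cycles
  of length three and four and the 4-cycle with a chord. Longer chordless cycles contain the block
  pppp.\<close>

lemma closed_pp: "closed_ends [1, 2]"
  by (rule find_closed_sound) code_simp

lemma closed_ppp: "closed_ends [1, 2, 3]"
  by (rule find_closed_sound) code_simp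

lemma closed_t: "closed_ends [3, 2, 1]"
  by (rule find_closed_sound) code_simp

section \<open>Extending five-colorings\<close>

definition five_colorable :: "'a set set \<Rightarrow> bool" where
  "five_colorable E \<longleftrightarrow> (\<exists>c. star_coloring E c \<and> c ` E \<subseteq> {..<5})"

locale subcubic_edges =
  fixes E :: "'a set set"
  assumes fin: "finite E" and two: "\<forall>e\<in>E. card e = 2" and deg: "card {e \<in> E. v \<in> e} \<le> 3"
begin

lemma no_four_neighbours:
  assumes "{v, a} \<in> E" "{v, b} \<in> E" "{v, d} \<in> E" "{v, e} \<in> E" "distinct [a, b, d, e]"
  shows False
proof -
  have "{{v, a}, {v, b}, {v, d}, {v, e}} \<subseteq> {e \<in> E. v \<in> e}"
    using assms by auto
  then have "card {{v, a}, {v, b}, {v, d}, {v, e}} \<le> 3"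
    using deg[of v] fin card_mono[of "{e \<in> E. v \<in> e}" "{{v, a}, {v, b}, {v, d}, {v, e}}"] by simp
  moreover have "card {{v, a}, {v, b}, {v, d}, {v, e}} = 4"
    using assms(5) by (auto simp: card_insert_if doubleton_eq_iff)
  ultimately show False by simp
qed

lemma card_colors_at: "card (colors_at E c v) \<le> 3"
  unfolding colors_at_def using deg[of v] card_image_le[of "{e \<in> E. v \<in> e}" c] fin by simp

lemma subset: "F \<subseteq> E \<Longrightarrow> subcubic_edges F"
proof
  fix v
  assume "F \<subseteq> E"
  then have "card {e \<in> F. v \<in> e} \<le> card {e \<in> E. v \<in> e}"
    using fin by (intro card_mono) auto
  then show "card {e \<in> F. v \<in> e} \<le> 3"
    using deg[of v] by simp
qed (use fin two finite_subset in auto)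

lemma neq: "{v, w} \<in> E \<Longrightarrow> v \<noteq> w"
  using two by fastforce

end

lemma star_coloring_subset:
  assumes "star_coloring E c" "F \<subseteq> E"
  shows "star_coloring F c"
proof -
  have "colors_at F c v \<subseteq> colors_at E c v" for v
    using assms(2) by (auto simp: colors_at_def)
  then show ?thesis
    using assms unfolding star_coloring_def by blast
qed

lemma colors_at_less: "c ` E \<subseteq> {..<n} \<Longrightarrow> colors_at E c v \<subseteq> {..<n}"
  by (auto simp: colors_at_def)

lemma obtain_color:
  assumes "finite S" "card S \<le> 4"
  obtains m :: nat where "m < 5" "m \<notin> S"
proof -
  have "\<not> {..<5} \<subseteq> S"
    using assms card_mono[of S "{..<5::nat}"] by auto
  then show ?thesis using that by auto
qed

lemma obtain_permutation:
  fixes a b d a' b' d' :: nat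
  assumes "distinct [a, b, d]" "distinct [a', b', d']" "{a, b, d} \<subseteq> {..<5}" "{a', b', d'} \<subseteq> {..<5}"
  obtains \<pi> where "bij_betw \<pi> {..<5} {..<5::nat}" "\<pi> a = a'" "\<pi> b = b'" "\<pi> d = d'"
proof -
  define g where "g = (\<lambda>v. if v = a then a' else if v = b then b' else d')"
  have g: "bij_betw g {a, b, d} {a', b', d'}"
    using assms(1,2) by (auto simp: g_def bij_betw_def inj_on_def)
  have "card {a, b, d} = 3" "card {a', b', d'} = 3"
    using assms(1,2) by auto
  then have "card ({..<5} - {a, b, d}) = card ({..<5} - {a', b', d'})"
    using assms(3,4) by (simp add: card_Diff_subset del: card_insert_disjoint)
  then obtain f where f: "bij_betw f ({..<5} - {a, b, d}) ({..<5} - {a', b', d'})"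
    using finite_same_card_bij[of "{..<5} - {a, b, d}" "{..<5} - {a', b', d'}"] by auto
  have "bij_betw (\<lambda>v. if v \<in> {a, b, d} then g v else f v)
      ({a, b, d} \<union> ({..<5} - {a, b, d})) ({a', b', d'} \<union> ({..<5} - {a', b', d'}))"
    by (rule bij_betw_disjoint_Un[OF g f]) auto
  moreover have "{a, b, d} \<union> ({..<5} - {a, b, d}) = {..<5}" "{a', b', d'} \<union> ({..<5} - {a', b', d'}) = {..<5}"
    using assms(3,4) by auto
  ultimately show ?thesis
    using that[of "\<lambda>v. if v \<in> {a, b, d} then g v else f v"] assms(1) by (auto simp: g_def)
qed

lemma five_permute:
  assumes "star_coloring E c" "c ` E \<subseteq> {..<5}" "bij_betw \<pi> {..<5} {..<5::nat}"
  shows "star_coloring E (\<pi> \<circ> c)" "(\<pi> \<circ> c) ` E \<subseteq> {..<5}"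
proof -
  have "inj_on \<pi> (c ` E)"
    using assms(2,3) by (meson bij_betw_def inj_on_subset)
  then show "star_coloring E (\<pi> \<circ> c)"
    using assms(1) by (rule star_coloring_permute[rotated])
  show "(\<pi> \<circ> c) ` E \<subseteq> {..<5}"
    using assms(2,3) by (auto simp: bij_betw_def)
qed

text \<open>Collects those assumptions of \<open>arc_extension\<close> that concern only the graph.
  Uniqueness of spokes is left to the degree bound.\<close>

definition arc_pattern :: "'a set set \<Rightarrow> (nat \<Rightarrow> 'a) \<Rightarrow> nat list \<Rightarrow> bool" where
  "arc_pattern E x ps \<longleftrightarrow> (let k = length ps in
     2 \<le> k \<and> inj_on x {1..k} \<and> x 0 \<notin> x ` {1..k} \<and> x (k + 1) \<notin> x ` {1..k} \<and>
     (\<forall>i\<le>k. {x i, x (i + 1)} \<in> E) \<and>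
     (\<forall>i\<in>{1..k}. \<forall>w. {x i, w} \<in> E \<longrightarrow> w \<noteq> x (i - 1) \<longrightarrow> w \<noteq> x (i + 1) \<longrightarrow>
        (\<forall>e\<in>E. w \<in> e \<longrightarrow> e = {x i, w}) \<or>
        ps ! (i - 1) \<noteq> i \<and> ps ! (i - 1) \<in> {1..k} \<and> w = x (ps ! (i - 1))))"

context subcubic_edges
begin

lemma delete_arc_sub:
  assumes "arc_pattern E x ps"
  shows "delete_arc E x (length ps) \<subseteq> E"
  using assms by (auto simp: arc_pattern_def delete_arc_def Let_def)

lemma delete_arc_leaves:
  assumes "arc_pattern E x ps" "e \<in> delete_arc E x (length ps)"
  shows "x 1 \<in> e \<Longrightarrow> e = {x 0, x 1}" "x (length ps) \<in> e \<Longrightarrow> e = {x (length ps), x (length ps + 1)}"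
proof -
  let ?k = "length ps"
  have k: "2 \<le> ?k" and inj: "inj_on x {1..?k}" and ends: "x 0 \<notin> x ` {1..?k}" "x (?k + 1) \<notin> x ` {1..?k}"
    using assms(1) by (auto simp: arc_pattern_def Let_def)
  have "x 1 \<noteq> x ?k"
    using inj_onD[OF inj, of 1 ?k] k by auto
  moreover have on: "x 1 \<in> x ` {1..?k}" "x ?k \<in> x ` {1..?k}"
    using k by auto
  moreover have "x 0 \<noteq> x ?k" "x (?k + 1) \<noteq> x 1"
    using on ends by (metis, metis)
  moreover have "e \<inter> x ` {1..?k} = {} \<or> e = {x 0, x 1} \<or> e = {x ?k, x (?k + 1)}"
    using assms(2) unfolding delete_arc_def by auto
  ultimately show "x 1 \<in> e \<Longrightarrow> e = {x 0, x 1}" "x ?k \<in> e \<Longrightarrow> e = {x ?k, x (?k + 1)}"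
    by fastforce+
qed

lemma arc_extend:
  assumes arc: "arc_pattern E x ps"
    and star: "star_coloring (delete_arc E x (length ps)) c" "c ` delete_arc E x (length ps) \<subseteq> {..<5}"
    and "colors_at (delete_arc E x (length ps)) c (x 0) \<subseteq> set A"
    and "colors_at (delete_arc E x (length ps)) c (x (length ps + 1)) \<subseteq> set B"
    and ext: "extendable ps A B Fu Fv (c {x 0, x 1}) (c {x (length ps), x (length ps + 1)})"
    and left: "\<And>w. {x 0, w} \<in> delete_arc E x (length ps) \<Longrightarrow> w \<noteq> x 1 \<Longrightarrow> c {x 0, w} \<in> set Fu \<or>
      w \<notin> x ` {1..length ps} \<and> c {x 0, x 1} \<notin> colors_at (delete_arc E x (length ps)) c w"
    and right: "\<And>w. {x (length ps + 1), w} \<in> delete_arc E x (length ps) \<Longrightarrow> w \<noteq> x (length ps) \<Longrightarrow>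
      c {x (length ps + 1), w} \<in> set Fv \<or> w \<notin> x ` {1..length ps} \<and>
      c {x (length ps), x (length ps + 1)} \<notin> colors_at (delete_arc E x (length ps)) c w"
  shows "five_colorable E"
proof -
  let ?k = "length ps"
  obtain fs gs where fit: "fits ps A B Fu Fv (c {x 0, x 1}) (c {x ?k, x (?k + 1)}) fs gs"
    using ext by (auto simp: extendable_def)
  have k: "2 \<le> ?k" and inj: "inj_on x {1..?k}"
    and ends: "x 0 \<notin> x ` {1..?k}" "x (?k + 1) \<notin> x ` {1..?k}"
    and path: "\<And>i. i \<le> ?k \<Longrightarrow> {x i, x (i + 1)} \<in> E"
    and spoke: "\<And>i w. i \<in> {1..?k} \<Longrightarrow> {x i, w} \<in> E \<Longrightarrow> w \<noteq> x (i - 1) \<Longrightarrow> w \<noteq> x (i + 1) \<Longrightarrow>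
        (\<forall>e\<in>E. w \<in> e \<longrightarrow> e = {x i, w}) \<or>
        ps ! (i - 1) \<noteq> i \<and> ps ! (i - 1) \<in> {1..?k} \<and> w = x (ps ! (i - 1))"
    using arc by (auto simp: arc_pattern_def Let_def)
  \<comment> \<open>The two arc neighbours of \<open>x i\<close> differ even if the ends of the arc
    coincide, because \<open>2 \<le> ?k\<close> puts one of them in the interior. Hence at most one
    further neighbour is left for the spoke.\<close>
  have ne: "x (i - 1) \<noteq> x (i + 1)" if i: "i \<in> {1..?k}" for i
  proof (cases "i = 1")
    case True
    then have "x (i + 1) \<in> x ` {1..?k}"
      using k by auto
    then show ?thesis
      using True ends(1) by auto
  next
    case False
    then have im: "i - 1 \<in> {1..?k}"
      using i by auto
    show ?thesis
    proof (cases "i = ?k")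
      case True
      then show ?thesis using im ends(2) by (metis imageI)
    next
      case False
      then have "i + 1 \<in> {1..?k}"
        using i by auto
      then show ?thesis
        using inj_onD[OF inj _ im] by fastforce
    qed
  qed
  have unique: "w = w'" if "i \<in> {1..?k}" "{x i, w} \<in> E" "{x i, w'} \<in> E"
    "w \<notin> {x (i - 1), x (i + 1)}" "w' \<notin> {x (i - 1), x (i + 1)}" for i w w'
  proof (rule ccontr)
    assume "w \<noteq> w'"
    moreover have "i - 1 \<le> ?k" "i - 1 + 1 = i" "i \<le> ?k"
      using that(1) by auto
    then have "{x i, x (i - 1)} \<in> E" "{x i, x (i + 1)} \<in> E"
      using path[of "i - 1"] path[of i] by (simp_all add: insert_commute)
    ultimately show False
      using no_four_neighbours[of "x i" w w' "x (i - 1)" "x (i + 1)"] that ne by auto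
  qed
  interpret arc_extension E x ?k c ps A B fs gs
  proof
    show "ok_at ps A B fs gs i" if "i \<in> {1..?k}" for i
    proof -
      have "i \<in> set [1..<?k + 1]"
        using that by auto
      then show ?thesis
        using fit unfolding fits_def Let_def list_all_iff by blast
    qed
    show "c {x 0, w} \<notin> {fs ! 1, gs ! 0} \<or> w \<notin> x ` {1..?k} \<and> fs ! 0 \<notin> colors_at (delete_arc E x ?k) c w"
      if "{x 0, w} \<in> delete_arc E x ?k" "w \<noteq> x 1" for w
      using left[OF that] fit by (auto simp: fits_def Let_def)
    show "c {x (?k + 1), w} \<notin> {fs ! (?k - 1), gs ! (?k - 1)} \<or>
        w \<notin> x ` {1..?k} \<and> fs ! ?k \<notin> colors_at (delete_arc E x ?k) c w"
      if "{x (?k + 1), w} \<in> delete_arc E x ?k" "w \<noteq> x ?k" for w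
      using right[OF that] fit by (auto simp: fits_def Let_def)
  qed (use two k inj ends path spoke unique assms(2,4,5) fit in \<open>simp_all add: fits_def Let_def\<close>)
  obtain c' where c': "star_coloring E c'"
    "c' ` E \<subseteq> c ` delete_arc E x ?k \<union> (!) fs ` {1..<?k} \<union> (!) gs ` {0..<?k}"
    by (rule extension)
  have "(!) fs ` {1..<?k} \<subseteq> set fs" "(!) gs ` {0..<?k} \<subseteq> set gs"
    using fit by (auto simp: fits_def Let_def)
  moreover have "set fs \<subseteq> {..<5}" "set gs \<subseteq> {..<5}"
    using fit by (auto simp: fits_def Let_def list_all_iff)
  ultimately have "c ` delete_arc E x ?k \<union> (!) fs ` {1..<?k} \<union> (!) gs ` {0..<?k} \<subseteq> {..<5}"
    using assms(3) by (meson Un_least order_trans)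
  then have "c' ` E \<subseteq> {..<5}"
    using c'(2) by (rule order_trans[rotated])
  then show ?thesis
    using c'(1) by (auto simp: five_colorable_def)
qed

end

section \<open>Arcs with arbitrary ends and arcs with coinciding ends\<close>

context subcubic_edges
begin

text \<open>Pads the colors at \<open>v\<close> to exactly three, because the tables range over
  three colors at each end. An end of lower degree gets dummy colors.\<close>

lemma colors_at_cover:
  assumes "colors_at E c v \<subseteq> {..<5}" "p \<in> colors_at E c v"
  obtains a b where "distinct [p, a, b]" "{p, a, b} \<subseteq> {..<5}" "colors_at E c v \<subseteq> {p, a, b}"
proof -
  have "card (colors_at E c v) \<le> 3"
    by (rule card_colors_at)
  then obtain T where T: "colors_at E c v \<subseteq> T" "T \<subseteq> {..<5}" "card T = 3"
    using exists_subset_between[of "colors_at E c v" 3 "{..<5}"] assms(1) by auto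
  then have "card (T - {p}) = 2"
    using assms(2) by (simp add: subset_iff)
  then obtain a b where ab: "T - {p} = {a, b}" "a \<noteq> b"
    by (meson card_2_iff)
  moreover have "T = {p, a, b}"
    using ab T(1) assms(2) by blast
  ultimately show ?thesis
    using that[of a b] T by auto
qed

text \<open>Both forbidden lists contain every color at the respective end, so no old edge there can
  conflict with the new colors, whatever lies beyond it.\<close>

lemma free_extend:
  assumes arc: "arc_pattern E x ps" and "five_colorable (delete_arc E x (length ps))" and "free_ends ps"
  shows "five_colorable E"
proof -
  let ?k = "length ps" and ?E = "delete_arc E x (length ps)"
  interpret D: subcubic_edges ?E
    using delete_arc_sub[OF arc] by (rule subset)
  have e: "{x 0, x 1} \<in> ?E" "{x (?k + 1), x ?k} \<in> ?E"
    by (auto simp: delete_arc_def)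
  obtain c where c: "star_coloring ?E c" "c ` ?E \<subseteq> {..<5}"
    using assms(2) by (auto simp: five_colorable_def)
  have "c {x 0, x 1} \<in> colors_at ?E c (x 0)"
    using e(1) by (rule colors_atI)
  then obtain a b where ab: "distinct [c {x 0, x 1}, a, b]" "{c {x 0, x 1}, a, b} \<subseteq> {..<5}"
      "colors_at ?E c (x 0) \<subseteq> {c {x 0, x 1}, a, b}"
    using D.colors_at_cover[OF colors_at_less[OF c(2)]] by metis
  obtain \<pi> where \<pi>: "bij_betw \<pi> {..<5} {..<5::nat}" "\<pi> (c {x 0, x 1}) = 2" "\<pi> a = 0" "\<pi> b = 1"
    using obtain_permutation[of "c {x 0, x 1}" a b 2 0 1] ab(1,2) by auto
  define d where "d = \<pi> \<circ> c"
  have d: "star_coloring ?E d" "d ` ?E \<subseteq> {..<5}"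
    unfolding d_def using five_permute[OF c \<pi>(1)] by simp_all
  have d0: "d {x 0, x 1} = 2"
    using \<pi>(2) by (simp add: d_def)
  have d_left: "colors_at ?E d (x 0) \<subseteq> set [0, 1, 2]"
    using ab(3) \<pi> unfolding d_def colors_at_comp by auto
  define q where "q = d {x ?k, x (?k + 1)}"
  have "q \<in> colors_at ?E d (x (?k + 1))"
    using colors_atI[OF e(2), of d] by (simp add: q_def insert_commute)
  then obtain a' b' where ab': "distinct [q, a', b']" "{q, a', b'} \<subseteq> {..<5}"
      "colors_at ?E d (x (?k + 1)) \<subseteq> {q, a', b'}"
    using D.colors_at_cover[OF colors_at_less[OF d(2)]] by metis
  have "{q, a', b'} \<in> set ` set (subseqs [0, 1, 2, 3, 4])"
    using ab'(2) unfolding subseqs_powset by auto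
  then obtain B where B: "B \<in> set (subseqs [0, 1, 2, 3, 4])" "{q, a', b'} = set B"
    by (rule imageE)
  have "distinct B"
    using subseqs_distinctD[OF B(1)] by simp
  then have "length B = 3"
    using distinct_card[of B] B(2)[symmetric] ab'(1) by simp
  moreover have "q \<in> set B"
    using B(2) by auto
  ultimately have "extendable ps [0, 1, 2] B [0, 1, 2] B 2 q"
    using assms(3) B(1) unfolding free_ends_def list_all_iff by blast
  then have ext: "extendable ps [0, 1, 2] B [0, 1, 2] B (d {x 0, x 1}) (d {x ?k, x (?k + 1)})"
    using d0 by (simp add: q_def)
  have d_right: "colors_at ?E d (x (?k + 1)) \<subseteq> set B"
    using ab'(3) B(2) by simp
  show ?thesis
  proof (rule arc_extend[OF arc d d_left d_right ext])
    show "d {x 0, w} \<in> set [0, 1, 2] \<or> w \<notin> x ` {1..?k} \<and> d {x 0, x 1} \<notin> colors_at ?E d w"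
      if "{x 0, w} \<in> ?E" for w
      using subsetD[OF d_left colors_atI[OF that, of d]] by (rule disjI1)
    show "d {x (?k + 1), w} \<in> set B \<or>
        w \<notin> x ` {1..?k} \<and> d {x ?k, x (?k + 1)} \<notin> colors_at ?E d w"
      if "{x (?k + 1), w} \<in> ?E" for w
      using subsetD[OF d_right colors_atI[OF that, of d]] by (rule disjI1)
  qed
qed

text \<open>A third edge at the common end leads to a leaf, which sees no color but its own. Hence
  the new edges at \<open>x 1\<close> and at the last inner vertex have to avoid only the colors 2
  and 1 of the two end edges, and color 0 stays available.\<close>

lemma closed_extend:
  assumes arc: "arc_pattern E x ps" and "five_colorable (delete_arc E x (length ps))" and "closed_ends ps"
    and closed: "x (length ps + 1) = x 0"
    and leaf: "\<And>w. {x 0, w} \<in> E \<Longrightarrow> w \<noteq> x 1 \<Longrightarrow> w \<noteq> x (length ps) \<Longrightarrow> (\<forall>e\<in>E. w \<in> e \<longrightarrow> e = {x 0, w})"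
  shows "five_colorable E"
proof -
  let ?k = "length ps" and ?E = "delete_arc E x (length ps)"
  interpret D: subcubic_edges ?E
    using delete_arc_sub[OF arc] by (rule subset)
  have e: "{x 0, x 1} \<in> ?E" "{x 0, x ?k} \<in> ?E"
    using closed by (auto simp: delete_arc_def insert_commute)
  have "x 1 \<noteq> x ?k"
    using arc inj_onD[of x "{1..?k}" 1 ?k] by (auto simp: arc_pattern_def Let_def)
  obtain c where c: "star_coloring ?E c" "c ` ?E \<subseteq> {..<5}"
    using assms(2) by (auto simp: five_colorable_def)
  let ?p = "c {x 0, x 1}" and ?q = "c {x 0, x ?k}"
  have pq: "?p \<noteq> ?q"
    using star_coloringD(1)[OF c(1) e] \<open>x 1 \<noteq> x ?k\<close> by blast
  have at: "?p \<in> colors_at ?E c (x 0)" "?q \<in> colors_at ?E c (x 0)"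
    using e by (auto intro: colors_atI)
  then obtain a b where ab: "distinct [?p, a, b]" "{?p, a, b} \<subseteq> {..<5}"
      "colors_at ?E c (x 0) \<subseteq> {?p, a, b}"
    using D.colors_at_cover[OF colors_at_less[OF c(2)]] by metis
  define s where "s = (if ?q = a then b else a)"
  have "?q = a \<or> ?q = b"
    using ab(3) at(2) pq by auto
  then have s: "distinct [?p, ?q, s]" "{?p, ?q, s} \<subseteq> {..<5}"
      "colors_at ?E c (x 0) \<subseteq> {?p, ?q, s}"
    using pq ab by (auto simp: s_def)
  obtain \<pi> where \<pi>: "bij_betw \<pi> {..<5} {..<5::nat}" "\<pi> ?p = 2" "\<pi> ?q = 1" "\<pi> s = 0"
    using obtain_permutation[of ?p ?q s 2 1 0] s(1,2) by auto
  define d where "d = \<pi> \<circ> c"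
  have d: "star_coloring ?E d" "d ` ?E \<subseteq> {..<5}"
    unfolding d_def using five_permute[OF c \<pi>(1)] by simp_all
  have d01: "d {x 0, x 1} = 2" "d {x 0, x ?k} = 1"
    using \<pi> by (simp_all add: d_def)
  have d_at: "colors_at ?E d (x 0) \<subseteq> set [0, 1, 2]"
    using s(3) \<pi> unfolding d_def colors_at_comp by auto
  have sub: "?E \<subseteq> E"
    by (rule delete_arc_sub[OF arc])
  have other: "w \<notin> x ` {1..?k} \<and> d {x 0, w} \<noteq> 2 \<and> d {x 0, w} \<noteq> 1 \<and> colors_at ?E d w = {d {x 0, w}}"
    if w: "{x 0, w} \<in> ?E" "w \<noteq> x 1" "w \<noteq> x ?k" for w
  proof -
    have l: "\<forall>e\<in>E. w \<in> e \<longrightarrow> e = {x 0, w}"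
      using leaf w sub by blast
    have "x 0 \<notin> x ` {1..?k}"
      using arc by (simp add: arc_pattern_def Let_def)
    then have "w \<notin> x ` {1..?k}"
      using w by (auto simp: delete_arc_def doubleton_eq_iff)
    moreover have "d {x 0, w} \<noteq> 2" "d {x 0, w} \<noteq> 1"
      using star_coloringD(1)[OF d(1) w(1) e(1)] star_coloringD(1)[OF d(1) w(1) e(2)] w d01 by auto
    moreover have "{e \<in> ?E. w \<in> e} = {{x 0, w}}"
      using l sub w(1) by auto
    then have "colors_at ?E d w = {d {x 0, w}}"
      by (simp add: colors_at_def)
    ultimately show ?thesis by blast
  qed
  have dk: "d {x ?k, x (?k + 1)} = 1"
    using d01(2) closed by (simp add: insert_commute)
  have ext: "extendable ps [0, 1, 2] [0, 1, 2] [2, 1] [2, 1] (d {x 0, x 1}) (d {x ?k, x (?k + 1)})"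
    using assms(3) d01 dk by (simp add: closed_ends_def)
  show ?thesis
  proof (rule arc_extend[OF arc d d_at _ ext])
    fix w
    assume "{x 0, w} \<in> ?E" "w \<noteq> x 1"
    then show "d {x 0, w} \<in> set [2, 1] \<or> w \<notin> x ` {1..?k} \<and> d {x 0, x 1} \<notin> colors_at ?E d w"
      using other[of w] d01 by (cases "w = x ?k") auto
  next
    fix w
    assume "{x (?k + 1), w} \<in> ?E" "w \<noteq> x ?k"
    then show "d {x (?k + 1), w} \<in> set [2, 1] \<or>
        w \<notin> x ` {1..?k} \<and> d {x ?k, x (?k + 1)} \<notin> colors_at ?E d w"
      using other[of w] d01 dk closed by (cases "w = x 1") auto
  qed (use d_at closed in simp)
qed

text \<open>At most four colors are excluded: that of \<open>uv\<close> and the at most three at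
  \<open>u'\<close>. A two-colored path starting with the edge \<open>xu\<close> then cannot
  continue through \<open>u'\<close>, where \<open>m\<close> is missing, nor through
  \<open>v\<close>, because of \<open>far\<close>.\<close>

lemma recolor_pendant:
  assumes star: "star_coloring E c" and edges: "{u, v} \<in> E" "{u, x} \<in> E" "{u, u'} \<in> E"
    and dist: "distinct [v, x, u']" and leaf: "\<And>e. e \<in> E \<Longrightarrow> x \<in> e \<Longrightarrow> e = {u, x}"
    and far: "\<And>w. {v, w} \<in> E \<Longrightarrow> w \<noteq> u \<Longrightarrow> c {u, v} \<notin> colors_at E c w"
  obtains m where "m < 5" "m \<noteq> c {u, v}" "m \<notin> colors_at E c u'" "star_coloring E (c({u, x} := m))"
proof -
  have "card (insert (c {u, v}) (colors_at E c u')) \<le> 4"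
    using card_colors_at[of c u'] card_insert_le_m1[of 4 "colors_at E c u'"] by simp
  moreover have "finite (colors_at E c u')"
    unfolding colors_at_def using fin by simp
  ultimately obtain m where m: "m < 5" "m \<notin> insert (c {u, v}) (colors_at E c u')"
    using obtain_color[of "insert (c {u, v}) (colors_at E c u')"] by auto
  let ?F = "E - {{u, x}}"
  have ux: "u \<noteq> x"
    using neq edges(2) by blast
  have sub: "colors_at ?F c w \<subseteq> colors_at E c w" for w
    by (auto simp: colors_at_def)
  have nb: "w = v \<or> w = u'" if "{u, w} \<in> ?F" for w
    using no_four_neighbours[of u w v x u'] that edges dist by auto
  have "star_coloring (insert {u, x} ?F) (c({u, x} := m))"
  proof (rule star_coloring_leaf)
    show "star_coloring ?F c"
      using star by (rule star_coloring_subset) blast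
    show "x \<notin> e" if "e \<in> ?F" for e
      using leaf that by blast
    show "m \<notin> colors_at ?F c u"
    proof
      assume "m \<in> colors_at ?F c u"
      then obtain w where w: "{u, w} \<in> ?F" "m = c {u, w}"
        using two by (elim colors_atE) auto
      have "c {u, u'} \<in> colors_at E c u'"
        using colors_atI[of u' u E c] edges(3) by (simp add: insert_commute)
      then show False
        using nb[OF w(1)] w(2) m(2) by auto
    qed
    show "c {u, z} \<notin> colors_at ?F c w"
      if z: "{u, z} \<in> ?F" "{z, w} \<in> ?F" "w \<noteq> u" "c {z, w} = m" for z w
    proof (cases "z = v")
      case True
      then show ?thesis using far[of w] z sub[of w] by auto
    next
      case False
      then have "z = u'"
        using nb z(1) by blast
      then show ?thesis
        using colors_atI[of u' w E c] z m(2) by auto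
    qed
  qed (rule ux)
  then show ?thesis
    using that[of m] m edges(2) by (simp add: insert_absorb)
qed

end

section \<open>Arcs whose ends are joined by a chord\<close>

lemma colors_at_upd: "v \<notin> e \<Longrightarrow> colors_at E (c(e := m)) v = colors_at E c v"
  by (auto simp: colors_at_def)

context subcubic_edges
begin

text \<open>In the cases excluded by the first disjunct, the color of the chord does not occur at the far ends
  of the edges leaving it, hence the two leaf edges can be recolored to satisfy the second one. If
  there is no leaving edge at \<open>u\<close> or \<open>v\<close>, then \<open>a\<close> or \<open>b\<close> is a dummy.\<close>

lemma normalise_chord:
  assumes "five_colorable E" and dist: "distinct [u, v, x, y]"
    and edges: "{u, v} \<in> E" "{u, x} \<in> E" "{v, y} \<in> E"
    and leaf: "\<And>e. e \<in> E \<Longrightarrow> x \<in> e \<Longrightarrow> e = {u, x}" "\<And>e. e \<in> E \<Longrightarrow> y \<in> e \<Longrightarrow> e = {v, y}"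
  obtains c a b where "star_coloring E c" "c ` E \<subseteq> {..<5}" "a < 5" "b < 5"
    "distinct [c {u, v}, a, c {u, x}]" "distinct [c {u, v}, b, c {v, y}]"
    "\<And>w. {u, w} \<in> E \<Longrightarrow> w \<noteq> v \<Longrightarrow> w \<noteq> x \<Longrightarrow> c {u, w} = a"
    "\<And>w. {v, w} \<in> E \<Longrightarrow> w \<noteq> u \<Longrightarrow> w \<noteq> y \<Longrightarrow> c {v, w} = b"
    "a \<noteq> b \<and> \<not> (b = c {u, x} \<and> a = c {v, y}) \<or>
      (\<forall>w. {u, w} \<in> E \<longrightarrow> w \<noteq> v \<longrightarrow> w \<noteq> x \<longrightarrow> c {u, x} \<notin> colors_at E c w) \<and>
      (\<forall>w. {v, w} \<in> E \<longrightarrow> w \<noteq> u \<longrightarrow> w \<noteq> y \<longrightarrow> c {v, y} \<notin> colors_at E c w)"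
proof -
  obtain c where c: "star_coloring E c" "c ` E \<subseteq> {..<5}"
    using assms(1) by (auto simp: five_colorable_def)
  have vu: "{v, u} \<in> E" "c {v, u} = c {u, v}"
    using edges(1) by (simp_all add: insert_commute)
  have lt: "c {u, v} < 5" "c {u, x} < 5" "c {v, y} < 5"
    using c(2) edges by auto
  have ne: "c {u, v} \<noteq> c {u, x}" "c {u, v} \<noteq> c {v, y}"
    using star_coloringD(1)[OF c(1) edges(1,2)] star_coloringD(1)[OF c(1) vu(1) edges(3)] dist vu(2)
    by auto
  have nbu: "w = w'" if "{u, w} \<in> E" "{u, w'} \<in> E" "w \<notin> {v, x}" "w' \<notin> {v, x}" for w w'
    using no_four_neighbours[of u w w' v x] that edges dist by auto
  have nbv: "w = w'" if "{v, w} \<in> E" "{v, w'} \<in> E" "w \<notin> {u, y}" "w' \<notin> {u, y}" for w w'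
    using no_four_neighbours[of v w w' u y] that vu(1) edges dist by auto
  have pick: "\<exists>m<5. m \<notin> {p, q, r, s}" for p q r s :: nat
  proof -
    have "finite {p, q, r, s}" "card {p, q, r, s} \<le> 4"
      by (simp_all add: card_insert_if)
    then show ?thesis
      by (rule obtain_color) blast
  qed
  show ?thesis
  proof (cases "\<exists>u'. {u, u'} \<in> E \<and> u' \<notin> {v, x}")
    case noU: False
    obtain b where b: "b < 5" "distinct [c {u, v}, b, c {v, y}]"
      "\<And>w. {v, w} \<in> E \<Longrightarrow> w \<noteq> u \<Longrightarrow> w \<noteq> y \<Longrightarrow> c {v, w} = b"
    proof (cases "\<exists>v'. {v, v'} \<in> E \<and> v' \<notin> {u, y}")
      case True
      then obtain v' where v': "{v, v'} \<in> E" "v' \<notin> {u, y}" by blast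
      have "distinct [c {u, v}, c {v, v'}, c {v, y}]"
        using star_coloringD(1)[OF c(1) v'(1) vu(1)] star_coloringD(1)[OF c(1) v'(1) edges(3)]
          v'(2) ne vu(2) by auto
      moreover have "c {v, v'} < 5"
        using c(2) v'(1) by auto
      moreover have "c {v, w} = c {v, v'}" if "{v, w} \<in> E" "w \<noteq> u" "w \<noteq> y" for w
        using nbv[OF that(1) v'(1)] that v'(2) by simp
      ultimately show ?thesis
        by (intro that[of "c {v, v'}"]) blast+
    next
      case False
      obtain m where "m < 5" "m \<notin> {c {u, v}, c {v, y}, 0, 0}"
        using pick by blast
      then show ?thesis
        using that[of m] ne False by auto
    qed
    \<comment> \<open>A dummy different from \<open>b\<close> and from the color of
      \<open>vy\<close> makes the first alternative of the last claim true.\<close>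
    obtain a where "a < 5" "a \<notin> {c {u, v}, c {u, x}, b, c {v, y}}"
      using pick by blast
    then show ?thesis
      using noU ne b(1,2) by (intro that[of c a b] c b) auto
  next
    case True
    then obtain u' where u': "{u, u'} \<in> E" "u' \<notin> {v, x}" by blast
    define a where "a = c {u, u'}"
    have a3: "w = u'" if "{u, w} \<in> E" "w \<noteq> v" "w \<noteq> x" for w
      using nbu[OF that(1) u'(1)] that u'(2) by simp
    have a: "a < 5" "distinct [c {u, v}, a, c {u, x}]"
      using star_coloringD(1)[OF c(1) u'(1) edges(1)] star_coloringD(1)[OF c(1) u'(1) edges(2)]
        u' ne c(2) by (auto simp: a_def)
    have a4: "c {u, w} = a" if "{u, w} \<in> E" "w \<noteq> v" "w \<noteq> x" for w
      using a3[OF that] by (simp add: a_def)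
    show ?thesis
    proof (cases "\<exists>v'. {v, v'} \<in> E \<and> v' \<notin> {u, y}")
      case noV: False
      obtain b where "b < 5" "b \<notin> {c {u, v}, c {u, x}, a, c {v, y}}"
        using pick by blast
      then show ?thesis
        using noV ne a by (intro that[of c a b] c a4) auto
    next
      case True
      then obtain v' where v': "{v, v'} \<in> E" "v' \<notin> {u, y}" by blast
      define b where "b = c {v, v'}"
      have b3: "w = v'" if "{v, w} \<in> E" "w \<noteq> u" "w \<noteq> y" for w
        using nbv[OF that(1) v'(1)] that v'(2) by simp
      have b: "b < 5" "distinct [c {u, v}, b, c {v, y}]"
        using star_coloringD(1)[OF c(1) v'(1) vu(1)] star_coloringD(1)[OF c(1) v'(1) edges(3)]
          v' ne vu(2) c(2) by (auto simp: b_def)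
      have b4: "c {v, w} = b" if "{v, w} \<in> E" "w \<noteq> u" "w \<noteq> y" for w
        using b3[OF that] by (simp add: b_def)
      show ?thesis
      proof (cases "a \<noteq> b \<and> \<not> (b = c {u, x} \<and> a = c {v, y})")
        case True
        then show ?thesis
          by (intro that[of c a b] c a b a4 b4 disjI1)
      next
        case False
        then have ab: "a \<in> {b, c {v, y}}" "b \<in> {a, c {u, x}}"
          by auto
        have "u' \<noteq> y" "v' \<noteq> x"
          using leaf(1)[OF v'(1)] leaf(2)[OF u'(1)] dist by (auto simp: doubleton_eq_iff)
        \<comment> \<open>In both excluded cases \<open>a\<close> occurs at \<open>v\<close>, on the
          leaving edge or on \<open>vy\<close>. The star condition at \<open>u\<close> for the edges
          \<open>uu'\<close> and \<open>uv\<close> then keeps the chord color away from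
          \<open>u'\<close>; likewise at \<open>v\<close>. This is the assumption \<open>far\<close>
          of \<open>recolor_pendant\<close>.\<close>
        have "a \<in> colors_at E c v"
          using ab(1) colors_atI[OF v'(1), of c] colors_atI[OF edges(3), of c] by (auto simp: b_def)
        then have cu: "c {u, v} \<notin> colors_at E c u'"
          using star_coloringD(2)[OF c(1) u'(1) edges(1)] u'(2) by (auto simp: a_def)
        have "b \<in> colors_at E c u"
          using ab(2) colors_atI[OF u'(1), of c] colors_atI[OF edges(2), of c] by (auto simp: a_def)
        then have cv: "c {u, v} \<notin> colors_at E c v'"
          using star_coloringD(2)[OF c(1) v'(1) vu(1)] v'(2) vu(2) by (auto simp: b_def)
        have at_leaf: "colors_at E c x = {c {u, x}}" "colors_at E c y = {c {v, y}}" for c :: "'a set \<Rightarrow> nat"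
          using leaf edges(2,3) unfolding colors_at_def by blast+
        obtain m where m: "m < 5" "m \<noteq> c {u, v}" "m \<notin> colors_at E c u'"
            "star_coloring E (c({u, x} := m))"
        proof (rule recolor_pendant[OF c(1) edges(1,2) u'(1)])
          show "c {u, v} \<notin> colors_at E c w" if "{v, w} \<in> E" "w \<noteq> u" for w
            using b3[OF that] cv at_leaf(2)[of c] ne(2) by (cases "w = y") auto
        qed (use dist u'(2) leaf(1) in auto)
        let ?d = "c({u, x} := m)"
        have nux: "{u, v} \<noteq> {u, x}" "{v, y} \<noteq> {u, x}" "{v, v'} \<noteq> {u, x}" "{u, u'} \<noteq> {u, x}"
          using dist u'(2) by (auto simp: doubleton_eq_iff)
        have du': "colors_at E ?d w = colors_at E c w" if "w \<notin> {u, x}" for w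
          using that by (rule colors_at_upd)
        have "u' \<noteq> u" "v' \<noteq> v"
          using neq u'(1) v'(1) by blast+
        obtain n where n: "n < 5" "n \<noteq> ?d {v, u}" "n \<notin> colors_at E ?d v'"
            "star_coloring E (?d({v, y} := n))"
        proof (rule recolor_pendant[OF m(4) vu(1) edges(3) v'(1)])
          show "?d {v, u} \<notin> colors_at E ?d w" if "{u, w} \<in> E" "w \<noteq> v" for w
          proof (cases "w = x")
            case True
            then show ?thesis
              using at_leaf(1)[of ?d] m(2) nux vu(2) by (auto simp: insert_commute)
          next
            case False
            then have "w = u'"
              using a3 that by blast
            then show ?thesis
              using du'[of u'] cu u'(2) \<open>u' \<noteq> u\<close> nux(1) vu(2) by (auto simp: insert_commute)
          qed
        qed (use dist v'(2) leaf(2) in auto)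
        let ?e = "?d({v, y} := n)"
        have nvy: "{u, v} \<noteq> {v, y}" "{u, x} \<noteq> {v, y}" "{v, v'} \<noteq> {v, y}" "{u, u'} \<noteq> {v, y}"
          using dist v'(2) \<open>u' \<noteq> y\<close> by (auto simp: doubleton_eq_iff)
        have e: "?e {u, v} = c {u, v}" "?e {u, x} = m" "?e {v, y} = n" "?e {u, u'} = a" "?e {v, v'} = b"
          using nux nvy by (simp_all add: a_def b_def)
        have "m \<noteq> a"
          using m(3) colors_atI[of u' u E c] u'(1) by (auto simp: a_def insert_commute)
        have "n \<noteq> b"
          using n(3) colors_atI[of v' v E ?d] v'(1) nux(3) by (auto simp: b_def insert_commute)
        have "m \<notin> colors_at E ?e u'"
          using colors_at_upd[of u' "{v, y}" E ?d n] du'[of u'] m(3) u'(2) \<open>u' \<noteq> u\<close> \<open>u' \<noteq> y\<close> by auto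
        moreover have "n \<notin> colors_at E ?e v'"
          using colors_at_upd[of v' "{v, y}" E ?d n] n(3) v'(2) \<open>v' \<noteq> v\<close> by auto
        moreover have "?e ` E \<subseteq> {..<5}"
          using c(2) m(1) n(1) by auto
        moreover have "distinct [?e {u, v}, a, ?e {u, x}]" "distinct [?e {u, v}, b, ?e {v, y}]"
          using a(2) b(2) m(2) n(2) \<open>m \<noteq> a\<close> \<open>n \<noteq> b\<close> nux(1) vu(2) unfolding e
          by (auto simp: insert_commute)
        moreover have "?e {u, w} = a" if "{u, w} \<in> E" "w \<noteq> v" "w \<noteq> x" for w
          using a3[OF that] e(4) by simp
        moreover have "?e {v, w} = b" if "{v, w} \<in> E" "w \<noteq> u" "w \<noteq> y" for w
          using b3[OF that] e(5) by simp
        moreover have "?e {u, x} \<notin> colors_at E ?e w" if "{u, w} \<in> E" "w \<noteq> v" "w \<noteq> x" for w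
          using a3[OF that] e(2) \<open>m \<notin> colors_at E ?e u'\<close> by simp
        moreover have "?e {v, y} \<notin> colors_at E ?e w" if "{v, w} \<in> E" "w \<noteq> u" "w \<noteq> y" for w
          using b3[OF that] e(3) \<open>n \<notin> colors_at E ?e v'\<close> by simp
        ultimately show ?thesis
          using n(4) a(1) b(1) by (intro that[of ?e a b]) blast+
      qed
    qed
  qed
qed

text \<open>The alternatives of \<open>normalise_chord\<close> select the two rows of
  \<open>chord_ends\<close>. In the first one the leaving colors 1 and \<open>b'\<close> are
  forbidden at the adjacent arc vertices; in the second one the colors 2 and \<open>q\<close> of the
  end edges are missing at the far ends of the leaving edges, so 1 and \<open>b'\<close> may be used
  there.\<close>

lemma chord_extend:
  assumes arc: "arc_pattern E x ps" and "five_colorable (delete_arc E x (length ps))" and "chord_ends ps"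
    and uv: "{x 0, x (length ps + 1)} \<in> E"
  shows "five_colorable E"
proof -
  let ?k = "length ps" and ?E = "delete_arc E x (length ps)"
  let ?u = "x 0" and ?v = "x (?k + 1)"
  interpret D: subcubic_edges ?E
    using delete_arc_sub[OF arc] by (rule subset)
  have k: "2 \<le> ?k" and inj: "inj_on x {1..?k}" and ends: "?u \<notin> x ` {1..?k}" "?v \<notin> x ` {1..?k}"
    using arc by (auto simp: arc_pattern_def Let_def)
  have on: "x 1 \<in> x ` {1..?k}" "x ?k \<in> x ` {1..?k}" "x 1 \<noteq> x ?k"
    using k inj_onD[OF inj, of 1 ?k] by auto
  have "?u \<noteq> ?v"
    using neq uv by blast
  then have dist: "distinct [?u, ?v, x 1, x ?k]"
    using on ends by auto
  have uvE: "{?u, ?v} \<in> ?E"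
    using uv ends by (simp add: delete_arc_def)
  have e: "{?u, x 1} \<in> ?E" "{?v, x ?k} \<in> ?E"
    by (auto simp: delete_arc_def)
  have l: "\<And>e. e \<in> ?E \<Longrightarrow> x 1 \<in> e \<Longrightarrow> e = {?u, x 1}" "\<And>e. e \<in> ?E \<Longrightarrow> x ?k \<in> e \<Longrightarrow> e = {?v, x ?k}"
    using delete_arc_leaves[OF arc] by (simp_all add: insert_commute)
  obtain c a b where c: "star_coloring ?E c" "c ` ?E \<subseteq> {..<5}" and ab: "a < 5" "b < 5"
    "distinct [c {?u, ?v}, a, c {?u, x 1}]" "distinct [c {?u, ?v}, b, c {?v, x ?k}]"
    and au: "\<And>w. {?u, w} \<in> ?E \<Longrightarrow> w \<noteq> ?v \<Longrightarrow> w \<noteq> x 1 \<Longrightarrow> c {?u, w} = a"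
    and bv: "\<And>w. {?v, w} \<in> ?E \<Longrightarrow> w \<noteq> ?u \<Longrightarrow> w \<noteq> x ?k \<Longrightarrow> c {?v, w} = b"
    and mode: "a \<noteq> b \<and> \<not> (b = c {?u, x 1} \<and> a = c {?v, x ?k}) \<or>
      (\<forall>w. {?u, w} \<in> ?E \<longrightarrow> w \<noteq> ?v \<longrightarrow> w \<noteq> x 1 \<longrightarrow> c {?u, x 1} \<notin> colors_at ?E c w) \<and>
      (\<forall>w. {?v, w} \<in> ?E \<longrightarrow> w \<noteq> ?u \<longrightarrow> w \<noteq> x ?k \<longrightarrow> c {?v, x ?k} \<notin> colors_at ?E c w)"
    using D.normalise_chord[OF assms(2) dist uvE e l] by blast
  have lt: "c {?u, ?v} < 5" "c {?u, x 1} < 5" "c {?v, x ?k} < 5"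
    using c(2) uvE e by auto
  obtain \<pi> where \<pi>: "bij_betw \<pi> {..<5} {..<5::nat}" "\<pi> (c {?u, ?v}) = 0" "\<pi> a = 1" "\<pi> (c {?u, x 1}) = 2"
    using obtain_permutation[of "c {?u, ?v}" a "c {?u, x 1}" 0 1 2] ab lt by auto
  have \<pi>_eq: "\<pi> s = \<pi> t \<longleftrightarrow> s = t" if "s < 5" "t < 5" for s t
    using \<pi>(1) that by (auto simp: bij_betw_def inj_on_def)
  have \<pi>_lt: "\<pi> s < 5" if "s < 5" for s
    using bij_betwE[OF \<pi>(1)] that by auto
  define d where "d = \<pi> \<circ> c"
  define q where "q = d {?v, x ?k}"
  define b' where "b' = \<pi> b"
  have d: "star_coloring ?E d" "d ` ?E \<subseteq> {..<5}"
    unfolding d_def using five_permute[OF c \<pi>(1)] by simp_all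
  have dv: "d {?u, ?v} = 0" "d {?v, ?u} = 0" "d {?u, x 1} = 2" "d {x ?k, ?v} = q"
    using \<pi> by (simp_all add: d_def q_def insert_commute)
  have du: "d {?u, w} = 1" if "{?u, w} \<in> ?E" "w \<noteq> ?v" "w \<noteq> x 1" for w
    using au[OF that] \<pi>(3) by (simp add: d_def)
  have dvw: "d {?v, w} = b'" if "{?v, w} \<in> ?E" "w \<noteq> ?u" "w \<noteq> x ?k" for w
    using bv[OF that] by (simp add: d_def b'_def)
  have bq: "b' \<noteq> q" "b' \<noteq> 0" "q \<noteq> 0" "b' < 5" "q < 5"
    using \<pi>_eq[of b "c {?v, x ?k}"] \<pi>_eq[of b "c {?u, ?v}"] \<pi>_eq[of "c {?v, x ?k}" "c {?u, ?v}"]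
      ab lt \<pi>(2) \<pi>_lt[of b] \<pi>_lt[of "c {?v, x ?k}"]
    by (auto simp: b'_def q_def d_def)
  then have bq_in: "b' \<in> set [1, 2, 3, 4]" "q \<in> set [1, 2, 3, 4]"
    by auto
  have d_left: "colors_at ?E d ?u \<subseteq> set [0, 1, 2]"
  proof
    fix m
    assume "m \<in> colors_at ?E d ?u"
    then obtain w where "{?u, w} \<in> ?E" "m = d {?u, w}"
      using D.two by (elim colors_atE)
    then show "m \<in> set [0, 1, 2]"
      using dv du[of w] by (cases "w = ?v"; cases "w = x 1") auto
  qed
  have d_right: "colors_at ?E d ?v \<subseteq> set [0, b', q]"
  proof
    fix m
    assume "m \<in> colors_at ?E d ?v"
    then obtain w where "{?v, w} \<in> ?E" "m = d {?v, w}"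
      using D.two by (elim colors_atE)
    then show "m \<in> set [0, b', q]"
      using dv dvw[of w] by (cases "w = ?u"; cases "w = x ?k") (auto simp: q_def)
  qed
  let ?h = "if b' = 2 \<or> q = 2 then [0] else []" and ?l = "if q = 1 \<or> q = 2 then [0] else []"
  have off: "w \<notin> x ` {1..?k}" if w: "{z, w} \<in> ?E" "z \<notin> x ` {1..?k}" "w \<noteq> x 1" "w \<noteq> x ?k" for z w
    using w ends unfolding delete_arc_def by (auto simp: doubleton_eq_iff)
  have nu: "w \<noteq> x ?k" if "{?u, w} \<in> ?E" for w
    using delete_arc_leaves(2)[OF arc that] dist by (auto simp: doubleton_eq_iff)
  have nv: "w \<noteq> x 1" if "{?v, w} \<in> ?E" for w
    using delete_arc_leaves(1)[OF arc that] dist by (auto simp: doubleton_eq_iff)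
  \<comment> \<open>This treats the pair at \<open>?u\<close> formed by the arc and the chord: the
    chord color 0 is forbidden at \<open>x 1\<close>, or color 2 does not occur at
    \<open>?v\<close>.\<close>
  have v_ok: "0 \<in> set (?h) \<or> ?v \<notin> x ` {1..?k} \<and> 2 \<notin> colors_at ?E d ?v"
    using d_right ends(2) by auto
  have u_ok: "0 \<in> set (?l) \<or> ?u \<notin> x ` {1..?k} \<and> q \<notin> colors_at ?E d ?u"
    using d_left ends(1) bq(3) by auto
  have table: "extendable ps [0, 1, 2] [0, b', q] (2 # ?h) (q # ?l) 2 q \<and>
      (b' \<noteq> 1 \<and> \<not> (b' = 2 \<and> q = 1) \<longrightarrow>
        extendable ps [0, 1, 2] [0, b', q] (1 # 2 # ?h) (b' # q # ?l) 2 q)"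
    using assms(3) bq_in bq(1) unfolding chord_ends_def list_all_iff Let_def by blast
  from mode show ?thesis
  proof
    assume "a \<noteq> b \<and> \<not> (b = c {?u, x 1} \<and> a = c {?v, x ?k})"
    then have "b' \<noteq> 1 \<and> \<not> (b' = 2 \<and> q = 1)"
      using \<pi>_eq[of b a] \<pi>_eq[of b "c {?u, x 1}"] \<pi>_eq[of "c {?v, x ?k}" a] ab lt \<pi>
      by (auto simp: b'_def q_def d_def)
    then have ext: "extendable ps [0, 1, 2] [0, b', q] (1 # 2 # ?h) (b' # q # ?l) (d {?u, x 1}) (d {x ?k, ?v})"
      using table dv by simp
    show ?thesis
    proof (rule arc_extend[OF arc d d_left d_right ext])
      show "d {?u, w} \<in> set (1 # 2 # ?h) \<or> w \<notin> x ` {1..?k} \<and> d {?u, x 1} \<notin> colors_at ?E d w"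
        if "{?u, w} \<in> ?E" "w \<noteq> x 1" for w
        using du[OF that(1) _ that(2)] v_ok dv by (cases "w = ?v") auto
      show "d {?v, w} \<in> set (b' # q # ?l) \<or> w \<notin> x ` {1..?k} \<and> d {x ?k, ?v} \<notin> colors_at ?E d w"
        if "{?v, w} \<in> ?E" "w \<noteq> x ?k" for w
        using dvw[OF that(1) _ that(2)] u_ok dv by (cases "w = ?u") auto
    qed
  next
    assume free: "(\<forall>w. {?u, w} \<in> ?E \<longrightarrow> w \<noteq> ?v \<longrightarrow> w \<noteq> x 1 \<longrightarrow> c {?u, x 1} \<notin> colors_at ?E c w) \<and>
      (\<forall>w. {?v, w} \<in> ?E \<longrightarrow> w \<noteq> ?u \<longrightarrow> w \<noteq> x ?k \<longrightarrow> c {?v, x ?k} \<notin> colors_at ?E c w)"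
    have transfer: "\<pi> s \<notin> colors_at ?E d w" if "s < 5" "s \<notin> colors_at ?E c w" for s w
    proof
      assume "\<pi> s \<in> colors_at ?E d w"
      then obtain t where t: "t \<in> colors_at ?E c w" "\<pi> s = \<pi> t"
        unfolding d_def colors_at_comp by blast
      then have "t < 5"
        using colors_at_less[OF c(2)] by auto
      then show False
        using \<pi>_eq[OF that(1)] t that(2) by blast
    qed
    have ext: "extendable ps [0, 1, 2] [0, b', q] (2 # ?h) (q # ?l) (d {?u, x 1}) (d {x ?k, ?v})"
      using table dv by simp
    show ?thesis
    proof (rule arc_extend[OF arc d d_left d_right ext])
      show "d {?u, w} \<in> set (2 # ?h) \<or> w \<notin> x ` {1..?k} \<and> d {?u, x 1} \<notin> colors_at ?E d w"
        if w: "{?u, w} \<in> ?E" "w \<noteq> x 1" for w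
      proof (cases "w = ?v")
        case True
        then show ?thesis using v_ok dv by auto
      next
        case False
        then have "d {?u, x 1} \<notin> colors_at ?E d w"
          using transfer[OF lt(2), of w] free w by (simp add: d_def)
        then show ?thesis using off[OF w(1) ends(1) w(2) nu[OF w(1)]] by blast
      qed
      show "d {?v, w} \<in> set (q # ?l) \<or> w \<notin> x ` {1..?k} \<and> d {x ?k, ?v} \<notin> colors_at ?E d w"
        if w: "{?v, w} \<in> ?E" "w \<noteq> x ?k" for w
      proof (cases "w = ?u")
        case True
        then show ?thesis using u_ok dv by auto
      next
        case False
        then have "d {x ?k, ?v} \<notin> colors_at ?E d w"
          using transfer[OF lt(3), of w] free w by (simp add: d_def insert_commute)
        then show ?thesis using off[OF w(1) ends(2) nv[OF w(1)] w(2)] by blast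
      qed
    qed
  qed
qed

end

section \<open>Minimal counterexamples\<close>

text \<open>The colors of \<open>G\<close> are permuted so that the edges at the bridge \<open>xy\<close> get five distinct colors. Then
  no two-colored path with four edges has the bridge in its interior.\<close>

lemma five_colorable_glue:
  assumes sub: "subcubic_edges E" and E: "E = insert {x, y} (F \<union> G)"
    and dj: "\<Union>F \<inter> \<Union>G = {}" "y \<notin> \<Union>F" "x \<notin> \<Union>G"
    and "five_colorable (insert {x, y} F)" "five_colorable (insert {x, y} G)"
  shows "five_colorable E"
proof -
  let ?F = "insert {x, y} F" and ?G = "insert {x, y} G"
  interpret subcubic_edges E by (rule sub)
  interpret F: subcubic_edges ?F by (rule subset) (use E in auto)
  interpret G: subcubic_edges ?G by (rule subset) (use E in auto)
  have xy: "x \<noteq> y"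
    using neq E by auto
  obtain c d0 where c: "star_coloring ?F c" "c ` ?F \<subseteq> {..<5}"
    and d0: "star_coloring ?G d0" "d0 ` ?G \<subseteq> {..<5}"
    using assms(6,7) by (auto simp: five_colorable_def)
  let ?p = "c {x, y}"
  have "?p \<in> colors_at ?F c x"
    by (rule colors_atI) simp
  then obtain a b where ab: "distinct [?p, a, b]" "{?p, a, b} \<subseteq> {..<5}" "colors_at ?F c x \<subseteq> {?p, a, b}"
    using F.colors_at_cover[OF colors_at_less[OF c(2)]] by metis
  have "d0 {x, y} \<in> colors_at ?G d0 y"
    using colors_atI[of y x ?G d0] by (simp add: insert_commute)
  then obtain a' b' where ab': "distinct [d0 {x, y}, a', b']" "{d0 {x, y}, a', b'} \<subseteq> {..<5}"
      "colors_at ?G d0 y \<subseteq> {d0 {x, y}, a', b'}"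
    using G.colors_at_cover[OF colors_at_less[OF d0(2)]] by metis
  have "finite {?p, a, b}" "card {?p, a, b} \<le> 4"
    by (simp_all add: card_insert_if)
  then obtain r where r: "r < 5" "r \<notin> {?p, a, b}"
    by (rule obtain_color)
  have "finite {?p, a, b, r}" "card {?p, a, b, r} \<le> 4"
    by (simp_all add: card_insert_if)
  then obtain s where s: "s < 5" "s \<notin> {?p, a, b, r}"
    by (rule obtain_color)
  obtain \<pi> where \<pi>: "bij_betw \<pi> {..<5} {..<5::nat}" "\<pi> (d0 {x, y}) = ?p" "\<pi> a' = r" "\<pi> b' = s"
    using obtain_permutation[of "d0 {x, y}" a' b' ?p r s] ab ab' r s by auto
  define d where "d = \<pi> \<circ> d0"
  have d: "star_coloring ?G d" "d ` ?G \<subseteq> {..<5}"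
    unfolding d_def using five_permute[OF d0 \<pi>(1)] by simp_all
  have dxy: "d {x, y} = ?p"
    using \<pi>(2) by (simp add: d_def)
  have dy: "colors_at ?G d y \<subseteq> {?p, r, s}"
    using ab'(3) \<pi> unfolding d_def colors_at_comp by auto
  have FG: "F \<inter> G = {}"
  proof (rule ccontr)
    assume "F \<inter> G \<noteq> {}"
    then obtain e where e: "e \<in> F" "e \<in> G" by blast
    then have "e \<noteq> {}"
      using F.two by auto
    then obtain v where "v \<in> e" by blast
    then show False
      using e dj(1) by blast
  qed
  define h where "h e = (if e \<in> ?F then c e else d e)" for e
  have hF: "h e = c e" if "e \<in> ?F" for e
    using that by (simp add: h_def)
  have hG: "h e = d e" if "e \<in> ?G" for e
    using that dxy FG by (auto simp: h_def)
  have atF: "colors_at E h v = colors_at ?F c v" if "v \<notin> \<Union>G" "v \<noteq> y" for v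
  proof -
    have "{e \<in> E. v \<in> e} = {e \<in> ?F. v \<in> e}"
      using that E by auto
    then show ?thesis
      unfolding colors_at_def using hF by auto
  qed
  have atG: "colors_at E h v = colors_at ?G d v" if "v \<notin> \<Union>F" for v
  proof -
    have "{e \<in> E. v \<in> e} = {e \<in> ?G. v \<in> e}"
      using that E by auto
    then show ?thesis
      unfolding colors_at_def using hG by auto
  qed
  have atx: "colors_at E h x \<subseteq> {?p, a, b}" and aty: "colors_at E h y \<subseteq> {?p, r, s}"
    using atF[of x] atG[of y] dj xy ab(3) dy by auto
  \<comment> \<open>Stated for an abstract side \<open>H\<close> with its end \<open>x'\<close> of
    the bridge, so that it applies to both sides, with the roles of \<open>x\<close> and
    \<open>y\<close> exchanged. The only new situation is \<open>v = x'\<close> with the bridge as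
    one of the two edges; there the colors at the two ends share only that of the bridge.\<close>
  have half: "h {v, z} \<noteq> h {v, w} \<and> \<not> (h {v, w} \<in> colors_at E h z \<and> h {v, z} \<in> colors_at E h w)"
    if e: "{v, z} \<in> insert {x', y'} H" "{v, w} \<in> insert {x', y'} H" "z \<noteq> w" "v \<noteq> y'"
      and H: "star_coloring (insert {x', y'} H) f" "\<And>e. e \<in> insert {x', y'} H \<Longrightarrow> h e = f e"
        "\<And>u. u \<in> \<Union>H \<Longrightarrow> colors_at E h u = colors_at (insert {x', y'} H) f u"
        "colors_at E h x' \<inter> colors_at E h y' \<subseteq> {h {x', y'}}" "y' \<notin> \<Union>H" "x' \<noteq> y'"
        "colors_at (insert {x', y'} H) f x' = colors_at E h x'"
    for v z w x' y' H f
  proof -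
    have ne: "h {v, z} \<noteq> h {v, w}"
      using star_coloringD(1)[OF H(1) e(1-3)] H(2)[OF e(1)] H(2)[OF e(2)] by simp
    have eq: "v = x' \<and> u = y'" if "{v, u} \<in> insert {x', y'} H" "u \<notin> \<Union>H" for u
      using that e(4) by (auto simp: doubleton_eq_iff)
    have cross: "h {x', u} \<notin> colors_at E h y'" if "{x', u} \<in> insert {x', y'} H" "h {x', u} \<noteq> h {x', y'}" for u
      using H(4,7) colors_atI[OF that(1), of f] H(2)[OF that(1)] that(2) by auto
    show ?thesis
    proof (cases "z \<in> \<Union>H \<and> w \<in> \<Union>H")
      case True
      then show ?thesis
        using star_coloringD(2)[OF H(1) e(1-3)] ne H(2)[OF e(1)] H(2)[OF e(2)] H(3) by simp
    next
      case False
      then show ?thesis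
        using eq[OF e(1)] eq[OF e(2)] e(1,2) cross[of z] cross[of w] ne by auto
    qed
  qed
  have meet: "colors_at E h x \<inter> colors_at E h y \<subseteq> {h {x, y}}"
    using atx aty r s hF[of "{x, y}"] by auto
  have "star_coloring E h"
    unfolding star_coloring_def
  proof (intro allI impI)
    fix v z w
    assume e: "{v, z} \<in> E" "{v, w} \<in> E" "z \<noteq> w"
    show "h {v, z} \<noteq> h {v, w} \<and> \<not> (h {v, w} \<in> colors_at E h z \<and> h {v, z} \<in> colors_at E h w)"
    proof (cases "v \<in> \<Union>G \<or> v = y")
      case True
      have vF: "v \<notin> \<Union>F"
        using True dj(1,2) by blast
      have "v \<noteq> x"
        using True dj(3) xy by blast
      have "{v, u} \<in> insert {y, x} G" if "{v, u} \<in> E" for u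
      proof -
        have "{v, u} \<notin> F"
          using vF by blast
        then show ?thesis
          using that unfolding E insert_commute[of y x] by blast
      qed
      then have "{v, z} \<in> insert {y, x} G" "{v, w} \<in> insert {y, x} G"
        using e(1,2) by blast+
      then show ?thesis
      proof (rule half[OF _ _ e(3) \<open>v \<noteq> x\<close>])
        show "star_coloring (insert {y, x} G) d"
          using d(1) by (simp add: insert_commute)
        show "h e = d e" if "e \<in> insert {y, x} G" for e
          using that hG[of e] by (simp add: insert_commute)
        show "colors_at E h u = colors_at (insert {y, x} G) d u" if "u \<in> \<Union>G" for u
          using that atG[of u] dj by (simp add: insert_commute) blast
        show "colors_at E h y \<inter> colors_at E h x \<subseteq> {h {y, x}}"
          using meet by (simp add: insert_commute Int_commute)
        show "colors_at (insert {y, x} G) d y = colors_at E h y"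
          using atG[of y] dj by (simp add: insert_commute)
      qed (fact dj(3), use xy in simp)
    next
      case False
      have "{v, u} \<in> ?F" if "{v, u} \<in> E" for u
      proof -
        have "{v, u} \<notin> G"
          using False by blast
        then show ?thesis
          using that unfolding E by blast
      qed
      then have "{v, z} \<in> ?F" "{v, w} \<in> ?F"
        using e(1,2) by blast+
      moreover have "v \<noteq> y"
        using False by blast
      ultimately show ?thesis
      proof (rule half[OF _ _ e(3) _ c(1) hF])
        show "colors_at E h u = colors_at ?F c u" if "u \<in> \<Union>F" for u
          using that atF[of u] dj by blast
        show "colors_at ?F c x = colors_at E h x"
          using atF[of x] dj xy by simp
      qed (assumption | fact meet | fact dj(2) | fact xy)+
    qed
  qed
  moreover have "h ` E \<subseteq> {..<5}"
    using c(2) d(2) E by (auto simp: h_def)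
  ultimately show ?thesis
    by (auto simp: five_colorable_def)
qed

text \<open>If \<open>w\<close> is already on the path, the path is cut off there. So the vertices
  reachable by paths are closed under adjacency.\<close>

lemma walk_extend:
  assumes "path_in F p" "p \<noteq> []" "{last p, w} \<in> F"
  shows "\<exists>q. path_in F q \<and> q \<noteq> [] \<and> hd q = hd p \<and> last q = w"
proof (cases "w \<in> set p")
  case True
  then obtain r s where p: "p = r @ w # s"
    using split_list by metis
  have "path_in F (r @ [w])"
    using assms(1) p walk_edges_append[of r w s] by (auto simp: path_in_def)
  moreover have "hd (r @ [w]) = hd p"
    using p by (cases r) auto
  ultimately show ?thesis
    by (intro exI[of _ "r @ [w]"]) simp
next
  case False
  obtain r v where p: "p = r @ [v]"
    using assms(2) by (metis rev_exhaust)
  have "path_in F (p @ [w])"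
    using assms False p walk_edges_append[of r v "[w]"] by (auto simp: path_in_def)
  then show ?thesis
    using assms(2) by (intro exI[of _ "p @ [w]"]) simp
qed

definition cycle_in :: "'a set set \<Rightarrow> 'a list \<Rightarrow> bool" where
  "cycle_in E p \<longleftrightarrow> 3 \<le> length p \<and> path_in E p \<and> {last p, hd p} \<in> E"

lemma cycle_in_rotate:
  assumes "cycle_in E (p @ q)"
  shows "cycle_in E (q @ p)"
proof (cases "p = [] \<or> q = []")
  case True
  then show ?thesis using assms by auto
next
  case False
  then obtain a p' b q' where pq: "p = p' @ [a]" "q = b # q'"
    by (metis neq_Nil_conv rev_exhaust)
  obtain c r where r: "p = c # r"
    using False by (cases p) auto
  obtain s d where s: "q = s @ [d]"
    using False by (metis rev_exhaust)
  have "walk_edges (p @ q) = walk_edges p @ {a, b} # walk_edges q"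
    using walk_edges_append[of p' a q] pq by simp
  moreover have "walk_edges (q @ p) = walk_edges q @ {d, c} # walk_edges p"
    using walk_edges_append[of s d p] r s by simp
  moreover have "last p = a" "hd q = b" "hd p = c" "last q = d"
    by (simp add: pq(1), simp add: pq(2), simp add: r, simp add: s)
  then have "{last (p @ q), hd (p @ q)} = {d, c}" "{last (q @ p), hd (q @ p)} = {a, b}"
    using False by (simp_all add: last_append hd_append)
  ultimately show ?thesis
    using assms by (auto simp: cycle_in_def path_in_def)
qed

definition leaf_at :: "'a set set \<Rightarrow> 'a \<Rightarrow> 'a \<Rightarrow> bool" where
  "leaf_at E x w \<longleftrightarrow> (\<forall>e\<in>E. w \<in> e \<longrightarrow> e = {x, w})"

locale minimal_counterexample = subcubic_edges E for E :: "'a set set" +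
  assumes theta: "theta_free E" and crossing: "crossing_free E"
    and minimal: "\<And>F. F \<subset> E \<Longrightarrow> five_colorable F"
    and bad: "\<not> five_colorable E"
begin

text \<open>Were \<open>x\<close> unreachable from \<open>y\<close> without the edge
  \<open>xy\<close>, this edge would be a bridge between the edges meeting the reachable set
  \<open>R\<close> and the rest. The edges \<open>xx'\<close> and \<open>yy'\<close> lie on
  different sides, so each side together with the bridge is a proper subset of \<open>E\<close>, and
  the two colorings glue.\<close>

lemma return_path:
  assumes "{x, y} \<in> E" "{x, x'} \<in> E" "x' \<noteq> y" "{y, y'} \<in> E" "y' \<noteq> x"
  obtains p where "path_in (E - {{x, y}}) p" "p \<noteq> []" "hd p = y" "last p = x"
proof (rule ccontr)
  assume no: "\<not> thesis"
  let ?D = "E - {{x, y}}"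
  define R where "R = {v. \<exists>p. path_in ?D p \<and> p \<noteq> [] \<and> hd p = y \<and> last p = v}"
  have "x \<notin> R"
    using no that by (auto simp: R_def)
  have "y \<in> R"
    unfolding R_def by (rule CollectI, rule exI[of _ "[y]"]) (simp add: path_in_def)
  have closed: "w \<in> R" if vR: "v \<in> R" and vw: "{v, w} \<in> ?D" for v w
  proof -
    obtain p where p: "path_in ?D p" "p \<noteq> []" "hd p = y" "last p = v"
      using vR by (auto simp: R_def)
    then obtain q where "path_in ?D q" "q \<noteq> []" "hd q = y" "last q = w"
      using walk_extend[of ?D p w] vw by auto
    then show ?thesis
      by (auto simp: R_def)
  qed
  define G where "G = {e \<in> ?D. e \<inter> R \<noteq> {}}"
  define F where "F = ?D - G"
  have GR: "e \<subseteq> R" if eG: "e \<in> G" for e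
  proof -
    obtain v where v: "v \<in> e" "v \<in> R" "e \<in> ?D"
      using eG by (auto simp: G_def)
    then obtain w where "e = {v, w}"
      using two card_2_iff[of e] by (metis DiffD1 insertE insert_commute singletonD)
    then show ?thesis
      using closed[of v w] v by auto
  qed
  have E: "E = insert {x, y} (F \<union> G)"
    using assms(1) by (auto simp: F_def G_def)
  have in': "{y, y'} \<in> G" "{x, x'} \<in> F"
    using assms \<open>x \<notin> R\<close> \<open>y \<in> R\<close> GR[of "{x, x'}"] by (auto simp: F_def G_def doubleton_eq_iff)
  then have notin: "{y, y'} \<notin> insert {x, y} F" "{x, x'} \<notin> insert {x, y} G"
    by (auto simp: F_def G_def)
  have sub: "insert {x, y} F \<subseteq> E" "insert {x, y} G \<subseteq> E"
    using assms(1) by (auto simp: F_def G_def)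
  have "insert {x, y} F \<noteq> E" "insert {x, y} G \<noteq> E"
    using notin assms(2,4) by metis+
  then have "insert {x, y} F \<subset> E" "insert {x, y} G \<subset> E"
    using sub by (metis psubsetI)+
  then have "five_colorable (insert {x, y} F)" "five_colorable (insert {x, y} G)"
    using minimal by blast+
  moreover have "\<Union>F \<inter> \<Union>G = {}" "y \<notin> \<Union>F" "x \<notin> \<Union>G"
    using GR \<open>x \<notin> R\<close> \<open>y \<in> R\<close> by (auto simp: F_def G_def)
  ultimately have "five_colorable E"
    using five_colorable_glue[OF _ E] subcubic_edges_axioms by blast
  then show False
    using bad by blast
qed

text \<open>All other neighbours of \<open>x\<close> are leaves, so no path with four edges uses
  \<open>xy\<close>, and any color missing at \<open>x\<close> extends a coloring of the remaining
  edges.\<close>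

lemma no_isolated_leaf:
  assumes "{x, y} \<in> E" "\<And>e. e \<in> E \<Longrightarrow> y \<in> e \<Longrightarrow> e = {x, y}"
    and "\<And>z w. {x, z} \<in> E \<Longrightarrow> {z, w} \<in> E \<Longrightarrow> z \<noteq> y \<Longrightarrow> w = x"
  shows False
proof -
  let ?F = "E - {{x, y}}"
  have "?F \<subset> E"
    using assms(1) by auto
  from minimal[OF this] obtain c where c: "star_coloring ?F c" "c ` ?F \<subseteq> {..<5}"
    unfolding five_colorable_def by blast
  interpret F: subcubic_edges ?F
    by (rule subset) auto
  have "finite (colors_at ?F c x)" "card (colors_at ?F c x) \<le> 4"
    using F.card_colors_at[of c x] F.fin by (auto simp: colors_at_def)
  then obtain k where k: "k < 5" "k \<notin> colors_at ?F c x"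
    by (rule obtain_color)
  have "star_coloring (insert {x, y} ?F) (c({x, y} := k))"
  proof (rule star_coloring_leaf[OF c(1) _ _ k(2)])
    show "y \<notin> e" if "e \<in> ?F" for e
      using assms(2) that by auto
    show "x \<noteq> y"
      using neq assms(1) by blast
    show "c {x, z} \<notin> colors_at ?F c w" if "{x, z} \<in> ?F" "{z, w} \<in> ?F" "w \<noteq> x" for z w
      using assms(3)[of z w] that by auto
  qed
  moreover have "insert {x, y} ?F = E"
    using assms(1) by auto
  moreover have "(c({x, y} := k)) ` E \<subseteq> {..<5}"
    using c(2) k(1) by auto
  ultimately show False
    using bad unfolding five_colorable_def by metis
qed

text \<open>Otherwise every edge has a leaf as an end, so the components are stars, and
  \<open>no_isolated_leaf\<close> applies.\<close>

lemma obtain_inner_edge: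
  obtains (witness) x x' y y' where "{x, y} \<in> E" "{x, x'} \<in> E" "x' \<noteq> y" "{y, y'} \<in> E" "y' \<noteq> x"
proof (rule ccontr)
  assume not: "\<not> thesis"
  have no: False if e: "{x, y} \<in> E" "{x, x'} \<in> E" "x' \<noteq> y" "{y, y'} \<in> E" "y' \<noteq> x" for x y x' y'
    using not witness[OF e] by contradiction
  have "E \<noteq> {}"
    using bad by (auto simp: five_colorable_def star_coloring_def)
  then obtain e where "e \<in> E" by blast
  then obtain x y where xy: "{x, y} \<in> E"
    using two card_2_iff[of e] by metis
  have leaf: False if uv: "{u, v} \<in> E" and end_: "\<And>v'. {v, v'} \<in> E \<Longrightarrow> v' = u" for u v
  proof (rule no_isolated_leaf[OF uv])
    show "e = {u, v}" if e: "e \<in> E" "v \<in> e" for e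
    proof -
      obtain v' where "e = {v, v'}"
        using two card_2_iff[of e] e by (metis insertE insert_commute singletonD)
      then show ?thesis
        using end_[of v'] e(1) by (auto simp: insert_commute)
    qed
    show "w = u" if "{u, z} \<in> E" "{z, w} \<in> E" "z \<noteq> v" for z w
      using no[OF that(1) uv that(3)[symmetric] that(2)] by blast
  qed
  have yx: "{y, x} \<in> E"
    using xy by (simp add: insert_commute)
  obtain v' where "{y, v'} \<in> E" "v' \<noteq> x"
    using leaf[OF xy] by blast
  moreover obtain u' where "{x, u'} \<in> E" "u' \<noteq> y"
    using leaf[OF yx] by blast
  ultimately show False
    using no xy by blast
qed

lemma cycle_exists: "\<exists>p. cycle_in E p"
proof -
  obtain x x' y y' where e: "{x, y} \<in> E" "{x, x'} \<in> E" "x' \<noteq> y" "{y, y'} \<in> E" "y' \<noteq> x"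
    by (rule obtain_inner_edge)
  obtain p where p: "path_in (E - {{x, y}}) p" "p \<noteq> []" "hd p = y" "last p = x"
    using return_path[OF e] by metis
  have "x \<noteq> y"
    using neq e(1) by blast
  then obtain r where r: "p = y # r" "r \<noteq> []" "last r = x"
    using p(2-4) by (cases p) (auto split: if_splits)
  have "tl r \<noteq> []"
  proof
    assume "tl r = []"
    then have "r = [x]"
      using r(2,3) by (cases r) auto
    then show False
      using p(1) r(1) by (auto simp: path_in_def insert_commute)
  qed
  then have "3 \<le> length p"
    using r by (cases r; cases "tl r") auto
  moreover have "path_in E p"
    using p(1) by (auto simp: path_in_def)
  ultimately show ?thesis
    using p(3,4) e(1) by (auto simp: cycle_in_def)
qed

lemma cycle_length_bound: "cycle_in E p \<Longrightarrow> length p \<le> card (\<Union>E)"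
proof -
  assume p: "cycle_in E p"
  have "set p \<subseteq> \<Union>E"
    using p in_walk_edge[of _ p] by (fastforce simp: cycle_in_def path_in_def)
  moreover have "finite (\<Union>E)"
    using fin two by (metis card.infinite finite_Union zero_neq_numeral)
  moreover have "card (set p) = length p"
    using p distinct_card by (auto simp: cycle_in_def path_in_def)
  ultimately show ?thesis
    using card_mono by metis
qed

definition circumference :: nat where
  "circumference = (GREATEST n. \<exists>p. cycle_in E p \<and> length p = n)"

definition long_cycle :: "'a list \<Rightarrow> bool" where
  "long_cycle p \<longleftrightarrow> cycle_in E p \<and> length p = circumference"

lemma cycle_le_circumference: "cycle_in E p \<Longrightarrow> length p \<le> circumference"
  unfolding circumference_def
  using cycle_length_bound by (intro Greatest_le_nat[of _ _ "card (\<Union>E)"]) auto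

lemma long_cycle_exists: "\<exists>p. long_cycle p"
proof -
  obtain q where "cycle_in E q"
    using cycle_exists by blast
  then have "\<exists>p. cycle_in E p \<and> length p = circumference"
    unfolding circumference_def
    using cycle_length_bound
    by (intro GreatestI_nat[of "\<lambda>n. \<exists>p. cycle_in E p \<and> length p = n" "length q" "card (\<Union>E)"]) auto
  then show ?thesis
    by (auto simp: long_cycle_def)
qed

lemma long_cycle_rotate: "long_cycle (p @ q) \<Longrightarrow> long_cycle (q @ p)"
  using cycle_in_rotate[of E p q] by (auto simp: long_cycle_def)

end

section \<open>The longest cycle of a minimal counterexample\<close>

lemma walk_edges_snoc: "p \<noteq> [] \<Longrightarrow> walk_edges (p @ [w]) = walk_edges p @ [{last p, w}]"
proof (cases p rule: rev_cases)
  case (snoc q v)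
  then show ?thesis
    using walk_edges_append[of q v "[w]"] by simp
qed simp

lemma cycle_arcs:
  assumes "cycle_in E (u # X @ v # Y)"
  shows "path_in E (u # X @ [v])" "path_in E (u # rev Y @ [v])"
proof -
  have dist: "distinct (u # X @ v # Y)" and sub: "set (walk_edges (u # X @ v # Y)) \<subseteq> E"
    and close: "{last (v # Y), u} \<in> E"
    using assms by (auto simp: cycle_in_def path_in_def)
  have split: "walk_edges (u # X @ v # Y) = walk_edges (u # X @ [v]) @ walk_edges (v # Y)"
    using walk_edges_append[of "u # X" v Y] by simp
  then show "path_in E (u # X @ [v])"
    using dist sub by (auto simp: path_in_def)
  have "set (walk_edges (u # rev Y @ [v])) = set (walk_edges ((v # Y) @ [u]))"
    using set_walk_edges_rev[of "(v # Y) @ [u]"] by simp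
  also have "\<dots> = insert {last (v # Y), u} (set (walk_edges (v # Y)))"
    by (subst walk_edges_snoc) simp_all
  finally show "path_in E (u # rev Y @ [v])"
    using dist sub close split unfolding path_in_def by auto
qed

lemma cycle_in_join:
  assumes "path_in E (u # X @ [v])" "path_in E (u # rev Y @ [v])" "set X \<inter> set Y = {}" "X \<noteq> [] \<or> Y \<noteq> []"
  shows "cycle_in E (u # X @ v # Y)"
proof -
  have "set (walk_edges (u # rev Y @ [v])) = set (walk_edges ((v # Y) @ [u]))"
    using set_walk_edges_rev[of "(v # Y) @ [u]"] by simp
  also have "\<dots> = insert {last (v # Y), u} (set (walk_edges (v # Y)))"
    by (subst walk_edges_snoc) simp_all
  finally have "set (walk_edges (v # Y)) \<subseteq> E" "{last (v # Y), u} \<in> E"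
    using assms(2) by (auto simp: path_in_def)
  moreover have "walk_edges (u # X @ v # Y) = walk_edges (u # X @ [v]) @ walk_edges (v # Y)"
    using walk_edges_append[of "u # X" v Y] by simp
  moreover have "3 \<le> length (u # X @ v # Y)"
    using assms(4) by (cases X; cases Y) auto
  ultimately show ?thesis
    using assms(1-3) by (auto simp: cycle_in_def path_in_def)
qed

context minimal_counterexample
begin

text \<open>If \<open>y\<close> is not a leaf, then \<open>xy\<close> lies on a return path, whose
  part up to the first cycle vertex is an ear. Such an ear contradicts the length of the cycle, the
  absence of thetas or the degree of \<open>x\<close>.\<close>

lemma off_cycle_leaf:
  assumes long: "long_cycle (x # ps)" and xy: "{x, y} \<in> E" and off: "y \<notin> set (x # ps)"
  shows "leaf_at E x y"
proof (rule ccontr)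
  assume "\<not> leaf_at E x y"
  then obtain e where e: "e \<in> E" "y \<in> e" "e \<noteq> {x, y}"
    by (auto simp: leaf_at_def)
  then obtain y' where y': "e = {y, y'}"
    using two card_2_iff[of e] by (metis insertE insert_commute singletonD)
  have cyc: "cycle_in E (x # ps)"
    using long by (simp add: long_cycle_def)
  then have len: "2 \<le> length ps" and dist: "distinct (x # ps)"
    by (auto simp: cycle_in_def path_in_def)
  then have ne: "ps \<noteq> []"
    by auto
  then have hd: "{x, hd ps} \<in> E" and last: "{x, last ps} \<in> E"
    using cyc by (cases ps; auto simp: cycle_in_def path_in_def insert_commute)+
  have "hd ps \<noteq> last ps"
    using len dist by (cases ps) auto
  have inps: "hd ps \<in> set ps" "last ps \<in> set ps"
    using ne by auto
  let ?D = "E - {{x, y}}"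
  obtain p where p: "path_in ?D p" "p \<noteq> []" "hd p = y" "last p = x"
    using return_path[OF xy hd] off inps e y' by (metis insert_commute list.set_intros(2))
  have "\<exists>z\<in>set p. z \<in> set (x # ps)"
    using p(2,4) last_in_set by fastforce
  then obtain r z s where rz: "p = r @ z # s" "z \<in> set (x # ps)" "\<forall>v\<in>set r. v \<notin> set (x # ps)"
    using split_list_first_prop[of p "\<lambda>z. z \<in> set (x # ps)"] by blast
  have "r \<noteq> []"
    using rz p(3) off by (cases r) auto
  then have hr: "hd r = y"
    using rz(1) p(3) by simp
  have rpath: "path_in ?D (r @ [z])"
    using p(1) rz(1) walk_edges_append[of r z s] by (auto simp: path_in_def)
  have lastr: "{last r, z} \<in> ?D"
    using rpath walk_edges_snoc[OF \<open>r \<noteq> []\<close>, of z] by (auto simp: path_in_def)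
  show False
  \<comment> \<open>An ear returning to \<open>x\<close> itself would give \<open>x\<close> a fourth
    neighbour besides \<open>y\<close> and its two cycle neighbours.\<close>
  proof (cases "z = x")
    case True
    have "last r \<in> set r"
      using \<open>r \<noteq> []\<close> by simp
    then have "last r \<notin> set (x # ps)"
      using rz(3) by blast
    then have "hd ps \<noteq> last r" "last ps \<noteq> last r" "hd ps \<noteq> y" "last ps \<noteq> y"
      using inps off by (metis list.set_intros(2))+
    moreover have "last r \<noteq> y" "{x, last r} \<in> E"
      using lastr True by (auto simp: insert_commute)
    ultimately show False
      using no_four_neighbours[OF hd last xy, of "last r"] \<open>hd ps \<noteq> last ps\<close> by auto
  next
    case False
    then obtain p1 q1 where ps: "ps = p1 @ z # q1"
      using rz(2) split_list[of z ps] by auto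
    have cyc': "cycle_in E (x # p1 @ z # q1)"
      using cyc ps by simp
    note arcs = cycle_arcs[OF cyc']
    have disj: "set r \<inter> set p1 = {}" "set r \<inter> set q1 = {}" "x \<notin> set r" "z \<notin> set r"
      using rz(2,3) ps by auto
    obtain r' where r': "r = y # r'"
      using hr \<open>r \<noteq> []\<close> by (cases r) auto
    have ear: "path_in E (x # r @ [z])"
      using rpath disj False xy r' by (auto simp: path_in_def)
    \<comment> \<open>If one arc of the cycle between \<open>x\<close> and \<open>z\<close> is a
      single edge, replacing it by the ear gives a longer cycle. Otherwise the ear and both arcs
      form a theta.\<close>
    consider "p1 = []" | "q1 = []" | "p1 \<noteq> []" "q1 \<noteq> []"
      by blast
    then show False
    proof cases
      case 1
      have "cycle_in E (x # r @ z # q1)"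
        by (rule cycle_in_join[OF ear arcs(2)]) (use disj \<open>r \<noteq> []\<close> in auto)
      then have "length (x # r @ z # q1) \<le> length (x # ps)"
        using cycle_le_circumference long unfolding long_cycle_def by metis
      then show False
        using 1 ps r' by simp
    next
      case 2
      have "cycle_in E (x # p1 @ z # rev r)"
        by (rule cycle_in_join[OF arcs(1)]) (use ear disj \<open>r \<noteq> []\<close> in auto)
      then have "length (x # p1 @ z # rev r) \<le> length (x # ps)"
        using cycle_le_circumference long unfolding long_cycle_def by metis
      then show False
        using 2 ps r' by simp
    next
      case 3
      have "set p1 \<inter> set (rev q1) = {}"
        using dist ps by auto
      then show False
        using theta arcs ear 3 disj \<open>r \<noteq> []\<close> unfolding theta_free_def
        by (metis Int_commute rev_is_Nil_conv set_rev)
    qed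
  qed
qed

lemma chord_separates:
  assumes "cycle_in E (u # X @ v # Y)" "{u, v} \<in> E" "a \<in> set X" "b \<in> set Y" "{a, b} \<in> E"
  shows False
proof -
  have "set X \<inter> set (rev Y) = {}"
    using assms(1) by (auto simp: cycle_in_def path_in_def)
  moreover have "b \<in> set (rev Y)"
    using assms(4) by simp
  ultimately show False
    using crossing cycle_arcs[OF assms(1)] assms(2,3,5) unfolding crossing_free_def by blast
qed

lemma cycle_neighbour:
  assumes "long_cycle p" "x \<in> set p" "{x, w} \<in> E" "w \<notin> set p"
  shows "leaf_at E x w"
proof -
  obtain r s where p: "p = r @ x # s"
    using assms(2) split_list by metis
  then have "long_cycle (x # s @ r)"
    using long_cycle_rotate[of r "x # s"] assms(1) by simp
  then show ?thesis
    using off_cycle_leaf[of x "s @ r" w] assms(3,4) p by auto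
qed

definition chord_arc :: "'a \<Rightarrow> 'a list \<Rightarrow> 'a \<Rightarrow> 'a list \<Rightarrow> bool" where
  "chord_arc u X v Y \<longleftrightarrow> long_cycle (u # X @ v # Y) \<and> {u, v} \<in> E \<and> X \<noteq> [] \<and> Y \<noteq> []"

text \<open>A neighbour that is not a leaf is on the cycle, and noncrossing chords keep it out of
  \<open>Y\<close>. The ends \<open>u\<close> and \<open>v\<close> already have degree three from
  two cycle edges and the chord, so they are reached only along the cycle.\<close>

lemma chord_arc_neighbour:
  assumes "chord_arc u X v Y" "x \<in> set X" "{x, w} \<in> E" "\<not> leaf_at E x w"
  shows "w \<in> set X \<or> w = u \<and> x = hd X \<or> w = v \<and> x = last X"
proof -
  have long: "long_cycle (u # X @ v # Y)" and uv: "{u, v} \<in> E" and ne: "X \<noteq> []" "Y \<noteq> []"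
    using assms(1) by (auto simp: chord_arc_def)
  then have cyc: "cycle_in E (u # X @ v # Y)" and dist: "distinct (u # X @ v # Y)"
    by (auto simp: long_cycle_def cycle_in_def path_in_def)
  note arcs = cycle_arcs[OF cyc]
  obtain a X' where X: "X = a # X'"
    using ne(1) by (cases X) auto
  obtain b Y' where Y: "Y = b # Y'"
    using ne(2) by (cases Y) auto
  have ends: "{u, hd X} \<in> E" "{u, last Y} \<in> E" "{last X, v} \<in> E" "{v, hd Y} \<in> E"
  proof -
    show "{u, hd X} \<in> E"
      using arcs(1) X by (simp add: path_in_def)
    show "{u, last Y} \<in> E"
      using cyc ne by (simp add: cycle_in_def insert_commute)
    show "{last X, v} \<in> E"
      using arcs(1) walk_edges_snoc[of "u # X" v] ne(1) by (simp add: path_in_def)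
    show "{v, hd Y} \<in> E"
      using arcs(2) walk_edges_snoc[of "u # rev Y" v] ne(2) Y
      by (simp add: path_in_def insert_commute)
  qed
  have "w \<in> set (u # X @ v # Y)"
    using cycle_neighbour[OF long _ assms(3)] assms(2,4) by auto
  moreover have "w \<notin> set Y"
    using chord_separates[OF cyc uv assms(2) _ assms(3)] by blast
  moreover have "x = hd X" if "w = u"
  proof (rule ccontr)
    assume "x \<noteq> hd X"
    moreover have "{u, x} \<in> E" "last Y \<in> set Y" "hd X \<in> set X"
      using assms(3) that ne by (auto simp: insert_commute)
    moreover from this have "hd X \<noteq> last Y" "hd X \<noteq> v" "last Y \<noteq> v" "last Y \<noteq> x" "v \<noteq> x"
      using dist assms(2) by auto
    ultimately show False
      using no_four_neighbours[OF ends(1,2) uv, of x] by auto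
  qed
  moreover have "x = last X" if "w = v"
  proof (rule ccontr)
    assume "x \<noteq> last X"
    moreover have "{v, x} \<in> E" "{v, last X} \<in> E" "{v, u} \<in> E" "hd Y \<in> set Y" "last X \<in> set X"
      using assms(3) that ends(3) uv ne by (auto simp: insert_commute)
    moreover from this have "last X \<noteq> hd Y" "last X \<noteq> u" "hd Y \<noteq> u" "hd Y \<noteq> x" "u \<noteq> x"
      using dist assms(2) by auto
    ultimately show False
      using no_four_neighbours[of v "last X" "hd Y" u x] ends(4) by auto
  qed
  ultimately show ?thesis by auto
qed

text \<open>A chord between vertices of \<open>X\<close> cuts off a strictly shorter side
  \<open>Z\<close> of a rotation of the same cycle. By minimality \<open>Z\<close> is a single
  vertex, and \<open>chord_arc_neighbour\<close> for the new chord confines its neighbours.\<close>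

lemma triangle_chord:
  assumes arc: "chord_arc u X v Y"
    and min: "\<And>u' X' v' Y'. chord_arc u' X' v' Y' \<Longrightarrow> 2 \<le> length X' \<Longrightarrow> length X \<le> length X'"
    and ij: "i < j" "j < length X" "j \<noteq> Suc i" "{X ! i, X ! j} \<in> E"
  shows "j = Suc (Suc i)"
    "{X ! Suc i, w} \<in> E \<Longrightarrow> \<not> leaf_at E (X ! Suc i) w \<Longrightarrow> w = X ! i \<or> w = X ! Suc (Suc i)"
proof -
  define A Z B where "A = take i X" and "Z = take (j - Suc i) (drop (Suc i) X)" and "B = drop (Suc j) X"
  have "drop (Suc i) X = Z @ X ! j # B"
  proof -
    have "drop (Suc i) X = Z @ drop (j - Suc i) (drop (Suc i) X)"
      by (simp only: Z_def append_take_drop_id)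
    also have "drop (j - Suc i) (drop (Suc i) X) = drop j X"
      using ij(1) by simp
    also have "drop j X = X ! j # B"
      using ij(2) by (simp add: B_def Cons_nth_drop_Suc)
    finally show ?thesis .
  qed
  then have X: "X = A @ X ! i # Z @ X ! j # B"
    using id_take_nth_drop[of i X] ij by (simp add: A_def)
  have lenZ: "length Z = j - Suc i"
    using ij by (simp add: Z_def)
  have "long_cycle ((u # A) @ (X ! i # Z @ X ! j # B @ v # Y))"
    using arc X unfolding chord_arc_def by (metis append_Cons append_assoc)
  then have "long_cycle (X ! i # Z @ X ! j # (B @ v # Y @ u # A))"
    using long_cycle_rotate by fastforce
  then have arc': "chord_arc (X ! i) Z (X ! j) (B @ v # Y @ u # A)"
    using ij lenZ by (auto simp: chord_arc_def)
  then have "length Z < 2"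
    using min[OF arc'] lenZ ij by fastforce
  then show j: "j = Suc (Suc i)"
    using lenZ ij by auto
  have Z: "Z = [X ! Suc i]"
    using j ij by (simp add: Z_def take_Suc_conv_app_nth)
  show "w = X ! i \<or> w = X ! Suc (Suc i)"
    if "{X ! Suc i, w} \<in> E" "\<not> leaf_at E (X ! Suc i) w"
    using chord_arc_neighbour[OF arc', of "X ! Suc i" w] that Z j neq by auto
qed

end

section \<open>Reducible blocks on an arc of the cycle\<close>

lemma (in subcubic_edges) delete_arc_psubset:
  assumes "arc_pattern E x ps"
  shows "delete_arc E x (length ps) \<subset> E"
proof -
  let ?k = "length ps"
  have k: "2 \<le> ?k" and inj: "inj_on x {1..?k}" and ends: "x 0 \<notin> x ` {1..?k}" "x (?k + 1) \<notin> x ` {1..?k}"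
    and path: "\<And>i. i \<le> ?k \<Longrightarrow> {x i, x (i + 1)} \<in> E"
    using assms by (auto simp: arc_pattern_def Let_def)
  have "1 \<in> {1..?k}" "2 \<in> {1..?k}"
    using k by auto
  then have on: "x 1 \<in> x ` {1..?k}" "x 2 \<in> x ` {1..?k}"
    by blast+
  have "{x 1, x 2} \<in> E"
    using path[of 1] k by (simp add: numeral_2_eq_2)
  moreover have "{x 1, x 2} \<notin> delete_arc E x ?k"
  proof
    assume "{x 1, x 2} \<in> delete_arc E x ?k"
    then have "{x 1, x 2} = {x 0, x 1} \<or> {x 1, x 2} = {x ?k, x (?k + 1)}"
      using on by (auto simp: delete_arc_def)
    moreover have "x 0 \<noteq> x 1" "x 0 \<noteq> x 2" "x (?k + 1) \<noteq> x 1" "x (?k + 1) \<noteq> x 2"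
      using on ends by metis+
    ultimately show False
      by (auto simp: doubleton_eq_iff)
  qed
  ultimately show ?thesis
    using delete_arc_sub[OF assms] by blast
qed

text \<open>Only inner vertices are compared with the others, so the ends may coincide. Both a side
  of a chord and a whole cycle cut at one vertex are instances.\<close>

locale cycle_arc = minimal_counterexample +
  fixes x :: "nat \<Rightarrow> 'a" and n :: nat
  assumes path: "i \<le> n \<Longrightarrow> {x i, x (Suc i)} \<in> E"
    and x_eq: "1 \<le> i \<Longrightarrow> i \<le> n \<Longrightarrow> j \<le> Suc n \<Longrightarrow> x i = x j \<Longrightarrow> i = j"
begin

text \<open>With \<open>m = j\<close> the last alternative disappears, so \<open>spoke j j\<close>
  expresses that \<open>x j\<close> is pendant.\<close>

definition spoke :: "nat \<Rightarrow> nat \<Rightarrow> bool" where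
  "spoke j m \<longleftrightarrow> (\<forall>w. {x j, w} \<in> E \<longrightarrow>
     w = x (j - 1) \<or> w = x (Suc j) \<or> leaf_at E (x j) w \<or> m \<noteq> j \<and> w = x m)"

text \<open>Entries of \<open>ps\<close> are relative to the offset \<open>s\<close>; the vertex
  \<open>x s\<close> is the left end of the block and not part of it.\<close>

definition fits_block :: "nat \<Rightarrow> nat list \<Rightarrow> bool" where
  "fits_block s ps \<longleftrightarrow> s + length ps \<le> n \<and> 2 \<le> length ps \<and>
     (\<forall>i<length ps. 1 \<le> ps ! i \<and> ps ! i \<le> length ps \<and> spoke (s + Suc i) (s + ps ! i))"

lemma arc_pattern_block:
  assumes "fits_block s ps"
  shows "arc_pattern E (\<lambda>i. x (s + i)) ps"
proof -
  let ?k = "length ps"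
  have sk: "s + ?k \<le> n" and k: "2 \<le> ?k"
    and sp: "\<And>i. i < ?k \<Longrightarrow> 1 \<le> ps ! i \<and> ps ! i \<le> ?k \<and> spoke (s + Suc i) (s + ps ! i)"
    using assms by (auto simp: fits_block_def)
  have eq: "i = j" if "i \<in> {1..?k}" "j \<le> ?k + 1" "x (s + i) = x (s + j)" for i j
    using x_eq[of "s + i" "s + j"] that sk by auto
  have "inj_on (\<lambda>i. x (s + i)) {1..?k}"
    by (rule inj_onI) (use eq in auto)
  moreover have "x (s + 0) \<notin> (\<lambda>i. x (s + i)) ` {1..?k}" "x (s + (?k + 1)) \<notin> (\<lambda>i. x (s + i)) ` {1..?k}"
    using eq[of _ 0] eq[of _ "?k + 1"] by fastforce+
  moreover have "{x (s + i), x (s + (i + 1))} \<in> E" if "i \<le> ?k" for i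
    using path[of "s + i"] that sk by simp
  moreover have "(\<forall>e\<in>E. w \<in> e \<longrightarrow> e = {x (s + i), w}) \<or>
      ps ! (i - 1) \<noteq> i \<and> ps ! (i - 1) \<in> {1..?k} \<and> w = x (s + ps ! (i - 1))"
    if iw: "i \<in> {1..?k}" "{x (s + i), w} \<in> E" "w \<noteq> x (s + (i - 1))" "w \<noteq> x (s + (i + 1))" for i w
  proof -
    obtain m where m: "i = Suc m" "m < ?k"
      using iw(1) by (cases i) auto
    have "leaf_at E (x (s + i)) w \<or> ps ! m \<noteq> i \<and> w = x (s + ps ! m)"
      using sp[OF m(2)] iw(2-4) m(1) by (simp add: spoke_def) blast
    then show ?thesis
      using sp[OF m(2)] m(1) unfolding leaf_at_def by simp
  qed
  ultimately show ?thesis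
    using k unfolding arc_pattern_def Let_def by blast
qed

lemma no_free_block: "fits_block s ps \<Longrightarrow> free_ends ps \<Longrightarrow> False"
  using free_extend minimal bad arc_pattern_block delete_arc_psubset by metis

lemma no_chord_block:
  assumes "fits_block 0 ps" "length ps = n" "chord_ends ps" "{x 0, x (Suc n)} \<in> E"
  shows False
  using chord_extend[of x ps] minimal bad arc_pattern_block[OF assms(1)] delete_arc_psubset[of x ps] assms
  by simp

lemma no_closed_block:
  assumes "fits_block 0 ps" "length ps = n" "closed_ends ps" "x (Suc n) = x 0"
    and "\<And>w. {x 0, w} \<in> E \<Longrightarrow> w \<noteq> x 1 \<Longrightarrow> w \<noteq> x n \<Longrightarrow> leaf_at E (x 0) w"
  shows False
  using closed_extend[of x ps] minimal bad arc_pattern_block[OF assms(1)] delete_arc_psubset[of x ps] assms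
  by (simp add: leaf_at_def)

definition tri :: "nat \<Rightarrow> bool" where
  "tri j \<longleftrightarrow> 1 \<le> j \<and> j + 2 \<le> n \<and> {x j, x (j + 2)} \<in> E"

lemma neighbours_distinct:
  assumes "i \<in> {1..n}" "j \<le> Suc n" "i \<noteq> j"
  shows "x i \<noteq> x j" "x j \<noteq> x i"
  using x_eq[of i j] assms by auto

lemma prev_edge: "1 \<le> j \<Longrightarrow> j \<le> Suc n \<Longrightarrow> {x j, x (j - 1)} \<in> E"
  using path[of "j - 1"] by (auto simp: insert_commute)

lemma tri_spokes:
  assumes "tri j"
  shows "spoke j (j + 2)" "spoke (j + 2) j"
proof -
  have j: "1 \<le> j" "j + 2 \<le> n" and e: "{x j, x (j + 2)} \<in> E" "{x (j + 2), x j} \<in> E"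
    using assms by (auto simp: tri_def insert_commute)
  have ne: "x (j - 1) \<noteq> x (Suc j)" "x (j - 1) \<noteq> x (j + 2)" "x (Suc j) \<noteq> x (j + 2)"
    using neighbours_distinct[of "Suc j" "j - 1"] neighbours_distinct[of "j + 2" "j - 1"]
      neighbours_distinct[of "j + 2" "Suc j"] j by auto
  show "spoke j (j + 2)"
    unfolding spoke_def
    using no_four_neighbours[of "x j" "x (j - 1)" "x (Suc j)" "x (j + 2)"] prev_edge[of j] path[of j] j e ne
    by fastforce
  have ne': "x (j + 3) \<noteq> x (Suc j)" "x (j + 3) \<noteq> x j" "x (Suc j) \<noteq> x j"
    using neighbours_distinct[of "Suc j" "j + 3"] neighbours_distinct[of j "j + 3"]
      neighbours_distinct[of j "Suc j"] j by auto
  have "{x (j + 2), x (j + 3)} \<in> E" "{x (j + 2), x (Suc j)} \<in> E"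
    using path[of "j + 2"] prev_edge[of "j + 2"] j by (simp_all add: eval_nat_numeral)
  then show "spoke (j + 2) j"
    unfolding spoke_def
    using no_four_neighbours[of "x (j + 2)" "x (j + 3)" "x (Suc j)" "x j"] e ne'
    by (fastforce simp: eval_nat_numeral)
qed

lemma not_leaf_on_arc:
  assumes "2 \<le> n" "1 \<le> i" "i \<le> n"
  shows "\<not> leaf_at E v (x i)"
proof
  assume "leaf_at E v (x i)"
  then have "{x i, x (Suc i)} = {v, x i}" "{x i, x (i - 1)} = {v, x i}"
    using path[of i] prev_edge[of i] assms unfolding leaf_at_def by (metis insertI1 le_SucI)+
  then have "v = x (Suc i)" "v = x (i - 1)"
    using neighbours_distinct[of i "Suc i"] neighbours_distinct[of i "i - 1"] assms
    by (auto simp: doubleton_eq_iff)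
  moreover have "x (Suc i) \<noteq> x (i - 1)"
  proof (cases "i = n")
    case True
    then show ?thesis
      using neighbours_distinct[of "i - 1" "Suc i"] assms by auto
  next
    case False
    then show ?thesis
      using neighbours_distinct[of "Suc i" "i - 1"] assms by auto
  qed
  ultimately show False by simp
qed

lemma tri_not_pendant:
  assumes "tri j"
  shows "\<not> spoke j j" "\<not> spoke (j + 2) (j + 2)"
proof -
  have j: "1 \<le> j" "j + 2 \<le> n" and e: "{x j, x (j + 2)} \<in> E" "{x (j + 2), x j} \<in> E"
    using assms by (auto simp: tri_def insert_commute)
  have "x (j + 2) \<noteq> x (j - 1)" "x (j + 2) \<noteq> x (Suc j)" "\<not> leaf_at E (x j) (x (j + 2))"
    using neighbours_distinct[of "j + 2" "j - 1"] neighbours_distinct[of "j + 2" "Suc j"]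
      not_leaf_on_arc[of "j + 2"] j by auto
  then show "\<not> spoke j j"
    using e(1) unfolding spoke_def by blast
  have "x j \<noteq> x (j + 2 - 1)" "x j \<noteq> x (Suc (j + 2))" "\<not> leaf_at E (x (j + 2)) (x j)"
    using neighbours_distinct[of j "j + 1"] neighbours_distinct[of j "Suc (j + 2)"]
      not_leaf_on_arc[of j] j by auto
  then show "\<not> spoke (j + 2) (j + 2)"
    using e(2) unfolding spoke_def by blast
qed

text \<open>The common vertex would have two chords and two arc edges.\<close>

lemma tri_not_consecutive:
  assumes "tri j" "tri (j + 2)"
  shows False
proof -
  have j: "1 \<le> j" "j + 4 \<le> n"
    using assms by (auto simp: tri_def)
  have "{x (j + 2), x j} \<in> E" "{x (j + 2), x (j + 4)} \<in> E"
    using assms by (auto simp: tri_def insert_commute eval_nat_numeral)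
  moreover have "{x (j + 2), x (j + 1)} \<in> E" "{x (j + 2), x (j + 3)} \<in> E"
    using prev_edge[of "j + 2"] path[of "j + 2"] j by (simp_all add: eval_nat_numeral)
  moreover have "x j \<noteq> x (j + 4)" "x j \<noteq> x (j + 1)" "x j \<noteq> x (j + 3)" "x (j + 4) \<noteq> x (j + 1)"
    "x (j + 4) \<noteq> x (j + 3)" "x (j + 1) \<noteq> x (j + 3)"
    using neighbours_distinct j by simp_all
  ultimately show False
    using no_four_neighbours[of "x (j + 2)" "x j" "x (j + 4)" "x (j + 1)" "x (j + 3)"] by simp
qed

text \<open>By \<open>kinds\<close> and \<open>mid\<close> the side spells a word in the letters p
  and t. The case distinction reads it from the left until the word ends, which is a chord pattern,
  or a free block appears. Offset 1 drops a leading p: pt followed by t contains tt, and ppp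
  followed by t contains ppt.\<close>

lemma chord_arc_impossible:
  assumes n: "2 \<le> n" and chord: "{x 0, x (Suc n)} \<in> E"
    and kinds: "\<And>j. 1 \<le> j \<Longrightarrow> j \<le> n \<Longrightarrow> spoke j j \<or> tri j \<or> 3 \<le> j \<and> tri (j - 2)"
    and mid: "\<And>j. tri j \<Longrightarrow> spoke (j + 1) (j + 1)"
  shows False
proof -
  have mid': "\<not> tri (j + 1)" if "tri j" for j
    using mid[OF that] tri_not_pendant(1) by blast
  have tri: "j + 2 \<le> n" "spoke j (j + 2)" "spoke (j + 1) (j + 1)" "spoke (j + 2) j"
    if "tri j" for j
    using tri_spokes[OF that] mid[OF that] that by (auto simp: tri_def)
  have one: "spoke 1 1 \<or> tri 1"
    using kinds[of 1] n by simp
  show False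
  proof (cases "tri 1")
    case t1: True
    note T1 = tri[OF t1, simplified]
    show False
    proof (cases "n = 3")
      case True
      have "fits_block 0 [3, 2, 1]"
        using T1 by (simp add: fits_block_def All_less_Suc numeral_eq_Suc)
      then show False
        using no_chord_block[OF _ _ chord_t chord] True by simp
    next
      case False
      then have "4 \<le> n" using T1 by simp
      \<comment> \<open>The remaining alternative of \<open>kinds\<close> is \<open>tri 2\<close>, a
        triangle starting at the middle vertex of the first one.\<close>
      then have four: "spoke 4 4 \<or> tri 4"
        using kinds[of 4] mid'[OF t1] by (simp add: numeral_eq_Suc)
      show False
      proof (cases "tri 4")
        case True
        from tri[OF this, simplified] T1 show False
          by (intro no_free_block[OF _ free_tt, of 0])
            (simp_all add: fits_block_def All_less_Suc numeral_eq_Suc)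
      next
        case False
        then have s4: "spoke 4 4" using four by blast
        show False
        proof (cases "n = 4")
          case True
          have "fits_block 0 [3, 2, 1, 4]"
            using T1 s4 \<open>4 \<le> n\<close> by (simp add: fits_block_def All_less_Suc numeral_eq_Suc)
          then show False
            using no_chord_block[OF _ _ chord_tp chord] True by simp
        next
          case False
          then have n5: "5 \<le> n" using \<open>4 \<le> n\<close> by simp
          \<comment> \<open>Position 5 could also be the last vertex of \<open>tri 3\<close>, but
            then \<open>x 3\<close> would be on two chords.\<close>
          have "\<not> tri 3"
            using tri_not_consecutive[of 1] t1 by (auto simp: numeral_eq_Suc)
          then consider "spoke 5 5" | "tri 5"
            using kinds[of 5] n5 by (auto simp: numeral_eq_Suc)
          then show False
          proof cases
            case 1
            then show False
              using T1 s4 n5 by (intro no_free_block[OF _ free_tpp, of 0])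
                (simp_all add: fits_block_def All_less_Suc numeral_eq_Suc)
          next
            case 2
            from tri[OF this, simplified] T1 s4 show False
              by (intro no_free_block[OF _ free_tpt, of 0])
                (simp_all add: fits_block_def All_less_Suc numeral_eq_Suc)
          qed
        qed
      qed
    qed
  next
    case nt1: False
    then have s1: "spoke 1 1" using one by blast
    have two: "spoke 2 2 \<or> tri 2"
      using kinds[of 2] n by simp
    show False
    proof (cases "tri 2")
      case t2: True
      note T2 = tri[OF t2, simplified]
      show False
      proof (cases "n = 4")
        case True
        have "fits_block 0 [1, 4, 3, 2]"
          using T2 s1 by (simp add: fits_block_def All_less_Suc numeral_eq_Suc)
        then show False
          using no_chord_block[OF _ _ chord_pt chord] True by simp
      next
        case False
        then have n5: "5 \<le> n" using T2 by simp
        \<comment> \<open>\<open>x 3\<close> is the middle vertex of \<open>tri 2\<close>, so a new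
          letter starts at position 5.\<close>
        have "\<not> tri 3"
          using mid'[OF t2] by (simp add: numeral_eq_Suc)
        then consider "spoke 5 5" | "tri 5"
          using kinds[of 5] n5 by (auto simp: numeral_eq_Suc)
        then show False
        proof cases
          case 1
          then show False
            using T2 s1 n5 by (intro no_free_block[OF _ free_ptp, of 0])
              (simp_all add: fits_block_def All_less_Suc numeral_eq_Suc)
        next
          case 2
          from tri[OF this, simplified] T2 show False
            by (intro no_free_block[OF _ free_tt, of 1])
              (simp_all add: fits_block_def All_less_Suc numeral_eq_Suc)
        qed
      qed
    next
      case nt2: False
      then have s2: "spoke 2 2" using two by blast
      show False
      proof (cases "n = 2")
        case True
        have "fits_block 0 [1, 2]"
          using s1 s2 n by (simp add: fits_block_def All_less_Suc numeral_eq_Suc)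
        then show False
          using no_chord_block[OF _ _ chord_pp chord] True by simp
      next
        case False
        then have n3: "3 \<le> n" using n by simp
        then consider "tri 3" | "spoke 3 3"
          using kinds[of 3] nt1 by auto
        then show False
        proof cases
          case 1
          from tri[OF this, simplified] s1 s2 show False
            by (intro no_free_block[OF _ free_ppt, of 0])
              (simp_all add: fits_block_def All_less_Suc numeral_eq_Suc)
        next
          case s3: 2
          show False
          proof (cases "n = 3")
            case True
            have "fits_block 0 [1, 2, 3]"
              using s1 s2 s3 n3 by (simp add: fits_block_def All_less_Suc numeral_eq_Suc)
            then show False
              using no_chord_block[OF _ _ chord_ppp chord] True by simp
          next
            case False
            then have n4: "4 \<le> n" using n3 by simp
            then consider "tri 4" | "spoke 4 4"
              using kinds[of 4] nt2 by (auto simp: numeral_eq_Suc)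
            then show False
            proof cases
              case 1
              from tri[OF this, simplified] s2 s3 show False
                by (intro no_free_block[OF _ free_ppt, of 1])
                  (simp_all add: fits_block_def All_less_Suc numeral_eq_Suc)
            next
              case 2
              then show False
                using s1 s2 s3 n4 by (intro no_free_block[OF _ free_pppp, of 0])
                  (simp_all add: fits_block_def All_less_Suc numeral_eq_Suc)
            qed
          qed
        qed
      qed
    qed
  qed
qed

text \<open>The cycle has \<open>n + 1\<close> vertices. From \<open>n = 4\<close> on the block pppp
  fits; for \<open>n = 4\<close> its two ends coincide, which the free tables permit. The triangle
  and the 4-cycle are left to the closed patterns.\<close>

lemma pendant_cycle_impossible:
  assumes "2 \<le> n" "x (Suc n) = x 0"
    and pend: "\<And>j. 1 \<le> j \<Longrightarrow> j \<le> n \<Longrightarrow> spoke j j"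
    and "\<And>w. {x 0, w} \<in> E \<Longrightarrow> w \<noteq> x 1 \<Longrightarrow> w \<noteq> x n \<Longrightarrow> leaf_at E (x 0) w"
  shows False
proof -
  consider "n = 2" | "n = 3" | "4 \<le> n"
    using assms(1) by linarith
  then show False
  proof cases
    case 1
    have "fits_block 0 [1, 2]"
      using pend assms(1) by (simp add: fits_block_def All_less_Suc numeral_eq_Suc)
    then show False
      using no_closed_block[OF _ _ closed_pp assms(2,4)] 1 by simp
  next
    case 2
    then have "3 \<le> n"
      by simp
    then have "fits_block 0 [1, 2, 3]"
      using pend by (simp add: fits_block_def All_less_Suc numeral_eq_Suc)
    then show False
      using no_closed_block[OF _ _ closed_ppp assms(2,4)] 2 by simp
  next
    case 3
    then show False
      using pend by (intro no_free_block[OF _ free_pppp, of 0])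
        (simp_all add: fits_block_def All_less_Suc numeral_eq_Suc)
  qed
qed

end

lemma walk_edge_nth:
  assumes "set (walk_edges p) \<subseteq> E" "Suc i < length p"
  shows "{p ! i, p ! Suc i} \<in> E"
proof -
  have "{p ! i, p ! Suc i} = walk_edges p ! i" "i < length (walk_edges p)"
    using assms(2) by (auto simp: walk_edges_def nth_tl)
  then show ?thesis
    using assms(1) by (metis nth_mem subsetD)
qed

lemma nth_between_ends_eq:
  assumes "distinct X" "a \<notin> set X" "b \<notin> set X" "1 \<le> i" "i \<le> length X" "j \<le> Suc (length X)"
    and "(a # X @ [b]) ! i = (a # X @ [b]) ! j"
  shows "i = j"
proof -
  obtain m where m: "i = Suc m" "m < length X"
    using assms(4,5) by (cases i) auto
  have xi: "(a # X @ [b]) ! i = X ! m"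
    using m by (simp add: nth_append)
  show ?thesis
  proof (cases j)
    case 0
    then show ?thesis
      using xi assms(2,7) m(2) by (metis nth_Cons_0 nth_mem)
  next
    case (Suc l)
    have d: "distinct (X @ [b])"
      using assms(1,3) by simp
    have "(X @ [b]) ! m = (X @ [b]) ! l"
      using assms(7) m Suc by simp
    then have "m = l"
      using nth_eq_iff_index_eq[OF d, of m l] m(2) Suc assms(6) by simp
    then show ?thesis
      using m Suc by simp
  qed
qed

section \<open>Excluding chords of the longest cycle\<close>

context minimal_counterexample
begin

lemma cycle_arc_list:
  assumes "distinct X" "a \<notin> set X" "b \<notin> set X" "set (walk_edges (a # X @ [b])) \<subseteq> E"
  shows "cycle_arc E ((!) (a # X @ [b])) (length X)"
proof unfold_locales
  show "{(a # X @ [b]) ! i, (a # X @ [b]) ! Suc i} \<in> E" if "i \<le> length X" for i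
    using walk_edge_nth[OF assms(4), of i] that by simp
  show "i = j" if "1 \<le> i" "i \<le> length X" "j \<le> Suc (length X)" "(a # X @ [b]) ! i = (a # X @ [b]) ! j" for i j
    using nth_between_ends_eq[OF assms(1-3) that] .
qed

lemma no_long_chord_arc:
  assumes "chord_arc u X v Y" "2 \<le> length X"
  shows False
proof -
  \<comment> \<open>The minimum is taken over all chords of all longest cycles and over both sides,
    which allows the comparison with chords of a rotated cycle in
    \<open>triangle_chord\<close>.\<close>
  define P where "P X \<longleftrightarrow> (\<exists>u v Y. chord_arc u X v Y) \<and> 2 \<le> length X" for X
  have "P X"
    using assms by (auto simp: P_def)
  then obtain X where "P X" and least: "\<forall>X'. P X' \<longrightarrow> length X \<le> length X'"
    using ex_has_least_nat[of P X length] by blast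
  then obtain u v Y where arc: "chord_arc u X v Y" and two: "2 \<le> length X"
    by (auto simp: P_def)
  have min: "length X \<le> length X'" if "chord_arc u' X' v' Y'" "2 \<le> length X'" for u' X' v' Y'
    using least that by (auto simp: P_def)
  let ?x = "(!) (u # X @ [v])" and ?n = "length X"
  have chord1: "j = Suc (Suc i)"
    if "i < j" "j < ?n" "j \<noteq> Suc i" "{X ! i, X ! j} \<in> E" for i j
    by (rule triangle_chord(1)[OF arc _ that]) (rule min)
  have chord2: "w = X ! i \<or> w = X ! Suc (Suc i)"
    if "Suc (Suc i) < ?n" "{X ! i, X ! Suc (Suc i)} \<in> E" "{X ! Suc i, w} \<in> E"
      "\<not> leaf_at E (X ! Suc i) w" for i w
    by (rule triangle_chord(2)[OF arc _ _ that(1) _ that(2-4)]) (rule min, auto)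
  have cyc: "cycle_in E (u # X @ v # Y)" and dist: "distinct (u # X @ v # Y)" and uv: "{u, v} \<in> E"
    using arc by (auto simp: chord_arc_def long_cycle_def cycle_in_def path_in_def)
  interpret cycle_arc E ?x ?n
    by (rule cycle_arc_list) (use dist cycle_arcs(1)[OF cyc] in \<open>auto simp: path_in_def\<close>)
  have x: "?x (Suc i) = X ! i" if "i < ?n" for i
    using that by (simp add: nth_append)
  have x_end: "?x 0 = u" "?x (Suc ?n) = v"
    by simp_all
  have "X \<noteq> []"
    using two by auto
  then have hd: "hd X = X ! 0" and last: "last X = X ! (?n - 1)"
    by (simp_all add: hd_conv_nth last_conv_nth)
  show False
  proof (rule chord_arc_impossible)
    show "2 \<le> ?n" by (rule two)
    show "{?x 0, ?x (Suc ?n)} \<in> E"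
      using uv by simp
    \<comment> \<open>A third neighbour of \<open>x j\<close> that is not a leaf lies in
      \<open>X\<close> and, by minimality, two places away. If it is ahead, \<open>j\<close> is the
      first vertex of a triangle; if it is behind, the last one.\<close>
    show "spoke j j \<or> tri j \<or> 3 \<le> j \<and> tri (j - 2)" if j: "1 \<le> j" "j \<le> ?n" for j
    proof (cases "spoke j j")
      case False
      obtain i where i: "j = Suc i" "i < ?n"
        using j by (cases j) auto
      obtain w where w: "{X ! i, w} \<in> E" "w \<noteq> ?x i" "w \<noteq> ?x (Suc j)" "\<not> leaf_at E (X ! i) w"
        using False x[OF i(2)] i(1) unfolding spoke_def by auto
      have "w \<in> set X"
        using chord_arc_neighbour[OF arc nth_mem[OF i(2)] w(1,4)]
      proof (elim disjE conjE)
        assume "w = u" "X ! i = hd X"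
        then have "i = 0"
          using hd dist i(2) \<open>X \<noteq> []\<close> nth_eq_iff_index_eq[of X i 0] by auto
        then show ?thesis
          using w(2) \<open>w = u\<close> by simp
      next
        assume "w = v" "X ! i = last X"
        then have "i = ?n - 1"
          using last dist i(2) \<open>X \<noteq> []\<close> nth_eq_iff_index_eq[of X i "?n - 1"] by auto
        then have "Suc j = Suc ?n"
          using i by simp
        then show ?thesis
          using w(3) \<open>w = v\<close> x_end(2) by simp
      qed auto
      then obtain m where m: "w = X ! m" "m < ?n"
        by (metis in_set_conv_nth)
      consider "i < m" | "m < i" | "m = i"
        by linarith
      then show ?thesis
      proof cases
        case 1
        have "m \<noteq> Suc i"
          using w(3) m x[of m] i(1) by auto
        then have "m = Suc (Suc i)"
          using chord1[OF 1 m(2)] w(1) m(1) by blast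
        then have "tri j"
          using w(1) m x[OF i(2)] x[OF m(2)] i by (simp add: tri_def)
        then show ?thesis by blast
      next
        case 2
        have "i \<noteq> Suc m"
          using w(2) m x[of m] by auto
        moreover have mi: "{X ! m, X ! i} \<in> E"
          using w(1) m(1) by (simp add: insert_commute)
        ultimately have "i = Suc (Suc m)"
          using chord1[OF 2 i(2)] by blast
        then have "tri (Suc m)" "j = Suc m + 2"
          using mi x[OF i(2)] x[OF m(2)] i by (simp_all add: tri_def)
        then show ?thesis by auto
      next
        case 3
        then show ?thesis
          using neq w(1) m(1) by blast
      qed
    qed blast
    show "spoke (j + 1) (j + 1)" if "tri j" for j
    proof -
      obtain i where i: "j = Suc i" "Suc (Suc i) < ?n"
        using \<open>tri j\<close> by (cases j) (auto simp: tri_def)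
      have "{X ! i, X ! Suc (Suc i)} \<in> E"
        using \<open>tri j\<close> x[of i] x[of "Suc (Suc i)"] i by (simp add: tri_def)
      then have "w = X ! i \<or> w = X ! Suc (Suc i)"
        if "{X ! Suc i, w} \<in> E" "\<not> leaf_at E (X ! Suc i) w" for w
        using chord2[OF i(2) _ that] by simp
      then show ?thesis
        using x[of i] x[of "Suc i"] x[of "Suc (Suc i)"] i by (auto simp: spoke_def)
    qed
  qed
qed

lemma chord_arc_swap:
  assumes "chord_arc u X v Y"
  shows "chord_arc v Y u X"
  using assms long_cycle_rotate[of "u # X" "v # Y"] by (auto simp: chord_arc_def insert_commute)

lemma no_chord_arc: "\<not> chord_arc u X v Y"
proof
  assume arc: "chord_arc u X v Y"
  have "\<not> 2 \<le> length X" "\<not> 2 \<le> length Y"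
    using no_long_chord_arc[OF arc] no_long_chord_arc[OF chord_arc_swap[OF arc]] by blast+
  moreover have "X \<noteq> []" "Y \<noteq> []"
    using arc by (simp_all add: chord_arc_def)
  ultimately obtain a b where XY: "X = [a]" "Y = [b]"
    by (cases X; cases "tl X"; cases Y; cases "tl Y") auto
  then have arc1: "chord_arc u [a] v [b]" and arc2: "chord_arc v [b] u [a]"
    using arc chord_arc_swap by auto
  have cyc: "cycle_in E [u, a, v, b]" and dist: "distinct [u, a, v, b]" and uv: "{u, v} \<in> E"
    using arc1 by (auto simp: chord_arc_def long_cycle_def cycle_in_def path_in_def)
  then have e: "{u, a} \<in> E" "{a, v} \<in> E" "{v, b} \<in> E" "{b, u} \<in> E"
    by (auto simp: cycle_in_def path_in_def)
  \<comment> \<open>Both sides of the chord now have one inner vertex. Cutting the 4-cycle at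
    \<open>a\<close> turns \<open>v\<close>, \<open>b\<close>, \<open>u\<close> with the chord
    \<open>uv\<close> into the pattern t whose two ends coincide in \<open>a\<close>.\<close>
  interpret cycle_arc E "(!) (a # [v, b, u] @ [a])" "length [v, b, u]"
    by (rule cycle_arc_list) (use dist e in \<open>auto simp: insert_commute\<close>)
  have nbv: "w \<in> {a, b, u}" if "{v, w} \<in> E" for w
    using no_four_neighbours[of v a b u w] e uv that dist by (auto simp: insert_commute)
  have nbu: "w \<in> {a, b, v}" if "{u, w} \<in> E" for w
    using no_four_neighbours[of u a b v w] e uv that dist by (auto simp: insert_commute)
  have nbb: "w \<in> {u, v} \<or> leaf_at E b w" if "{b, w} \<in> E" for w
    using chord_arc_neighbour[OF arc2, of b w] that neq[OF that] by auto
  have nba: "w \<in> {u, v} \<or> leaf_at E a w" if "{a, w} \<in> E" for w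
    using chord_arc_neighbour[OF arc1, of a w] that neq[OF that] by auto
  have "fits_block 0 [3, 2, 1]"
    unfolding fits_block_def spoke_def
    using nbv nbu nbb by (simp add: All_less_Suc numeral_eq_Suc) blast
  then show False
    by (rule no_closed_block[OF _ _ closed_t]) (use nba in auto)
qed

lemma contradiction: False
proof -
  obtain p where p: "long_cycle p"
    using long_cycle_exists by blast
  then obtain u X where uX: "p = u # X"
    by (cases p) (auto simp: long_cycle_def cycle_in_def)
  have cyc: "cycle_in E (u # X)"
    using p uX by (simp add: long_cycle_def)
  then have dist: "distinct (u # X)" and len: "2 \<le> length X" and sub: "set (walk_edges (u # X)) \<subseteq> E"
    and close: "{last (u # X), u} \<in> E"
    by (auto simp: cycle_in_def path_in_def)
  let ?x = "(!) (u # X @ [u])" and ?n = "length X"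
  have walk: "set (walk_edges (u # X @ [u])) \<subseteq> E"
    using sub close walk_edges_snoc[of "u # X" u] by simp
  interpret cycle_arc E ?x ?n
    by (rule cycle_arc_list) (use dist walk in auto)
  \<comment> \<open>Any other neighbour on the cycle would be the far end of a chord with both sides
    nonempty, which \<open>no_chord_arc\<close> excludes; neighbours off the cycle are leaves. It is
    applied to every rotation of the cycle.\<close>
  have key: "w = hd s \<or> w = last s \<or> leaf_at E y w"
    if "long_cycle (y # s)" "{y, w} \<in> E" for y s w
  proof (cases "w \<in> set (y # s)")
    case True
    then have "w \<in> set s"
      using neq[OF that(2)] by auto
    then obtain A B where s: "s = A @ w # B"
      using split_list by metis
    then have "A = [] \<or> B = []"
      using no_chord_arc[of y A w B] that by (auto simp: chord_arc_def)
    then show ?thesis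
      using s by auto
  next
    case False
    then show ?thesis
      using off_cycle_leaf[OF that] by simp
  qed
  have ne: "X \<noteq> []"
    using len by auto
  show False
  proof (rule pendant_cycle_impossible)
    show "2 \<le> ?n" by (rule len)
    show "?x (Suc ?n) = ?x 0" by simp
    show "leaf_at E (?x 0) w" if "{?x 0, w} \<in> E" "w \<noteq> ?x 1" "w \<noteq> ?x ?n" for w
    proof -
      have "hd X = ?x 1" "last X = ?x ?n"
        using ne by (auto simp: hd_conv_nth last_conv_nth nth_append nth_Cons')
      then show ?thesis
        using key[of u X w] p uX that by simp
    qed
    show "spoke j j" if j: "1 \<le> j" "j \<le> ?n" for j
    proof -
      obtain i where i: "j = Suc i" "i < ?n"
        using j by (cases j) auto
      have X: "X = take i X @ X ! i # drop (Suc i) X"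
        using i(2) by (rule id_take_nth_drop)
      let ?s = "drop (Suc i) X @ u # take i X"
      have "long_cycle ((u # take i X) @ (X ! i # drop (Suc i) X))"
        using p uX X by simp
      then have long: "long_cycle (X ! i # ?s)"
        using long_cycle_rotate by fastforce
      have "hd ?s = ?x (Suc j)"
        using i by (cases "Suc i < ?n") (auto simp: nth_append hd_append hd_drop_conv_nth)
      moreover have "last ?s = ?x (j - 1)"
        using i by (cases i) (auto simp: nth_append take_Suc_conv_app_nth)
      moreover have "?x j = X ! i"
        using i by (simp add: nth_append)
      ultimately show ?thesis
        using key[OF long] by (auto simp: spoke_def)
    qed
  qed
qed

end

lemma path_in_mono: "path_in F p \<Longrightarrow> F \<subseteq> E \<Longrightarrow> path_in E p"
  by (auto simp: path_in_def)

theorem five_colorable_if_theta_crossing_free: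
  assumes "subcubic_edges E" "theta_free E" "crossing_free E"
  shows "five_colorable E"
  using assms
proof (induction "card E" arbitrary: E rule: less_induct)
  case less
  interpret subcubic_edges E
    by (rule less.prems(1))
  show ?case
  proof (rule ccontr)
    assume bad: "\<not> five_colorable E"
    have "five_colorable F" if F: "F \<subset> E" for F
    proof (rule less.hyps)
      show "card F < card E"
        using F fin by (rule psubset_card_mono[rotated])
      show "subcubic_edges F"
        using F subset by blast
      show "theta_free F" "crossing_free F"
        using less.prems(2,3) F path_in_mono[of F _ E] unfolding theta_free_def crossing_free_def
        by (meson psubset_imp_subset subsetD)+
    qed
    then interpret minimal_counterexample E
      using less.prems(2,3) bad by unfold_locales
    show False
      by (rule contradiction)
  qed
qed

theorem theorem8:
  fixes V :: "'a set" and E :: "'a set set"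
  assumes "finite_simple_graph V E"
    and "subcubic V E"
    and "outerplanar V E"
  shows "star_chromatic_index V E \<le> 5"
proof -
  interpret finite_simple_graph V E
    by (rule assms(1))
  have "subcubic_edges E"
  proof
    show "card {e \<in> E. v \<in> e} \<le> 3" for v
    proof (cases "v \<in> V")
      case True
      then show ?thesis
        using assms(2) by (simp add: subcubic_def vertex_degree_def)
    next
      case False
      then have none: "{e \<in> E. v \<in> e} = {}"
        using edges_in_vertices by blast
      show ?thesis
        unfolding none by simp
    qed
  qed (use finite_edges edges_two_ends in auto)
  then have "five_colorable E"
    using outerplanar_theta_crossing_free[OF assms(1,3)] five_colorable_if_theta_crossing_free by blast
  then obtain c where "star_coloring E c" "c ` E \<subseteq> {..<5}"
    by (auto simp: five_colorable_def)
  then have "star_edge_colorable V E 5"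
    using star_edge_coloring_if_star_coloring edges_two_ends unfolding star_edge_colorable_def by blast
  then show ?thesis
    unfolding star_chromatic_index_def by (rule Least_le)
qed

end
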